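(* Let $F$ be an arbitrary field. Every three-dimensional Poisson algebra over $F$ is isomorphic to one of the algebras $$P_{3,1},\ P_{3,2},\ P_{3,3},\ P_{3,4}(M),\ P_{3,5},\ P_{3,6},\ P_{3,7},\ P_{3,8},\ P_{3,9}(E),\ P_{3,10},\ P_{3,11},\ P_{3,12}(E),\ P_{3,13}(K),\ P_{3,14},\ P_{3,15},$$ $$P_{3,16}(M),\quad P_{3,17},\ P_{3,18},\ P_{3,19},\ P_{3,20},\quad P_{3,21}(A),\quad P_{3,22}(q)\ \text{ (only if } \operatorname{char}(F)=2),\quad P_{3,23}(\mathfrak s)$$ defined in the context. The parameters are subject precisely to the following identifications: (a) $P_{3,4}(M)\cong P_{3,4}(M')$ if and only if $M'=\lambda C^{T}MC$ for some $C\in GL_2(F)$ and $\lambda\in F^\times$; (b) $P_{3,16}(M)\cong P_{3,16}(M')$ if and only if $M'=\frac{1}{\det C}C^{T}MC$ for some $C\in GL_2(F)$; (c) $P_{3,21}(A)\cong P_{3,21}(A')$ if and only if $A'=\lambda SAS^{-1}$ for some $S\in GL_2(F)$ and $\lambda\in F^\times$; (d) (when $\operatorname{char}(F)=2$) $P_{3,22}(q)\cong P_{3,22}(q')$ if and only if $q=q'$; (e) the field extensions occurring in $P_{3,9}(E)$, $P_{3,12}(E)$ and $P_{3,13}(K)$ are taken up to $F$-algebra isomorphism; (f) in the family $P_{3,23}(\mathfrak s)$, the parameter $\mathfrak s$ runs through the $F$-isomorphism classes of three-dimensional simple Lie algebras over $F$; thus $P_{3,23}(\mathfrak s)\cong P_{3,23}(\mathfrak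 s')$ if and only if $\mathfrak s\cong_F\mathfrak s'$.
   Context: A Poisson algebra over a field $F$ is an $F$-vector space $P$ with two $F$-bilinear operations: a commutative associative multiplication $(x,y)\mapsto xy$ (not assumed to have an identity) and a Lie multiplication $(x,y)\mapsto[x,y]$ (alternating, $[x,x]=0$ for all $x$, and satisfying the Jacobi identity), such that $[xy,z]=x[y,z]+y[x,z]$ for all $x,y,z\in P$. An isomorphism of Poisson algebras is an $F$-linear bijection preserving both multiplications. No restriction on $\operatorname{char}(F)$ is imposed unless stated. In the following list, all products and brackets of basis elements that are neither displayed nor determined from the displayed ones by commutativity, bilinearity and alternation are zero. Algebras with zero Lie multiplication: - $P_{3,1}$: three-dimensional, all associative products zero. - $P_{3,2}=Fe\oplus Fx\oplus Fy$: $e^2=e$. - $P_{3,3}=Fx\oplus Fy\oplus Fz$: $x^2=z$. - $P_{3,4}(M)=Fx\oplus Fy\oplus Fz$: $x^2=\alpha z$, $xy=\beta z$, $y^2=\gamma z$, where $M=\begin{pmatrix}\alpha&\beta\\ \beta&\gamma\end{pmatrix}$ is a symmetric matrix over $F$ with $\det M\ne0$. - $P_{3,5}=Fx\oplus Fy\oplus Fz$: $x^2=y$, $xy=z$. - $P_{3,6}=Fe\oplus Fx\oplus Fy$: $e^2=e$, $x^2=y$. - $P_{3,7}=Fe_1\oplus Fe_2\oplus Fz$: $e_1^2=e_1$, $e_2^2=e_2$. - $P_{3,8}=Fe\oplus Fu\oplus Fz$: $e^2=e$, $eu=u$, $u^2=0$. - $P_{3,9}(E)=E\oplus Fz$, where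 $E/F$ is a quadratic field extension, $E$ has its ordinary field multiplication, and $z$ multiplies every element to $0$. - $P_{3,10}\cong F\times F\times F$. - $P_{3,11}\cong F\times F[\varepsilon]/(\varepsilon^2)$. - $P_{3,12}(E)\cong F\times E$, where $E/F$ is a quadratic field extension. - $P_{3,13}(K)=K$, where $K/F$ is a cubic field extension. - $P_{3,14}=Fe\oplus Fu\oplus Fv$: $e^2=e$, $eu=u$, $ev=v$, $u^2=uv=v^2=0$. - $P_{3,15}=Fe\oplus Fu\oplus Fv$: $e^2=e$, $eu=u$, $ev=v$, $u^2=v$, $uv=v^2=0$ (equivalently $F[t]/(t^3)$). Algebras with non-zero Lie multiplication: - $P_{3,16}(M)=Fx\oplus Fy\oplus Fz$: $[x,y]=z$, $x^2=\alpha z$, $xy=\beta z$, $y^2=\gamma z$, $xz=yz=z^2=0$, where $M=\begin{pmatrix}\alpha&\beta\\ \beta&\gamma\end{pmatrix}$ is any symmetric $2\times2$ matrix over $F$ (possibly zero). - $P_{3,17},\dots,P_{3,20}$, each on $Fx\oplus Fy\oplus Fz$ with $[x,y]=y$ and $z$ Lie-central: $P_{3,17}$ has zero associative multiplication; $P_{3,18}$: $x^2=z$; $P_{3,19}$: $z^2=z$; $P_{3,20}$: $z^2=z$, $zx=x$, $zy=y$. - $P_{3,21}(A)=Fx\oplus V$ with $V=F^2$ and $A\in GL_2(F)$: $[x,v]=A(v)$ for $v\in V$, $[V,V]=0$, zero associative multiplication. - $P_{3,22}(q)=Fx\oplus Fu\oplus Fv$, defined for $\operatorname{char}(F)=2$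 and $q\in F$: $[x,u]=u$, $[x,v]=v+qu$, $xv=u$. - $P_{3,23}(\mathfrak s)$: a three-dimensional simple Lie algebra $\mathfrak s$ over $F$, with zero associative multiplication. *)

theory Defs
  imports "HOL-Analysis.Analysis"
begin

text \<open>
  An algebra over a field \<open>'f\<close> has as underlying additive group a whole type \<open>'v\<close>.  The scalar
  multiplication is part of the structure, since one type may carry several vector space structures.
  The operation \<open>mul\<close> is the product of an associative algebra or the bracket of a Lie algebra.
\<close>

record ('f, 'v) alg =
  smul :: "'f \<Rightarrow> 'v \<Rightarrow> 'v"
  mul :: "'v \<Rightarrow> 'v \<Rightarrow> 'v"

record ('f, 'v) poisson =
  psmul :: "'f \<Rightarrow> 'v \<Rightarrow> 'v"
  pmul :: "'v \<Rightarrow> 'v \<Rightarrow> 'v"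
  brk :: "'v \<Rightarrow> 'v \<Rightarrow> 'v"

definition algebra_over_field :: "('f::field, 'v::ab_group_add) alg \<Rightarrow> bool" where
  "algebra_over_field A \<longleftrightarrow> vector_space (smul A) \<and>
     (\<forall>x. Vector_Spaces.linear (smul A) (smul A) (\<lambda>y. mul A x y)) \<and>
     (\<forall>y. Vector_Spaces.linear (smul A) (smul A) (\<lambda>x. mul A x y))"

definition comm_assoc_algebra :: "('f::field, 'v::ab_group_add) alg \<Rightarrow> bool" where
  "comm_assoc_algebra A \<longleftrightarrow> algebra_over_field A \<and>
     (\<forall>x y. mul A x y = mul A y x) \<and>
     (\<forall>x y z. mul A (mul A x y) z = mul A x (mul A y z))"

definition lie_algebra :: "('f::field, 'v::ab_group_add) alg \<Rightarrow> bool" where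
  "lie_algebra L \<longleftrightarrow> algebra_over_field L \<and>
     (\<forall>x. mul L x x = 0) \<and>
     (\<forall>x y z. mul L x (mul L y z) + mul L y (mul L z x) + mul L z (mul L x y) = 0)"

definition simple_lie_algebra :: "('f::field, 'v::ab_group_add) alg \<Rightarrow> bool" where
  "simple_lie_algebra L \<longleftrightarrow> lie_algebra L \<and> (\<exists>x y. mul L x y \<noteq> 0) \<and>
     (\<forall>I. module.subspace (smul L) I \<and> (\<forall>x. \<forall>y\<in>I. mul L x y \<in> I) \<longrightarrow> I = {0} \<or> I = UNIV)"

text \<open>An extension field of \<open>'f\<close>, viewed as a unital commutative algebra in which every non-zero
  element is invertible; \<open>'f\<close> is embedded as the scalar multiples of the identity.\<close>

definition field_extension :: "('f::field, 'v::ab_group_add) alg \<Rightarrow> bool" where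
  "field_extension E \<longleftrightarrow> comm_assoc_algebra E \<and>
     (\<exists>u. u \<noteq> 0 \<and> (\<forall>x. mul E u x = x) \<and> (\<forall>x. x \<noteq> 0 \<longrightarrow> (\<exists>y. mul E x y = u)))"

text \<open>For an infinite-dimensional space \<open>dim UNIV\<close> is \<open>0\<close>, so \<open>alg_dim A = n\<close> with \<open>n > 0\<close> includes
  finite dimensionality.\<close>

definition alg_dim :: "('f::field, 'v::ab_group_add) alg \<Rightarrow> nat" where
  "alg_dim A = vector_space.dim (smul A) UNIV"

definition quadratic_extension :: "('f::field, 'v::ab_group_add) alg \<Rightarrow> bool" where
  "quadratic_extension E \<longleftrightarrow> field_extension E \<and> alg_dim E = 2"

definition cubic_extension :: "('f::field, 'v::ab_group_add) alg \<Rightarrow> bool" where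
  "cubic_extension K \<longleftrightarrow> field_extension K \<and> alg_dim K = 3"

definition simple_lie_algebra3 :: "('f::field, 'v::ab_group_add) alg \<Rightarrow> bool" where
  "simple_lie_algebra3 L \<longleftrightarrow> simple_lie_algebra L \<and> alg_dim L = 3"

definition alg_iso :: "('f::field, 'v::ab_group_add) alg \<Rightarrow> ('f, 'w::ab_group_add) alg \<Rightarrow> bool"
    (infix "\<cong>\<^sub>A" 50) where
  "A \<cong>\<^sub>A B \<longleftrightarrow> (\<exists>f. Vector_Spaces.linear (smul A) (smul B) f \<and> bij f \<and>
     (\<forall>x y. f (mul A x y) = mul B (f x) (f y)))"

definition assoc_part :: "('f, 'v) poisson \<Rightarrow> ('f, 'v) alg" where
  "assoc_part P = \<lparr>smul = psmul P, mul = pmul P\<rparr>"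

definition lie_part :: "('f, 'v) poisson \<Rightarrow> ('f, 'v) alg" where
  "lie_part P = \<lparr>smul = psmul P, mul = brk P\<rparr>"

definition poisson_algebra :: "('f::field, 'v::ab_group_add) poisson \<Rightarrow> bool" where
  "poisson_algebra P \<longleftrightarrow> comm_assoc_algebra (assoc_part P) \<and> lie_algebra (lie_part P) \<and>
     (\<forall>x y z. brk P (pmul P x y) z = pmul P x (brk P y z) + pmul P y (brk P x z))"

definition poisson_dim :: "('f::field, 'v::ab_group_add) poisson \<Rightarrow> nat" where
  "poisson_dim P = vector_space.dim (psmul P) UNIV"

definition poisson_iso ::
    "('f::field, 'v::ab_group_add) poisson \<Rightarrow> ('f, 'w::ab_group_add) poisson \<Rightarrow> bool"
    (infix "\<cong>\<^sub>P" 50) where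
  "P \<cong>\<^sub>P Q \<longleftrightarrow> (\<exists>f. Vector_Spaces.linear (psmul P) (psmul Q) f \<and> bij f \<and>
     (\<forall>x y. f (pmul P x y) = pmul Q (f x) (f y)) \<and>
     (\<forall>x y. f (brk P x y) = brk Q (f x) (f y)))"

text \<open>\<open>comm3\<close> is the bilinear commutative operation on \<open>'f ^ 3\<close> with prescribed products
  \<open>11, 12, 13, 22, 23, 33\<close> of the standard basis vectors; \<open>alt3\<close> is the bilinear alternating operation
  with prescribed products \<open>12, 13, 23\<close>.\<close>

definition comm3 :: "'f::field ^ 3 \<Rightarrow> 'f ^ 3 \<Rightarrow> 'f ^ 3 \<Rightarrow> 'f ^ 3 \<Rightarrow> 'f ^ 3 \<Rightarrow> 'f ^ 3 \<Rightarrow>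
    'f ^ 3 \<Rightarrow> 'f ^ 3 \<Rightarrow> 'f ^ 3" where
  "comm3 p11 p12 p13 p22 p23 p33 a b =
     (a$1 * b$1) *s p11 + (a$1 * b$2 + a$2 * b$1) *s p12 + (a$1 * b$3 + a$3 * b$1) *s p13 +
     (a$2 * b$2) *s p22 + (a$2 * b$3 + a$3 * b$2) *s p23 + (a$3 * b$3) *s p33"

definition alt3 :: "'f::field ^ 3 \<Rightarrow> 'f ^ 3 \<Rightarrow> 'f ^ 3 \<Rightarrow> 'f ^ 3 \<Rightarrow> 'f ^ 3 \<Rightarrow> 'f ^ 3" where
  "alt3 p12 p13 p23 a b =
     (a$1 * b$2 - a$2 * b$1) *s p12 + (a$1 * b$3 - a$3 * b$1) *s p13 +
     (a$2 * b$3 - a$3 * b$2) *s p23"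

abbreviation b1 :: "'f::field ^ 3" where "b1 \<equiv> axis 1 1"
abbreviation b2 :: "'f::field ^ 3" where "b2 \<equiv> axis 2 1"
abbreviation b3 :: "'f::field ^ 3" where "b3 \<equiv> axis 3 1"

definition zero_lie :: "('f, 'v::zero) alg \<Rightarrow> ('f, 'v) poisson" where
  "zero_lie A = \<lparr>psmul = smul A, pmul = mul A, brk = (\<lambda>_ _. 0)\<rparr>"

definition zero_assoc :: "('f, 'v::zero) alg \<Rightarrow> ('f, 'v) poisson" where
  "zero_assoc L = \<lparr>psmul = smul L, pmul = (\<lambda>_ _. 0), brk = mul L\<rparr>"

definition alg_prod :: "('f, 'v) alg \<Rightarrow> ('f, 'w) alg \<Rightarrow> ('f, 'v \<times> 'w) alg" (infixr "\<times>\<^sub>A" 75) where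
  "A \<times>\<^sub>A B = \<lparr>smul = (\<lambda>c (a, b). (smul A c a, smul B c b)),
     mul = (\<lambda>(a, b) (a', b'). (mul A a a', mul B b b'))\<rparr>"

definition base_alg :: "('f::field, 'f) alg" where
  "base_alg = \<lparr>smul = (*), mul = (*)\<rparr>"

definition null_alg :: "('f::field, 'f) alg" where
  "null_alg = \<lparr>smul = (*), mul = (\<lambda>_ _. 0)\<rparr>"

text \<open>\<open>F[\<epsilon>]/(\<epsilon>\<^sup>2)\<close>, where \<open>(a, b)\<close> stands for \<open>a + b \<epsilon>\<close>.\<close>

definition dual_numbers :: "('f::field, 'f \<times> 'f) alg" where
  "dual_numbers = \<lparr>smul = (\<lambda>c (a, b). (c * a, c * b)),
     mul = (\<lambda>(a, b) (a', b'). (a * a', a * b' + b * a'))\<rparr>"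

definition comm_alg3 :: "'f::field ^ 3 \<Rightarrow> 'f ^ 3 \<Rightarrow> 'f ^ 3 \<Rightarrow> 'f ^ 3 \<Rightarrow> 'f ^ 3 \<Rightarrow> 'f ^ 3 \<Rightarrow>
    ('f, 'f ^ 3) alg" where
  "comm_alg3 p11 p12 p13 p22 p23 p33 = \<lparr>smul = (*s), mul = comm3 p11 p12 p13 p22 p23 p33\<rparr>"

text \<open>In each algebra on \<open>'f ^ 3\<close> below, the standard basis vectors \<open>b1, b2, b3\<close> are the generators in
  the order indicated.\<close>

definition P3_1 :: "('f::field, 'f ^ 3) poisson" where
  "P3_1 = zero_lie (comm_alg3 0 0 0 0 0 0)"

definition P3_2 :: "('f::field, 'f ^ 3) poisson" where \<comment> \<open>\<open>e, x, y\<close>\<close>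
  "P3_2 = zero_lie (comm_alg3 b1 0 0 0 0 0)"

definition P3_3 :: "('f::field, 'f ^ 3) poisson" where \<comment> \<open>\<open>x, y, z\<close>\<close>
  "P3_3 = zero_lie (comm_alg3 b3 0 0 0 0 0)"

text \<open>\<open>P3_4 M\<close> and \<open>P3_16 M\<close> are only meant for symmetric \<open>M\<close>; the entry \<open>M$2$1\<close> is not used.\<close>

definition P3_4 :: "'f::field ^ 2 ^ 2 \<Rightarrow> ('f, 'f ^ 3) poisson" where \<comment> \<open>\<open>x, y, z\<close>\<close>
  "P3_4 M = zero_lie (comm_alg3 (M$1$1 *s b3) (M$1$2 *s b3) 0 (M$2$2 *s b3) 0 0)"

definition P3_5 :: "('f::field, 'f ^ 3) poisson" where \<comment> \<open>\<open>x, y, z\<close>\<close>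
  "P3_5 = zero_lie (comm_alg3 b2 b3 0 0 0 0)"

definition P3_6 :: "('f::field, 'f ^ 3) poisson" where \<comment> \<open>\<open>e, x, y\<close>\<close>
  "P3_6 = zero_lie (comm_alg3 b1 0 0 b3 0 0)"

definition P3_7 :: "('f::field, 'f ^ 3) poisson" where \<comment> \<open>\<open>e\<^sub>1, e\<^sub>2, z\<close>\<close>
  "P3_7 = zero_lie (comm_alg3 b1 0 0 b2 0 0)"

definition P3_8 :: "('f::field, 'f ^ 3) poisson" where \<comment> \<open>\<open>e, u, z\<close>\<close>
  "P3_8 = zero_lie (comm_alg3 b1 b2 0 0 0 0)"

definition P3_9 :: "('f::field, 'e::ab_group_add) alg \<Rightarrow> ('f, 'e \<times> 'f) poisson" where
  "P3_9 E = zero_lie (E \<times>\<^sub>A null_alg)"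

definition P3_10 :: "('f::field, 'f \<times> 'f \<times> 'f) poisson" where
  "P3_10 = zero_lie (base_alg \<times>\<^sub>A base_alg \<times>\<^sub>A base_alg)"

definition P3_11 :: "('f::field, 'f \<times> 'f \<times> 'f) poisson" where
  "P3_11 = zero_lie (base_alg \<times>\<^sub>A dual_numbers)"

definition P3_12 :: "('f::field, 'e::ab_group_add) alg \<Rightarrow> ('f, 'f \<times> 'e) poisson" where
  "P3_12 E = zero_lie (base_alg \<times>\<^sub>A E)"

definition P3_13 :: "('f::field, 'e::ab_group_add) alg \<Rightarrow> ('f, 'e) poisson" where
  "P3_13 K = zero_lie K"

definition P3_14 :: "('f::field, 'f ^ 3) poisson" where \<comment> \<open>\<open>e, u, v\<close>\<close>
  "P3_14 = zero_lie (comm_alg3 b1 b2 b3 0 0 0)"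

definition P3_15 :: "('f::field, 'f ^ 3) poisson" where \<comment> \<open>\<open>e, u, v\<close>\<close>
  "P3_15 = zero_lie (comm_alg3 b1 b2 b3 b3 0 0)"

definition P3_16 :: "'f::field ^ 2 ^ 2 \<Rightarrow> ('f, 'f ^ 3) poisson" where \<comment> \<open>\<open>x, y, z\<close>\<close>
  "P3_16 M = \<lparr>psmul = (*s),
     pmul = comm3 (M$1$1 *s b3) (M$1$2 *s b3) 0 (M$2$2 *s b3) 0 0, brk = alt3 b3 0 0\<rparr>"

definition P3_17 :: "('f::field, 'f ^ 3) poisson" where \<comment> \<open>\<open>x, y, z\<close>\<close>
  "P3_17 = \<lparr>psmul = (*s), pmul = comm3 0 0 0 0 0 0, brk = alt3 b2 0 0\<rparr>"

definition P3_18 :: "('f::field, 'f ^ 3) poisson" where \<comment> \<open>\<open>x, y, z\<close>\<close>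
  "P3_18 = \<lparr>psmul = (*s), pmul = comm3 b3 0 0 0 0 0, brk = alt3 b2 0 0\<rparr>"

definition P3_19 :: "('f::field, 'f ^ 3) poisson" where \<comment> \<open>\<open>x, y, z\<close>\<close>
  "P3_19 = \<lparr>psmul = (*s), pmul = comm3 0 0 0 0 0 b3, brk = alt3 b2 0 0\<rparr>"

definition P3_20 :: "('f::field, 'f ^ 3) poisson" where \<comment> \<open>\<open>x, y, z\<close>\<close>
  "P3_20 = \<lparr>psmul = (*s), pmul = comm3 0 0 b1 0 b2 b3, brk = alt3 b2 0 0\<rparr>"

text \<open>\<open>(a, v)\<close> stands for \<open>a x + v\<close>.\<close>

definition P3_21 :: "'f::field ^ 2 ^ 2 \<Rightarrow> ('f, 'f \<times> ('f ^ 2)) poisson" where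
  "P3_21 A = zero_assoc \<lparr>smul = (\<lambda>c (a, v). (c * a, c *s v)),
     mul = (\<lambda>(a, v) (b, w). (0, a *s (A *v w) - b *s (A *v v)))\<rparr>"

definition P3_22 :: "'f::field \<Rightarrow> ('f, 'f ^ 3) poisson" where \<comment> \<open>\<open>x, u, v\<close>\<close>
  "P3_22 q = \<lparr>psmul = (*s), pmul = comm3 0 0 b2 0 0 0, brk = alt3 b2 (b3 + q *s b2) 0\<rparr>"

definition P3_23 :: "('f::field, 's::ab_group_add) alg \<Rightarrow> ('f, 's) poisson" where
  "P3_23 L = zero_assoc L"

definition sym_mat :: "'f::field ^ 2 ^ 2 \<Rightarrow> bool" where
  "sym_mat M \<longleftrightarrow> transpose M = M"

definition mat_scale :: "'f::field \<Rightarrow> 'f ^ 2 ^ 2 \<Rightarrow> 'f ^ 2 ^ 2" where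
  "mat_scale c = map_matrix ((*) c)"

end

theory Submission
  imports Defs
begin

text \<open>
  A three-dimensional Poisson algebra is determined up to isomorphism by its structure constants in
  any basis (\<open>iso_structure_constants\<close>), so the existence half of the theorem is a search for a basis
  in which the two multiplications take one of the listed forms.  After a choice of coordinates the
  algebra lives on \<open>'f ^ 3\<close> (\<open>iso_coordinate_space\<close>).
  
  If the bracket vanishes, a commutative associative algebra remains.  The four vectors
  \<open>a, a\<^sup>2, a\<^sup>3, a\<^sup>4\<close> are linearly dependent, and reading the relation from its lowest term shows that
  either \<open>a\<^sup>4 = 0\<close> or some multiple of \<open>a\<close> is a non-zero idempotent (\<open>nilpotent_or_idempotent\<close>).
  Without idempotents every element is nilpotent, and the algebra is read off from an element with
  the highest non-vanishing power or, if all squares vanish, from a non-zero product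
  (\<open>nil_classification\<close>).  An idempotent \<open>e\<close> splits the algebra into the image and
  the kernel of multiplication by \<open>e\<close>.  If some idempotent has a one-dimensional image, the kernel is a
  plane to which the same dichotomy applies (\<open>rank1_idempotent\<close>).  Otherwise a non-identity idempotent
  has a two-dimensional image, which is unital, and a null line as kernel.  A unital plane is
  \<open>F[t]\<close> modulo a quadratic polynomial, hence a field, the dual numbers or \<open>F \<times> F\<close>
  (\<open>quadratic_cases\<close>).  If the identity is the only non-zero idempotent, every element is nilpotent
  or invertible, so the algebra is a field or is local with residue field \<open>F\<close> (\<open>unital_types\<close>).
  
  If the bracket does not vanish, the size and position of the derived algebra separate four Lie types
  (\<open>lie_classification\<close>): Heisenberg, affine plus centre, a line acting invertibly on an abelian
  plane, and perfect.  In each type the Leibniz rule determines the products of basis vectors up to a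
  few scalars: applying the inner derivations to a product and comparing coefficients leaves linear
  conditions, and associativity removes or normalises the rest.  Characteristic two enters
  only for an invertible action on a plane, where the Leibniz rule says that twice the product with
  \<open>x\<close> is a scalar; a non-zero product survives only when \<open>2 = 0\<close>, and then it is nilpotent and
  commutes with the action.  A perfect algebra is simple.  An idempotent in it would be central, so
  all elements are nilpotent and the products span a proper ideal, which is zero (\<open>perfect_types\<close>).
  
  For the parameters, an isomorphism preserves a canonical subspace of the model (the line spanned by
  the products or brackets, the plane of brackets, the square of the algebra, or the annihilator of an
  idempotent), and its restriction to this subspace or to the quotient is the asserted matrix or
  isomorphism.
\<close>

section \<open>Isomorphisms\<close>

lemma alg_isoI:
  assumes "vector_space (smul A)" "vector_space (smul B)"
    and "\<And>x y. f (x + y) = f x + f y" "\<And>c x. f (smul A c x) = smul B c (f x)" "bij f"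
    and "\<And>x y. f (mul A x y) = mul B (f x) (f y)"
  shows "A \<cong>\<^sub>A B"
  using assms unfolding alg_iso_def Vector_Spaces.linear_iff by blast

lemma alg_isoE:
  assumes "A \<cong>\<^sub>A B"
  obtains f where "vector_space (smul A)" "vector_space (smul B)"
    and "\<And>x y. f (x + y) = f x + f y" "\<And>c x. f (smul A c x) = smul B c (f x)" "bij f"
    and "\<And>x y. f (mul A x y) = mul B (f x) (f y)"
  using assms unfolding alg_iso_def Vector_Spaces.linear_iff by blast

lemma poisson_isoI:
  assumes "vector_space (psmul P)" "vector_space (psmul Q)"
    and "\<And>x y. f (x + y) = f x + f y" "\<And>c x. f (psmul P c x) = psmul Q c (f x)" "bij f"
    and "\<And>x y. f (pmul P x y) = pmul Q (f x) (f y)" "\<And>x y. f (brk P x y) = brk Q (f x) (f y)"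
  shows "P \<cong>\<^sub>P Q"
  using assms unfolding poisson_iso_def Vector_Spaces.linear_iff by blast

lemma poisson_isoE:
  assumes "P \<cong>\<^sub>P Q"
  obtains f where "vector_space (psmul P)" "vector_space (psmul Q)"
    and "\<And>x y. f (x + y) = f x + f y" "\<And>c x. f (psmul P c x) = psmul Q c (f x)" "bij f"
    and "\<And>x y. f (pmul P x y) = pmul Q (f x) (f y)" "\<And>x y. f (brk P x y) = brk Q (f x) (f y)"
  using assms unfolding poisson_iso_def Vector_Spaces.linear_iff by blast

lemma poisson_iso_refl: "vector_space (psmul P) \<Longrightarrow> P \<cong>\<^sub>P P"
  by (rule poisson_isoI[where f = "\<lambda>x. x"]) (simp_all add: bij_id[unfolded id_def])

lemma poisson_iso_sym:
  assumes "P \<cong>\<^sub>P Q"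
  shows "Q \<cong>\<^sub>P P"
proof -
  obtain f where f: "vector_space (psmul P)" "vector_space (psmul Q)"
    "\<And>x y. f (x + y) = f x + f y" "\<And>c x. f (psmul P c x) = psmul Q c (f x)" "bij f"
    "\<And>x y. f (pmul P x y) = pmul Q (f x) (f y)" "\<And>x y. f (brk P x y) = brk Q (f x) (f y)"
    using assms by (rule poisson_isoE) blast
  have inv: "f (inv f y) = y" for y
    using f(5) by (simp add: bij_is_surj surj_f_inv_f)
  have inv_eqI: "inv f y = x" if "f x = y" for x y
    using f(5) that by (auto simp: bij_is_inj)
  show ?thesis
    by (rule poisson_isoI[where f = "inv f"]) (use f in \<open>auto simp: inv bij_imp_bij_inv intro!: inv_eqI\<close>)
qed

lemma poisson_iso_trans:
  assumes "P \<cong>\<^sub>P Q" "Q \<cong>\<^sub>P R"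
  shows "P \<cong>\<^sub>P R"
proof -
  obtain f where f: "vector_space (psmul P)" "vector_space (psmul Q)"
    "\<And>x y. f (x + y) = f x + f y" "\<And>c x. f (psmul P c x) = psmul Q c (f x)" "bij f"
    "\<And>x y. f (pmul P x y) = pmul Q (f x) (f y)" "\<And>x y. f (brk P x y) = brk Q (f x) (f y)"
    using assms(1) by (rule poisson_isoE) blast
  obtain g where g: "vector_space (psmul Q)" "vector_space (psmul R)"
    "\<And>x y. g (x + y) = g x + g y" "\<And>c x. g (psmul Q c x) = psmul R c (g x)" "bij g"
    "\<And>x y. g (pmul Q x y) = pmul R (g x) (g y)" "\<And>x y. g (brk Q x y) = brk R (g x) (g y)"
    using assms(2) by (rule poisson_isoE) blast
  show ?thesis
  proof (rule poisson_isoI[where f = "\<lambda>x. g (f x)"])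
    show "bij (\<lambda>x. g (f x))" using bij_comp[OF f(5) g(5)] by (simp add: comp_def)
  qed (simp_all add: f(1,3,4,6,7) g(2-4,6,7))
qed

section \<open>Bases of a three-dimensional space\<close>

text \<open>
  Independence suffices, since the ambient space has dimension three.
\<close>

definition basis3 :: "'f::field ^ 3 \<Rightarrow> 'f ^ 3 \<Rightarrow> 'f ^ 3 \<Rightarrow> bool" where
  "basis3 x y z \<longleftrightarrow> (\<forall>a b c. a *s x + b *s y + c *s z = 0 \<longrightarrow> a = 0 \<and> b = 0 \<and> c = 0)"

definition comb3 :: "'f::field ^ 3 \<Rightarrow> 'f ^ 3 \<Rightarrow> 'f ^ 3 \<Rightarrow> 'f ^ 3 \<Rightarrow> 'f ^ 3" where
  "comb3 x y z a = a$1 *s x + a$2 *s y + a$3 *s z"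

lemma vec3_eq_iff: "(v :: 'f ^ 3) = w \<longleftrightarrow> v$1 = w$1 \<and> v$2 = w$2 \<and> v$3 = w$3"
  by (simp add: vec_eq_iff forall_3)

lemma vec2_eq_iff: "(v :: 'f ^ 2) = w \<longleftrightarrow> v$1 = w$1 \<and> v$2 = w$2"
  by (simp add: vec_eq_iff forall_2)

lemma axis3_nth [simp]:
  "(b1 :: 'f::field ^ 3)$1 = 1" "(b1 :: 'f ^ 3)$2 = 0" "(b1 :: 'f ^ 3)$3 = 0"
  "(b2 :: 'f ^ 3)$1 = 0" "(b2 :: 'f ^ 3)$2 = 1" "(b2 :: 'f ^ 3)$3 = 0"
  "(b3 :: 'f ^ 3)$1 = 0" "(b3 :: 'f ^ 3)$2 = 0" "(b3 :: 'f ^ 3)$3 = 1"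
  by (simp_all add: axis_def)

lemma comb3_simps [simp]:
  "comb3 x y z 0 = 0" "comb3 x y z b1 = x" "comb3 x y z b2 = y" "comb3 x y z b3 = z"
  "comb3 x y z (v + w) = comb3 x y z v + comb3 x y z w"
  "comb3 x y z (c *s v) = c *s comb3 x y z v"
  by (simp_all add: comb3_def vec3_eq_iff algebra_simps)

lemma comb3_linear: "Vector_Spaces.linear (*s) (*s) (comb3 x y z)"
  by (simp add: Vector_Spaces.linear_iff vec.vector_space_axioms)

lemma basis3_iff_inj: "basis3 x y z \<longleftrightarrow> inj (comb3 x y z)"
proof -
  have "inj (comb3 x y z) \<longleftrightarrow> (\<forall>a. comb3 x y z a = 0 \<longrightarrow> a = 0)"
    by (rule vec.linear_inj_iff_eq_0[OF comb3_linear])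
  also have "\<dots> \<longleftrightarrow> basis3 x y z"
  proof
    assume *: "\<forall>a. comb3 x y z a = 0 \<longrightarrow> a = 0"
    show "basis3 x y z"
      unfolding basis3_def
    proof (intro allI impI)
      fix a b c assume "a *s x + b *s y + c *s z = 0"
      then have "comb3 x y z (vector [a, b, c]) = 0" by (simp add: comb3_def)
      with * have "(vector [a, b, c] :: 'a ^ 3) = 0" by blast
      then show "a = 0 \<and> b = 0 \<and> c = 0" by (simp add: vec3_eq_iff)
    qed
  next
    assume *: "basis3 x y z"
    show "\<forall>a. comb3 x y z a = 0 \<longrightarrow> a = 0"
    proof (intro allI impI)
      fix a assume "comb3 x y z a = 0"
      with * have "a$1 = 0 \<and> a$2 = 0 \<and> a$3 = 0" unfolding basis3_def comb3_def by blast
      then show "a = 0" by (simp add: vec3_eq_iff)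
    qed
  qed
  finally show ?thesis ..
qed

lemma basis3_bij: "basis3 x y z \<Longrightarrow> bij (comb3 x y z)"
  by (simp add: bij_def basis3_iff_inj vec.linear_inj_imp_surj[OF comb3_linear])

lemma basis3_span:
  assumes "basis3 x y z"
  obtains a b c where "v = a *s x + b *s y + c *s z"
proof -
  obtain w where "v = comb3 x y z w" using surjD[OF bij_is_surj[OF basis3_bij[OF assms]]] by blast
  then show ?thesis using that unfolding comb3_def by blast
qed

lemma basis3_swap:
  assumes "basis3 x y z"
  shows "basis3 y x z"
  unfolding basis3_def
proof (intro allI impI)
  fix a b c assume "a *s y + b *s x + c *s z = 0"
  then have "b *s x + a *s y + c *s z = 0" by (simp only: ac_simps)
  then show "a = 0 \<and> b = 0 \<and> c = 0" using assms unfolding basis3_def by blast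
qed

lemma basis3_rot:
  assumes "basis3 x y z"
  shows "basis3 y z x"
  unfolding basis3_def
proof (intro allI impI)
  fix a b c assume "a *s y + b *s z + c *s x = 0"
  then have "c *s x + a *s y + b *s z = 0" by (simp only: ac_simps)
  then show "a = 0 \<and> b = 0 \<and> c = 0" using assms unfolding basis3_def by blast
qed

lemma span2_eq: "vec.span {x, y :: 'f::field ^ 'n} = {a *s x + b *s y |a b. True}"
proof -
  have "v \<in> vec.span {x, y} \<longleftrightarrow> (\<exists>a b. v = a *s x + b *s y)" for v
    by (simp add: vec.span_breakdown_eq algebra_simps)
  then show ?thesis by auto
qed

lemma dim3: "vec.dim (UNIV :: ('f::field ^ 3) set) = 3"
  by (simp only: vec_dim_card) simp

lemma span2_proper: "vec.span {x, y :: 'f::field ^ 3} \<noteq> UNIV"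
proof
  assume "vec.span {x, y} = UNIV"
  then have "vec.dim (UNIV :: ('f ^ 3) set) \<le> card {x, y}"
    by (metis vec.dim_le_card finite.emptyI finite.insertI order_refl)
  also have "\<dots> \<le> 2" by (simp add: card_insert_le_m1)
  finally show False by (simp add: dim3 del: vec.dim_UNIV)
qed

lemma solve_last:
  fixes x y z :: "'f::field ^ 'n"
  assumes "a *s x + b *s y + c *s z = 0" "c \<noteq> 0"
  shows "z = (- a / c) *s x + (- b / c) *s y"
proof -
  have "c *s z = - (a *s x + b *s y)" using assms(1) by (simp add: add_eq_0_iff)
  then have "(1 / c) *s (c *s z) = (1 / c) *s (- (a *s x + b *s y))" by simp
  then show ?thesis using assms(2)
    by (simp add: vec.scale_right_diff_distrib)
qed

lemma extend_basis3:
  fixes x y :: "'f::field ^ 3"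
  assumes "\<And>a b. a *s x + b *s y = 0 \<Longrightarrow> a = 0 \<and> b = 0"
  obtains z where "basis3 x y z"
proof -
  obtain z where z: "z \<notin> vec.span {x, y}" using span2_proper[of x y] by auto
  have "basis3 x y z"
    unfolding basis3_def
  proof (intro allI impI)
    fix a b c assume eq: "a *s x + b *s y + c *s z = 0"
    have "c = 0"
    proof (rule ccontr)
      assume c: "c \<noteq> 0"
      then have "z = (- a / c) *s x + (- b / c) *s y"
        using solve_last[OF eq] by blast
      then show False using z unfolding span2_eq by blast
    qed
    then show "a = 0 \<and> b = 0 \<and> c = 0" using eq assms by simp
  qed
  then show ?thesis by (rule that)
qed

lemma extend_basis3_1:
  fixes x :: "'f::field ^ 3"
  assumes "x \<noteq> 0"
  obtains y z where "basis3 x y z"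
proof -
  obtain y where y: "y \<notin> vec.span {x, x}" using span2_proper[of x x] by auto
  have "a = 0 \<and> b = 0" if eq: "a *s x + b *s y = 0" for a b
  proof (cases "b = 0")
    case True
    then show ?thesis using that assms by auto
  next
    case False
    then have "y = (- 0 / b) *s x + (- a / b) *s x"
      using solve_last[of 0 x a x b y] eq by (simp del: vector_smult_lzero)
    then show ?thesis using y unfolding span2_eq by blast
  qed
  then show ?thesis using extend_basis3 that by metis
qed

lemma four_dependent:
  fixes v1 v2 v3 v4 :: "'f::field ^ 3"
  obtains c1 c2 c3 c4 where "c1 *s v1 + c2 *s v2 + c3 *s v3 + c4 *s v4 = 0"
    "c1 \<noteq> 0 \<or> c2 \<noteq> 0 \<or> c3 \<noteq> 0 \<or> c4 \<noteq> 0"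
proof (cases "basis3 v1 v2 v3")
  case True
  then obtain a b c where "v4 = a *s v1 + b *s v2 + c *s v3" by (rule basis3_span)
  then have "a *s v1 + b *s v2 + c *s v3 + (-1) *s v4 = 0" by (simp add: vec3_eq_iff)
  then show ?thesis using that[of a b c "-1"] by simp
next
  case False
  then obtain a b c where "a *s v1 + b *s v2 + c *s v3 = 0" "a \<noteq> 0 \<or> b \<noteq> 0 \<or> c \<noteq> 0"
    unfolding basis3_def by blast
  then show ?thesis using that[of a b c 0] by auto
qed

lemma basis3D:
  assumes "basis3 x y z" "a *s x + b *s y + c *s z = 0"
  shows "a = 0" "b = 0" "c = 0"
  using assms unfolding basis3_def by blast+

lemma basis3_replace:
  assumes "basis3 x y z" "c \<noteq> 0"
  shows "basis3 x y (a *s x + b *s y + c *s z)"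
  unfolding basis3_def
proof (intro allI impI)
  fix p q r assume "p *s x + q *s y + r *s (a *s x + b *s y + c *s z) = 0"
  then have "(p + r * a) *s x + (q + r * b) *s y + (r * c) *s z = 0"
    by (simp add: algebra_simps)
  note basis3D[OF assms(1) this]
  with assms(2) show "p = 0 \<and> q = 0 \<and> r = 0" by simp
qed

lemma basis3_cong:
  assumes "basis3 x y z" "z' = a *s x + b *s y + c *s z" "c \<noteq> 0"
  shows "basis3 x y z'"
  using basis3_replace assms by metis

lemma basis3_swap23: "basis3 x y z \<Longrightarrow> basis3 x z y"
  by (rule basis3_swap[OF basis3_rot[OF basis3_rot]])

lemma plane_through_two:
  fixes p q :: "'f::field ^ 3"
  obtains x u v where "basis3 x u v" "p \<in> vec.span {u, v}" "q \<in> vec.span {u, v}"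
proof (cases "p = 0")
  case True
  obtain w where w: "w \<noteq> 0" "q = 0 \<or> q = w"
  proof (cases "q = 0")
    case True
    show thesis by (rule that[of b1]) (simp_all add: True)
  qed (rule that[of q], simp_all)
  obtain y z where "basis3 w y z" by (rule extend_basis3_1[OF w(1)])
  then have "basis3 z w y" by (rule basis3_rot[OF basis3_rot])
  moreover have "p \<in> vec.span {w, y}" "q \<in> vec.span {w, y}"
    using True w(2) by (auto intro: vec.span_zero vec.span_base)
  ultimately show thesis by (rule that)
next
  case p: False
  show thesis
  proof (cases "\<exists>c. q = c *s p")
    case True
    then obtain c where c: "q = c *s p" ..
    obtain y z where "basis3 p y z" by (rule extend_basis3_1[OF p])
    then have "basis3 z p y" by (rule basis3_rot[OF basis3_rot])
    moreover have "p \<in> vec.span {p, y}" "q \<in> vec.span {p, y}"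
      unfolding c by (auto intro: vec.span_base vec.span_scale)
    ultimately show thesis by (rule that)
  next
    case False
    have "a = 0 \<and> b = 0" if dep: "a *s p + b *s q = 0" for a b
    proof (cases "b = 0")
      case True
      then show ?thesis using dep p by simp
    next
      case b: False
      have "0 *s p + a *s p + b *s q = 0" using dep by simp
      from solve_last[OF this b] have "q = (- a / b) *s p" by simp
      then show ?thesis using False by blast
    qed
    then obtain z where "basis3 p q z" by (rule extend_basis3)
    then have "basis3 z p q" by (rule basis3_rot[OF basis3_rot])
    then show thesis by (rule that) (auto intro: vec.span_base)
  qed
qed

text \<open>
  Applied to the three brackets of basis vectors, this puts the derived algebra of a Lie algebra
  that is not perfect into a coordinate plane.
\<close>

lemma plane_through_dependent:
  fixes p q r :: "'f::field ^ 3"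
  assumes "\<not> basis3 p q r"
  obtains x u v where "basis3 x u v"
    "p \<in> vec.span {u, v}" "q \<in> vec.span {u, v}" "r \<in> vec.span {u, v}"
proof -
  obtain a b c where dep: "a *s p + b *s q + c *s r = 0" "a \<noteq> 0 \<or> b \<noteq> 0 \<or> c \<noteq> 0"
    using assms unfolding basis3_def by blast
  have solved: "\<exists>x u v. basis3 x u v \<and> p \<in> vec.span {u, v} \<and> q \<in> vec.span {u, v} \<and> r \<in> vec.span {u, v}"
    if eq: "a *s p + b *s q + c *s r = 0" and c: "c \<noteq> 0" for a b c and p q r :: "'f ^ 3"
  proof -
    obtain x u v where uv: "basis3 x u v" "p \<in> vec.span {u, v}" "q \<in> vec.span {u, v}"
      by (rule plane_through_two)
    have "r \<in> vec.span {u, v}"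
      unfolding solve_last[OF eq c] by (intro vec.span_add vec.span_scale uv)
    with uv show ?thesis by blast
  qed
  have "\<exists>x u v. basis3 x u v \<and> p \<in> vec.span {u, v} \<and> q \<in> vec.span {u, v} \<and> r \<in> vec.span {u, v}"
  proof (cases "c = 0")
    case False
    show ?thesis by (rule solved[OF dep(1) False])
  next
    case c: True
    show ?thesis
    proof (cases "b = 0")
      case False
      have "c *s r + a *s p + b *s q = 0" using dep(1) by (simp only: ac_simps)
      from solved[OF this False] show ?thesis by blast
    next
      case True
      have "b *s q + c *s r + a *s p = 0" using dep(1) by (simp only: ac_simps)
      from solved[OF this] dep(2) c True show ?thesis by blast
    qed
  qed
  then show thesis using that by blast
qed

section \<open>Poisson algebras on coordinate space\<close>

locale comm_assoc3 =
  fixes m :: "'f::field ^ 3 \<Rightarrow> 'f ^ 3 \<Rightarrow> 'f ^ 3" (infixl "\<odot>" 70)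
  assumes add_left: "(x + y) \<odot> z = x \<odot> z + y \<odot> z"
    and scale_left: "(c *s x) \<odot> y = c *s (x \<odot> y)"
    and comm: "x \<odot> y = y \<odot> x"
    and assoc: "(x \<odot> y) \<odot> z = x \<odot> (y \<odot> z)"
begin

lemma add_right: "x \<odot> (y + z) = x \<odot> y + x \<odot> z"
  by (metis add_left comm)

lemma scale_right: "x \<odot> (c *s y) = c *s (x \<odot> y)"
  by (metis scale_left comm)

lemma zero_left [simp]: "0 \<odot> x = 0"
  using scale_left[of 0 0 x] by simp

lemma zero_right [simp]: "x \<odot> 0 = 0"
  using scale_right[of x 0 0] by simp

lemma minus_left: "(- x) \<odot> y = - (x \<odot> y)"
  using scale_left[of "-1" x y] by simp

lemma minus_right: "x \<odot> (- y) = - (x \<odot> y)"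
  using scale_right[of x "-1" y] by simp

lemma diff_left: "(x - y) \<odot> z = x \<odot> z - y \<odot> z"
  using add_left[of x "- y" z] by (simp add: minus_left)

lemma diff_right: "x \<odot> (y - z) = x \<odot> y - x \<odot> z"
  using add_right[of x y "- z"] by (simp add: minus_right)

lemma left_commute: "x \<odot> (y \<odot> z) = y \<odot> (x \<odot> z)"
  by (metis assoc comm)

lemmas bilinear = add_left add_right scale_left scale_right minus_left minus_right
  diff_left diff_right

end

locale poisson3 = comm_assoc3 +
  fixes br :: "'f::field ^ 3 \<Rightarrow> 'f ^ 3 \<Rightarrow> 'f ^ 3"
  assumes br_add_left: "br (x + y) z = br x z + br y z"
    and br_add_right: "br x (y + z) = br x y + br x z"
    and br_scale_left: "br (c *s x) y = c *s br x y"
    and br_scale_right: "br x (c *s y) = c *s br x y"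
    and br_alt [simp]: "br x x = 0"
    and jacobi: "br x (br y z) + br y (br z x) + br z (br x y) = 0"
    and leibniz: "br (x \<odot> y) z = x \<odot> br y z + y \<odot> br x z"
begin

lemma br_anti: "br y x = - br x y"
proof -
  have "0 = br (x + y) (x + y)" by simp
  also have "\<dots> = br x y + br y x" unfolding br_add_left br_add_right by simp
  finally show ?thesis by (simp add: eq_neg_iff_add_eq_0 add.commute)
qed

lemma br_zero_left [simp]: "br 0 x = 0"
  using br_scale_left[of 0 0 x] by simp

lemma br_zero_right [simp]: "br x 0 = 0"
  using br_scale_right[of x 0 0] by simp

lemma br_minus_left: "br (- x) y = - br x y"
  using br_scale_left[of "-1" x y] by simp

lemma br_minus_right: "br x (- y) = - br x y"
  using br_scale_right[of x "-1" y] by simp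

lemma br_diff_left: "br (x - y) z = br x z - br y z"
  using br_add_left[of x "- y" z] by (simp add: br_minus_left)

lemma br_diff_right: "br x (y - z) = br x y - br x z"
  using br_add_right[of x y "- z"] by (simp add: br_minus_right)

lemmas br_bilinear = br_add_left br_add_right br_scale_left br_scale_right br_minus_left
  br_minus_right br_diff_left br_diff_right

lemma leibniz_right: "br z (x \<odot> y) = x \<odot> br z y + y \<odot> br z x"
  by (metis leibniz br_anti minus_right minus_add_distrib)

text \<open>
  The map \<open>comb3 x y z\<close> carries the model to the given algebra; by bilinearity the products of basis
  vectors decide whether it is multiplicative.
\<close>

lemma iso_structure_constants:
  assumes "basis3 x y z"
    and prods: "x \<odot> x = comb3 x y z p11" "x \<odot> y = comb3 x y z p12" "x \<odot> z = comb3 x y z p13"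
    "y \<odot> y = comb3 x y z p22" "y \<odot> z = comb3 x y z p23" "z \<odot> z = comb3 x y z p33"
    and brks: "br x y = comb3 x y z q12" "br x z = comb3 x y z q13" "br y z = comb3 x y z q23"
  shows "\<lparr>psmul = (*s), pmul = m, brk = br\<rparr> \<cong>\<^sub>P
    \<lparr>psmul = (*s), pmul = comm3 p11 p12 p13 p22 p23 p33, brk = alt3 q12 q13 q23\<rparr>"
proof (rule poisson_iso_sym, rule poisson_isoI[where f = "comb3 x y z"], simp_all only: poisson.simps)
  have flip: "y \<odot> x = x \<odot> y" "z \<odot> x = x \<odot> z" "z \<odot> y = y \<odot> z"
    "br y x = - br x y" "br z x = - br x z" "br z y = - br y z" by (rule comm br_anti)+
  show "comb3 x y z (comm3 p11 p12 p13 p22 p23 p33 a b) = comb3 x y z a \<odot> comb3 x y z b" for a b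
  proof -
    have "comb3 x y z (comm3 p11 p12 p13 p22 p23 p33 a b) =
     (a$1 * b$1) *s (x \<odot> x) + (a$1 * b$2 + a$2 * b$1) *s (x \<odot> y) +
     (a$1 * b$3 + a$3 * b$1) *s (x \<odot> z) +
     (a$2 * b$2) *s (y \<odot> y) + (a$2 * b$3 + a$3 * b$2) *s (y \<odot> z) + (a$3 * b$3) *s (z \<odot> z)"
      by (simp only: comm3_def comb3_simps prods)
    then show ?thesis
      by (simp add: comb3_def bilinear flip) (simp add: vec_eq_iff algebra_simps)
  qed
  show "comb3 x y z (alt3 q12 q13 q23 a b) = br (comb3 x y z a) (comb3 x y z b)" for a b
  proof -
    have "comb3 x y z (alt3 q12 q13 q23 a b) =
     (a$1 * b$2 - a$2 * b$1) *s br x y + (a$1 * b$3 - a$3 * b$1) *s br x z +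
     (a$2 * b$3 - a$3 * b$2) *s br y z"
      by (simp only: alt3_def comb3_simps brks)
    then show ?thesis
      by (simp add: comb3_def br_bilinear flip) (simp add: vec_eq_iff algebra_simps)
  qed
qed (simp_all add: vec.vector_space_axioms basis3_bij assms(1))

end

lemma alt3_zero: "alt3 0 0 0 = (\<lambda>_ _. 0)"
  by (simp add: alt3_def fun_eq_iff)

context comm_assoc3
begin

lemma zero_lie_poisson3: "poisson3 m (\<lambda>_ _. 0)"
  by unfold_locales simp_all

lemma iso_comm_alg3:
  assumes "basis3 x y z"
    and prods: "x \<odot> x = comb3 x y z p11" "x \<odot> y = comb3 x y z p12" "x \<odot> z = comb3 x y z p13"
    "y \<odot> y = comb3 x y z p22" "y \<odot> z = comb3 x y z p23" "z \<odot> z = comb3 x y z p33"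
  shows "\<lparr>psmul = (*s), pmul = m, brk = \<lambda>_ _. 0\<rparr> \<cong>\<^sub>P zero_lie (comm_alg3 p11 p12 p13 p22 p23 p33)"
  using poisson3.iso_structure_constants[OF zero_lie_poisson3 assms, of 0 0 0]
  by (simp add: zero_lie_def comm_alg3_def alt3_zero)

end

lemma iso_coordinate_space:
  fixes P :: "('f::field, 'v::ab_group_add) poisson"
  assumes "poisson_algebra P" "poisson_dim P = 3"
  obtains m br :: "'f ^ 3 \<Rightarrow> 'f ^ 3 \<Rightarrow> 'f ^ 3"
  where "poisson3 m br" "P \<cong>\<^sub>P \<lparr>psmul = (*s), pmul = m, brk = br\<rparr>"
proof -
  have vs: "vector_space (psmul P)" using assms(1)
    by (simp add: poisson_algebra_def comm_assoc_algebra_def algebra_over_field_def assoc_part_def)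
  interpret V: vector_space "psmul P" by (rule vs)
  obtain B where B: "V.independent B" "V.span B = UNIV" "card B = 3"
    using V.basis_exists[of UNIV] assms(2) unfolding poisson_dim_def by (metis subset_UNIV subset_antisym)
  then have "finite B" by (metis card.infinite zero_neq_numeral)
  then interpret V: finite_dimensional_vector_space "psmul P" B
    using B by unfold_locales auto
  interpret pair: finite_dimensional_vector_space_pair "(*s) :: 'f \<Rightarrow> 'f ^ 3 \<Rightarrow> 'f ^ 3" cart_basis "psmul P" B
    by unfold_locales
  have "card (cart_basis :: ('f ^ 3) set) = card B"
    using dim3 B(3) by (metis vec.dim_UNIV)
  then obtain f :: "'f ^ 3 \<Rightarrow> 'v" where f: "Vector_Spaces.linear (*s) (psmul P) f" "bij f"
    using pair.basis_change_exists'[of "cart_basis :: ('f ^ 3) set" B] B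
    by (auto simp: V.dimension_def 
        finite_dimensional_vector_space.dimension_def[OF vec.finite_dimensional_vector_space_axioms]
        vec.independent_Basis vec.span_Basis)
  have f_add: "f (x + y) = f x + f y" and f_scale: "f (c *s x) = psmul P c (f x)" for x y c
    using f(1) by (simp_all add: Vector_Spaces.linear_iff)
  have f_0: "f 0 = 0" using f_scale[of 0 0] by simp
  have inj: "f x = f y \<longleftrightarrow> x = y" for x y using f(2) by (meson bij_is_inj inj_eq)
  define m where "m = (\<lambda>a b. inv f (pmul P (f a) (f b)))"
  define br where "br = (\<lambda>a b. inv f (brk P (f a) (f b)))"
  have fm: "f (m a b) = pmul P (f a) (f b)" and fbr: "f (br a b) = brk P (f a) (f b)" for a b
    using f(2) by (simp_all add: m_def br_def bij_is_surj surj_f_inv_f)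
  note alg = assms(1)[unfolded poisson_algebra_def comm_assoc_algebra_def lie_algebra_def
      algebra_over_field_def Vector_Spaces.linear_iff assoc_part_def lie_part_def alg.simps]
  have mult: "pmul P (x + y) z = pmul P x z + pmul P y z"
    "pmul P (psmul P c x) y = psmul P c (pmul P x y)"
    "pmul P (pmul P x y) z = pmul P x (pmul P y z)" for x y z c
    using alg by (elim conjE, simp only: all_conj_distrib simp_thms)+
  have mult_comm: "pmul P x y = pmul P y x" for x y
    using alg by (elim conjE, simp only: all_conj_distrib simp_thms)
  have bracket: "brk P (x + y) z = brk P x z + brk P y z" "brk P x (y + z) = brk P x y + brk P x z"
    "brk P (psmul P c x) y = psmul P c (brk P x y)" "brk P x (psmul P c y) = psmul P c (brk P x y)"
    "brk P x x = 0"
    "brk P x (brk P y z) + brk P y (brk P z x) + brk P z (brk P x y) = 0"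
    "brk P (pmul P x y) z = pmul P x (brk P y z) + pmul P y (brk P x z)" for x y z c
    using alg by (elim conjE, simp only: all_conj_distrib simp_thms)+
  have "poisson3 m br"
    by unfold_locales
      (simp_all only: inj[symmetric] f_add f_scale f_0 fm fbr, (rule mult bracket mult_comm)+)
  moreover have "P \<cong>\<^sub>P \<lparr>psmul = (*s), pmul = m, brk = br\<rparr>"
    by (rule poisson_iso_sym, rule poisson_isoI[where f = f])
      (simp_all add: vec.vector_space_axioms vs f f_add f_scale fm fbr)
  ultimately show ?thesis by (rule that)
qed

section \<open>Algebras without idempotents\<close>

context comm_assoc3
begin

lemmas expand = bilinear vec.scale_right_distrib vec.scale_right_diff_distrib

text \<open>
  Multiplication by \<open>x\<close> is nilpotent, so it has no eigenvalue other than \<open>0\<close>.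
\<close>

lemma nilpotent_eigenvalue:
  assumes "x \<odot> (x \<odot> (x \<odot> x)) = 0" "x \<odot> v = c *s v" "v \<noteq> 0"
  shows "c = 0"
proof -
  have "(x \<odot> (x \<odot> (x \<odot> x))) \<odot> v = (c * (c * (c * c))) *s v"
    using assms(2) by (simp add: assoc bilinear)
  then show ?thesis using assms(1,3) by simp
qed

text \<open>
  The relation between \<open>a, a\<^sup>2, a\<^sup>3, a\<^sup>4\<close>, divided by its lowest non-zero coefficient, gives
  \<open>b = s a + t a\<^sup>2 + r a\<^sup>3\<close> that acts as an identity on \<open>a\<^sup>4\<close>.  The elements on which \<open>b\<close> acts as an
  identity form an ideal.  Since \<open>b\<close> is formally divisible by \<open>a\<close>, the factors \<open>a\<close> of \<open>a\<^sup>4\<close> can be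
  exchanged for \<open>b\<close> one at a time without leaving this ideal, so \<open>b\<^sup>4\<close> lies in it and is idempotent.
\<close>

lemma nilpotent_or_idempotent:
  assumes "a \<odot> (a \<odot> (a \<odot> a)) \<noteq> 0"
  obtains c where "(a \<odot> c) \<odot> (a \<odot> c) = a \<odot> c" "a \<odot> c \<noteq> 0"
proof -
  define a2 where "a2 = a \<odot> a"
  define a3 where "a3 = a \<odot> a2"
  define a4 where "a4 = a \<odot> a3"
  have a4: "a4 \<noteq> 0" using assms by (simp add: a4_def a3_def a2_def)
  obtain c1 c2 c3 c4 where dep: "c1 *s a + c2 *s a2 + c3 *s a3 + c4 *s a4 = 0"
    "c1 \<noteq> 0 \<or> c2 \<noteq> 0 \<or> c3 \<noteq> 0 \<or> c4 \<noteq> 0" by (rule four_dependent)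
  have solve: "u = - (1/c) *s v" if "c *s u + v = 0" "c \<noteq> 0" for c and u v :: "'f ^ 3"
  proof -
    have "c *s u = - v" using that(1) by (simp add: eq_neg_iff_add_eq_0)
    then have "(1/c) *s (c *s u) = (1/c) *s (- v)" by simp
    then show ?thesis using that(2) by simp
  qed
  \<comment> \<open>the lowest non-zero coefficient of the relation serves as the divisor\<close>
  have "\<exists>s t r. a4 \<odot> (s *s a + t *s a2 + r *s a3) = a4"
  proof (cases "c1 = 0")
    case False
    have "a = (- (1/c1)) *s (c2 *s a2 + c3 *s a3 + c4 *s a4)"
      using solve[OF dep(1)[unfolded add.assoc] False] by (simp only: add.assoc)
    also have "\<dots> = a \<odot> ((- (c2/c1)) *s a + (- (c3/c1)) *s a2 + (- (c4/c1)) *s a3)"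
      by (simp add: expand a2_def a3_def a4_def)
    finally have "a \<odot> ((- (c2/c1)) *s a + (- (c3/c1)) *s a2 + (- (c4/c1)) *s a3) = a" ..
    then have "a4 \<odot> ((- (c2/c1)) *s a + (- (c3/c1)) *s a2 + (- (c4/c1)) *s a3) = a4"
      unfolding a4_def comm[of a a3] assoc by simp
    then show ?thesis by blast
  next
    case c1: True
    show ?thesis
    proof (cases "c2 = 0")
      case False
      have "a2 = (- (1/c2)) *s (c3 *s a3 + c4 *s a4)"
        by (rule solve[OF _ False]) (use dep(1) c1 in \<open>simp add: add.assoc\<close>)
      also have "\<dots> = a2 \<odot> ((- (c3/c2)) *s a + (- (c4/c2)) *s a2 + 0 *s a3)"
        by (simp add: expand a2_def a3_def a4_def comm assoc left_commute)
      finally have "a2 \<odot> ((- (c3/c2)) *s a + (- (c4/c2)) *s a2 + 0 *s a3) = a2" ..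
      then have "a4 \<odot> ((- (c3/c2)) *s a + (- (c4/c2)) *s a2 + 0 *s a3) = a4"
        unfolding a4_def a3_def assoc by simp
      then show ?thesis by blast
    next
      case c2: True
      show ?thesis
      proof (cases "c3 = 0")
        case False
        have "a3 = (- (1/c3)) *s (c4 *s a4)"
          by (rule solve[OF _ False]) (use dep(1) c1 c2 in simp)
        also have "\<dots> = a3 \<odot> ((- (c4/c3)) *s a + 0 *s a2 + 0 *s a3)"
          by (simp add: bilinear a4_def comm)
        finally have "a3 \<odot> ((- (c4/c3)) *s a + 0 *s a2 + 0 *s a3) = a3" ..
        then have "a4 \<odot> ((- (c4/c3)) *s a + 0 *s a2 + 0 *s a3) = a4"
          unfolding a4_def assoc by simp
        then show ?thesis by blast
      next
        case True
        then show ?thesis using dep c1 c2 a4 by auto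
      qed
    qed
  qed
  then obtain s t r where "a4 \<odot> (s *s a + t *s a2 + r *s a3) = a4" by blast
  define b where "b = s *s a + t *s a2 + r *s a3"
  have b: "a4 \<odot> b = a4" unfolding b_def by fact
  have factor: "b \<odot> w = a \<odot> (s *s w + t *s (a \<odot> w) + r *s (a2 \<odot> w))" for w
    unfolding b_def by (simp add: bilinear a3_def a2_def assoc)
  have step: "(b \<odot> w) \<odot> b = b \<odot> w" if w: "(a \<odot> w) \<odot> b = a \<odot> w" for w
  proof -
    have *: "(v \<odot> (a \<odot> w)) \<odot> b = v \<odot> (a \<odot> w)" for v by (simp only: assoc[of v] w)
    have eq: "b \<odot> w = s *s (a \<odot> w) + t *s (a \<odot> (a \<odot> w)) + r *s (a2 \<odot> (a \<odot> w))"
      by (simp add: b_def bilinear a3_def a2_def assoc)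
    show ?thesis unfolding eq add_left scale_left w * ..
  qed
  \<comment> \<open>exchange the factors \<open>a\<close> for \<open>b\<close> one by one\<close>
  define e where "e = b \<odot> (b \<odot> (b \<odot> b))"
  have 0: "(a \<odot> (a \<odot> (a \<odot> a))) \<odot> b = a \<odot> (a \<odot> (a \<odot> a))"
    using b unfolding a4_def a3_def a2_def .
  have 1: "(a \<odot> (b \<odot> (a \<odot> a))) \<odot> b = a \<odot> (b \<odot> (a \<odot> a))"
    using step[OF 0] by (simp only: left_commute[of b a] comm[of b a])
  have 2: "(a \<odot> (b \<odot> (b \<odot> a))) \<odot> b = a \<odot> (b \<odot> (b \<odot> a))"
    using step[OF 1] by (simp only: left_commute[of b a] comm[of b a])
  have 3: "(a \<odot> (b \<odot> (b \<odot> b))) \<odot> b = a \<odot> (b \<odot> (b \<odot> b))"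
    using step[OF 2] by (simp only: left_commute[of b a] comm[of b a])
  have eb: "e \<odot> b = e"
    using step[OF 3] unfolding e_def .
  have "e \<odot> e = e" proof -
    have "e \<odot> (b \<odot> (b \<odot> (b \<odot> b))) = e" by (simp only: assoc[symmetric] eb)
    then show ?thesis by (simp only: e_def[symmetric])
  qed
  moreover have "e \<noteq> 0"
  proof
    assume "e = 0"
    have "a4 \<odot> e = a4" unfolding e_def by (simp only: assoc[symmetric] b)
    then show False using \<open>e = 0\<close> a4 by simp
  qed
  moreover obtain c where "e = a \<odot> c" unfolding e_def using factor by blast
  ultimately show ?thesis using that by blast
qed

text \<open>
  If \<open>a\<^sup>3 \<noteq> 0\<close>, the powers of \<open>a\<close> form a basis.  If all cubes vanish but \<open>z = a\<^sup>2 \<noteq> 0\<close>, nilpotency of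
  the multiplications by \<open>a\<close> and by a complementary \<open>y\<close> forces all products into the line of \<open>z\<close>.  If
  all squares vanish but \<open>z = a b \<noteq> 0\<close>, the products again span the line of \<open>z\<close>; this happens in
  characteristic two only.
\<close>

lemma nil_classification:
  assumes nil: "\<And>a. a \<odot> (a \<odot> (a \<odot> a)) = 0"
  obtains (zero) "\<And>x y. x \<odot> y = 0"
  | (chain) x y z where "basis3 x y z" "x \<odot> x = y" "x \<odot> y = z" "x \<odot> z = 0"
      "y \<odot> y = 0" "y \<odot> z = 0" "z \<odot> z = 0"
  | (rank1) x y z where "basis3 x y z" "x \<odot> x = z" "x \<odot> y = 0" "x \<odot> z = 0"
      "y \<odot> y = 0" "y \<odot> z = 0" "z \<odot> z = 0"
  | (rank2) x y z \<alpha> \<beta> \<gamma> where "basis3 x y z" "x \<odot> x = \<alpha> *s z" "x \<odot> y = \<beta> *s z" "x \<odot> z = 0"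
      "y \<odot> y = \<gamma> *s z" "y \<odot> z = 0" "z \<odot> z = 0" "\<alpha> * \<gamma> - \<beta> * \<beta> \<noteq> 0"
proof -
  consider (cube) a where "a \<odot> (a \<odot> a) \<noteq> 0"
    | (square) a where "a \<odot> a \<noteq> 0" "\<And>v. v \<odot> (v \<odot> v) = 0"
    | (alternating) a b where "a \<odot> b \<noteq> 0" "\<And>v. v \<odot> v = 0"
    | (none) "\<And>a b. a \<odot> b = 0"
    by (cases "\<exists>a. a \<odot> (a \<odot> a) \<noteq> 0"; cases "\<exists>a. a \<odot> a \<noteq> 0";
        cases "\<exists>a b. a \<odot> b \<noteq> 0") auto
  then show thesis
  proof cases
    case cube
    define z where "z = a \<odot> (a \<odot> a)"
    have z: "z \<noteq> 0" using cube by (simp add: z_def)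
    have az: "a \<odot> z = 0" unfolding z_def by (rule nil)
    have aaz: "(a \<odot> a) \<odot> z = 0" by (simp add: assoc az)
    have aaaa: "(a \<odot> a) \<odot> (a \<odot> a) = 0" using nil[of a] by (simp add: assoc)
    have zz: "z \<odot> z = 0" by (simp add: z_def[of] assoc) (simp add: z_def[symmetric] az)
    have bas: "basis3 a (a \<odot> a) z"
      unfolding basis3_def
    proof (intro allI impI)
      fix p q r assume dep: "p *s a + q *s (a \<odot> a) + r *s z = 0"
      have "(a \<odot> a) \<odot> (p *s a + q *s (a \<odot> a) + r *s z) = p *s z"
        by (simp add: bilinear aaaa aaz) (simp add: z_def assoc)
      then have p: "p = 0" using dep z by simp
      have "a \<odot> (p *s a + q *s (a \<odot> a) + r *s z) = q *s z"
        using p by (simp add: bilinear az z_def[symmetric])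
      then have q: "q = 0" using dep z by simp
      show "p = 0 \<and> q = 0 \<and> r = 0" using p q dep z by simp
    qed
    show thesis by (rule chain[OF bas refl z_def[symmetric] az aaaa aaz zz])
  next
    case square
    define z where "z = a \<odot> a"
    have z: "z \<noteq> 0" using square(1) by (simp add: z_def)
    have az: "a \<odot> z = 0" unfolding z_def by (rule square(2))
    have zz: "z \<odot> z = 0" using az by (metis assoc z_def zero_right)
    have indep: "p = 0 \<and> q = 0" if dep: "p *s a + q *s z = 0" for p q
    proof -
      have "a \<odot> (p *s a + q *s z) = p *s z" by (simp add: bilinear az z_def[symmetric])
      then have "p = 0" using dep z by simp
      then show ?thesis using dep z by simp
    qed
    obtain y where b: "basis3 a z y" by (rule extend_basis3[OF indep])
    obtain p q r where ay: "a \<odot> y = p *s a + q *s z + r *s y" by (rule basis3_span[OF b])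
    \<comment> \<open>the coefficient of \<open>y\<close> in \<open>a\<^sup>3 y = 0\<close> is \<open>r\<^sup>3\<close>\<close>
    have "a \<odot> (a \<odot> (a \<odot> y)) = (r * r * p) *s a + (r * p + r * r * q) *s z + (r * r * r) *s y"
      by (simp add: ay bilinear az z_def[symmetric]; simp add: vec_eq_iff algebra_simps)
    moreover have "a \<odot> (a \<odot> (a \<odot> y)) = 0"
      using square(2)[of a] by (metis assoc zero_left)
    ultimately have "r * r * r = 0" using basis3D(3)[OF b] by metis
    then have r: "r = 0" by simp
    have zy: "y \<odot> z = p *s z"
    proof -
      have "y \<odot> z = a \<odot> (a \<odot> y)" by (simp add: z_def comm[of y] assoc)
      also have "\<dots> = p *s z" by (simp add: ay r bilinear az z_def[symmetric])
      finally show ?thesis .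
    qed
    have p: "p = 0" using nilpotent_eigenvalue[OF nil zy z] .
    have ay': "a \<odot> y = q *s z" and yz: "y \<odot> z = 0" using ay zy p r by simp_all
    obtain s t u where yy: "y \<odot> y = s *s a + t *s z + u *s y" by (rule basis3_span[OF b])
    have "y \<odot> (y \<odot> y) = (u * s) *s a + (s * q + u * t) *s z + (u * u) *s y"
      by (simp add: yy bilinear yz comm[of y a] ay'; simp add: vec_eq_iff algebra_simps)
    then have "u * u = 0" using basis3D(3)[OF b] square(2)[of y] by metis
    then have u: "u = 0" by simp
    have "a \<odot> (y \<odot> y) = s *s z"
      by (simp add: yy bilinear az u z_def[symmetric])
    moreover have "a \<odot> (y \<odot> y) = 0"
      by (simp add: assoc[symmetric] ay' bilinear comm[of z y] yz)
    ultimately have s: "s = 0" using z by simp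
    have yy': "y \<odot> y = t *s z" using yy s u by simp
    have b': "basis3 a y z" by (rule basis3_swap23[OF b])
    show thesis
    proof (cases "t - q * q = 0")
      case False
      have "a \<odot> a = 1 *s z" by (simp add: z_def)
      from rank2[OF b' this ay' az yy' yz zz] show thesis using False by simp
    next
      case True
      \<comment> \<open>the form is degenerate, and \<open>y - q a\<close> spans its radical\<close>
      define y' where "y' = (- q) *s a + 0 *s z + 1 *s y"
      have azy: "basis3 a z y'" unfolding y'_def by (rule basis3_replace[OF b]) simp
      have by': "basis3 a y' z" by (rule basis3_swap23[OF azy])
      have ay0: "a \<odot> y' = 0" by (simp add: y'_def bilinear ay' z_def[symmetric])
      have "y' \<odot> y' = (t - q * q) *s z"
        by (simp add: y'_def bilinear ay' comm[of y a] yy' z_def[symmetric];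
          simp add: vec_eq_iff algebra_simps)
      then have yy0: "y' \<odot> y' = 0" using True by simp
      have yz0: "y' \<odot> z = 0" by (simp add: y'_def bilinear yz az)
      show thesis by (rule rank1[OF by' z_def[symmetric] ay0 az yy0 yz0 zz])
    qed
  next
    case alternating
    define z where "z = a \<odot> b"
    have z: "z \<noteq> 0" using alternating(1) by (simp add: z_def)
    have az: "a \<odot> z = 0" using alternating(2)[of a] by (metis assoc z_def zero_left)
    have bz: "b \<odot> z = 0" using alternating(2)[of b] by (metis assoc comm z_def zero_left)
    have bas: "basis3 a b z"
      unfolding basis3_def
    proof (intro allI impI)
      fix p q r assume dep: "p *s a + q *s b + r *s z = 0"
      have "b \<odot> (p *s a + q *s b + r *s z) = p *s z"
        by (simp add: bilinear alternating(2) bz comm[of b a] z_def[symmetric])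
      then have p: "p = 0" using dep z by simp
      have "a \<odot> (p *s a + q *s b + r *s z) = q *s z"
        by (simp add: bilinear alternating(2) az z_def[symmetric])
      then have q: "q = 0" using dep z by simp
      show "p = 0 \<and> q = 0 \<and> r = 0" using p q dep z by simp
    qed
    have sq: "v \<odot> v = 0 *s z" for v by (simp add: alternating(2))
    have "a \<odot> b = 1 *s z" by (simp add: z_def)
    from rank2[OF bas sq this az sq bz alternating(2)] show thesis by simp
  next
    case none
    then show thesis by (rule zero)
  qed
qed

end

section \<open>Commutative associative algebras of dimension three\<close>

text \<open>
  The algebra \<open>F[t]/(t\<^sup>2 - \<beta> t - \<alpha>)\<close>, with \<open>(a, b)\<close> standing for \<open>a + b t\<close>.
\<close>

definition quad_alg :: "'f::field \<Rightarrow> 'f \<Rightarrow> ('f, 'f ^ 2) alg" where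
  "quad_alg \<alpha> \<beta> = \<lparr>smul = (*s), mul = (\<lambda>a b. vector
     [a$1 * b$1 + \<alpha> * (a$2 * b$2), a$1 * b$2 + a$2 * b$1 + \<beta> * (a$2 * b$2)])\<rparr>"

text \<open>
  The inverse of \<open>a + b t\<close> is its conjugate \<open>a + \<beta> b - b t\<close> divided by the norm
  \<open>a\<^sup>2 + \<beta> a b - \<alpha> b\<^sup>2\<close>, and a zero of the norm with \<open>b \<noteq> 0\<close> would give the root \<open>- a / b\<close>.  The
  argument covers inseparable extensions.
\<close>

lemma quadratic_extension_quad_alg:
  fixes \<alpha> \<beta> :: "'f::field"
  assumes irred: "\<And>r. r * r \<noteq> \<beta> * r + \<alpha>"
  shows "quadratic_extension (quad_alg \<alpha> \<beta>)"
proof -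
  define u :: "'f ^ 2" where "u = vector [1, 0]"
  have u: "u \<noteq> 0" by (simp add: u_def vec2_eq_iff)
  have one: "mul (quad_alg \<alpha> \<beta>) u x = x" for x
    by (simp add: u_def quad_alg_def vec2_eq_iff)
  have inverse: "\<exists>y. mul (quad_alg \<alpha> \<beta>) x y = u" if x: "x \<noteq> 0" for x
  proof -
    define n where "n = x$1 * x$1 + \<beta> * (x$1 * x$2) - \<alpha> * (x$2 * x$2)"
    have "n \<noteq> 0"
    proof
      assume n: "n = 0"
      show False
      proof (cases "x$2 = 0")
        case True
        then show False using n x by (simp add: n_def vec2_eq_iff)
      next
        case False
        have "(- x$1 / x$2) * (- x$1 / x$2) = \<beta> * (- x$1 / x$2) + \<alpha>"
          using n False by (simp add: n_def field_simps)
        then show False using irred by blast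
      qed
    qed
    then have "mul (quad_alg \<alpha> \<beta>) x (vector [(x$1 + \<beta> * x$2) / n, - x$2 / n]) = u"
      by (simp add: quad_alg_def vec2_eq_iff u_def divide_simps) (simp add: n_def algebra_simps)
    then show ?thesis by blast
  qed
  have "comm_assoc_algebra (quad_alg \<alpha> \<beta>)"
    by (simp add: comm_assoc_algebra_def algebra_over_field_def Vector_Spaces.linear_iff
        quad_alg_def vec.vector_space_axioms vec2_eq_iff algebra_simps)
  moreover have "alg_dim (quad_alg \<alpha> \<beta>) = 2"
    by (simp only: alg_dim_def quad_alg_def alg.simps vec_dim_card) simp
  ultimately show ?thesis
    unfolding quadratic_extension_def field_extension_def using u one inverse by blast
qed

lemma vector_space_prod:
  assumes "vector_space s" "vector_space t"
  shows "vector_space (\<lambda>c (a, b). (s c a, t c b))"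
proof -
  interpret S: vector_space s by fact
  interpret T: vector_space t by fact
  show ?thesis
    by unfold_locales
      (auto simp: S.scale_right_distrib S.scale_left_distrib T.scale_right_distrib T.scale_left_distrib)
qed

lemma vector_space_field: "vector_space ((*) :: 'f::field \<Rightarrow> 'f \<Rightarrow> 'f)"
  by unfold_locales (simp_all add: algebra_simps)

lemma comm3_nth:
  "comm3 p11 p12 p13 p22 p23 p33 a b $ i =
     a$1 * b$1 * p11$i + (a$1 * b$2 + a$2 * b$1) * p12$i + (a$1 * b$3 + a$3 * b$1) * p13$i +
     a$2 * b$2 * p22$i + (a$2 * b$3 + a$3 * b$2) * p23$i + a$3 * b$3 * p33$i"
  by (simp only: comm3_def vector_add_component vector_smult_component)

lemma table_P3_9:
  "zero_lie (comm_alg3 b1 b2 0 (\<alpha> *s b1 + \<beta> *s b2) 0 0) \<cong>\<^sub>P P3_9 (quad_alg \<alpha> \<beta>)"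
proof (rule poisson_isoI)
  let ?f = "\<lambda>a :: 'a ^ 3. (vector [a$1, a$2] :: 'a ^ 2, a$3)"
  show "bij ?f"
  proof (rule bijI')
    show "(?f x = ?f y) = (x = y)" for x y by (auto simp: vec2_eq_iff vec3_eq_iff)
    show "\<exists>x. y = ?f x" for y
      by (rule exI[of _ "vector [fst y $ 1, fst y $ 2, snd y]"])
        (simp add: prod_eq_iff vec2_eq_iff)
  qed
qed (simp_all add: zero_lie_def comm_alg3_def P3_9_def alg_prod_def quad_alg_def null_alg_def
    vec.vector_space_axioms vector_space_prod vector_space_field vec2_eq_iff comm3_nth zero_prod_def
    algebra_simps)

lemma table_P3_12:
  "zero_lie (comm_alg3 b1 0 0 b2 b3 (\<alpha> *s b2 + \<beta> *s b3)) \<cong>\<^sub>P P3_12 (quad_alg \<alpha> \<beta>)"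
proof (rule poisson_isoI)
  let ?f = "\<lambda>a :: 'a ^ 3. (a$1, vector [a$2, a$3] :: 'a ^ 2)"
  show "bij ?f"
  proof (rule bijI')
    show "(?f x = ?f y) = (x = y)" for x y by (auto simp: vec2_eq_iff vec3_eq_iff)
    show "\<exists>x. y = ?f x" for y
      by (rule exI[of _ "vector [fst y, snd y $ 1, snd y $ 2]"])
        (simp add: prod_eq_iff vec2_eq_iff)
  qed
qed (simp_all add: zero_lie_def comm_alg3_def P3_12_def alg_prod_def quad_alg_def base_alg_def
    vec.vector_space_axioms vector_space_prod vector_space_field vec2_eq_iff comm3_nth zero_prod_def
    algebra_simps)

lemma bij_vec3_triple: "bij (\<lambda>a :: 'f::zero ^ 3. (a$1, a$2, a$3))"
proof (rule bijI')
  show "((x$1, x$2, x$3) = (y$1, y$2, y$3)) = (x = y)" for x y :: "'f ^ 3"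
    by (auto simp: vec3_eq_iff)
  show "\<exists>x :: 'f ^ 3. y = (x$1, x$2, x$3)" for y :: "'f \<times> 'f \<times> 'f"
    by (rule exI[of _ "vector [fst y, fst (snd y), snd (snd y)] :: 'f ^ 3"]) simp
qed

lemma table_P3_10: "zero_lie (comm_alg3 b1 0 0 b2 0 b3) \<cong>\<^sub>P P3_10"
  by (rule poisson_isoI[OF _ _ _ _ bij_vec3_triple])
    (simp_all add: zero_lie_def comm_alg3_def P3_10_def alg_prod_def base_alg_def
    vec.vector_space_axioms vector_space_prod vector_space_field comm3_nth zero_prod_def)

lemma table_P3_11: "zero_lie (comm_alg3 b1 0 0 b2 b3 0) \<cong>\<^sub>P P3_11"
  by (rule poisson_isoI[OF _ _ _ _ bij_vec3_triple])
    (simp_all add: zero_lie_def comm_alg3_def P3_11_def alg_prod_def base_alg_def dual_numbers_def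
    vec.vector_space_axioms vector_space_prod vector_space_field comm3_nth zero_prod_def)

text \<open>
  An inductive predicate rather than a disjunction, so that each family is available as an
  introduction rule.
\<close>

inductive zero_lie_type :: "('f::field, 'v::ab_group_add) poisson \<Rightarrow> bool" for P where
  "P \<cong>\<^sub>P P3_1 \<Longrightarrow> zero_lie_type P"
| "P \<cong>\<^sub>P P3_2 \<Longrightarrow> zero_lie_type P"
| "P \<cong>\<^sub>P P3_3 \<Longrightarrow> zero_lie_type P"
| "sym_mat M \<Longrightarrow> det M \<noteq> 0 \<Longrightarrow> P \<cong>\<^sub>P P3_4 M \<Longrightarrow> zero_lie_type P"
| "P \<cong>\<^sub>P P3_5 \<Longrightarrow> zero_lie_type P"
| "P \<cong>\<^sub>P P3_6 \<Longrightarrow> zero_lie_type P"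
| "P \<cong>\<^sub>P P3_7 \<Longrightarrow> zero_lie_type P"
| "P \<cong>\<^sub>P P3_8 \<Longrightarrow> zero_lie_type P"
| "quadratic_extension (E :: ('f, 'f ^ 2) alg) \<Longrightarrow> P \<cong>\<^sub>P P3_9 E \<Longrightarrow> zero_lie_type P"
| "P \<cong>\<^sub>P P3_10 \<Longrightarrow> zero_lie_type P"
| "P \<cong>\<^sub>P P3_11 \<Longrightarrow> zero_lie_type P"
| "quadratic_extension (E :: ('f, 'f ^ 2) alg) \<Longrightarrow> P \<cong>\<^sub>P P3_12 E \<Longrightarrow> zero_lie_type P"
| "cubic_extension (K :: ('f, 'f ^ 3) alg) \<Longrightarrow> P \<cong>\<^sub>P P3_13 K \<Longrightarrow> zero_lie_type P"
| "P \<cong>\<^sub>P P3_14 \<Longrightarrow> zero_lie_type P"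
| "P \<cong>\<^sub>P P3_15 \<Longrightarrow> zero_lie_type P"

context comm_assoc3
begin

abbreviation "zero_lie_m \<equiv> \<lparr>psmul = (*s), pmul = m, brk = \<lambda>_ _. 0\<rparr>"

text \<open>
  If the polynomial \<open>X\<^sup>2 - \<beta> X - \<alpha>\<close> has a root \<open>r\<close>, then \<open>s = t - r f\<close> satisfies \<open>s\<^sup>2 = \<delta> s\<close> with \<open>\<delta>\<close>
  the difference of the two roots, so \<open>s\<close> is square-zero or a multiple of an idempotent.
\<close>

lemma quadratic_cases:
  assumes f: "f \<odot> f = f" "f \<odot> t = t" and tt: "t \<odot> t = \<alpha> *s f + \<beta> *s t"
  obtains (irreducible) "\<And>r. r * r \<noteq> \<beta> * r + \<alpha>"
  | (double) s r where "s = t - r *s f" "s \<odot> s = 0" "f \<odot> s = s"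
  | (split) g r \<delta> where "g = (1 / \<delta>) *s (t - r *s f)" "\<delta> \<noteq> 0" "g \<odot> g = g" "f \<odot> g = g"
proof (cases "\<exists>r. r * r = \<beta> * r + \<alpha>")
  case True
  then obtain r where r: "r * r = \<beta> * r + \<alpha>" ..
  define s where "s = t - r *s f"
  \<comment> \<open>\<open>\<beta> - r\<close> is the other root\<close>
  define \<delta> where "\<delta> = \<beta> - 2 * r"
  have fs: "f \<odot> s = s" by (simp add: s_def bilinear f)
  have "s \<odot> s = (\<beta> - 2 * r) *s t + (\<alpha> + r * r) *s f"
    by (simp add: s_def bilinear f comm[of t f] tt vec_eq_iff algebra_simps)
  also have "\<alpha> + r * r = - (\<delta> * r)"
  proof -
    have "\<alpha> = r * r - \<beta> * r" using r by simp
    then show ?thesis by (simp add: \<delta>_def algebra_simps)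
  qed
  finally have e: "s \<odot> s = (\<beta> - 2 * r) *s t + - (\<delta> * r) *s f" .
  have ss: "s \<odot> s = \<delta> *s s"
    by (rule trans[OF e]) (simp add: s_def \<delta>_def vec_eq_iff algebra_simps)
  show thesis
  proof (cases "\<delta> = 0")
    case True
    show thesis by (rule double[OF s_def _ fs]) (simp add: ss True)
  next
    case False
    have "((1 / \<delta>) *s s) \<odot> ((1 / \<delta>) *s s) = (1 / \<delta>) *s s" "f \<odot> ((1 / \<delta>) *s s) = (1 / \<delta>) *s s"
      using False by (simp_all add: bilinear ss fs)
    then show thesis using split[of "(1 / \<delta>) *s s" \<delta> r] False s_def by simp
  qed
qed (simp add: irreducible)

lemma three_idempotents:
  assumes "basis3 x y z" "x \<odot> x = x" "y \<odot> y = y" "z \<odot> z = z"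
    "x \<odot> y = 0" "x \<odot> z = 0" "y \<odot> z = 0"
  shows "zero_lie_type zero_lie_m"
  by (rule zero_lie_type.intros(10), rule poisson_iso_trans[OF _ table_P3_10],
      rule iso_comm_alg3[OF assms(1)]) (simp_all add: assms(2-))

lemma two_idempotents_null:
  assumes "basis3 x y z" "x \<odot> x = x" "y \<odot> y = y" "z \<odot> z = 0"
    "x \<odot> y = 0" "x \<odot> z = 0" "y \<odot> z = 0"
  shows "zero_lie_type zero_lie_m"
  by (rule zero_lie_type.intros(7), unfold P3_7_def,
      rule iso_comm_alg3[OF assms(1)]) (simp_all add: assms(2-))

text \<open>
  The plane of \<open>f\<close> and \<open>t\<close> is a unital algebra with identity \<open>f\<close>, annihilated by the idempotent \<open>e\<close>;
  it is a field, contains a square-zero element or splits.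
\<close>

lemma unital_plane_times_field:
  assumes b: "basis3 e f t" and e: "e \<odot> e = e" "e \<odot> f = 0" "e \<odot> t = 0"
    and f: "f \<odot> f = f" "f \<odot> t = t" and tt: "t \<odot> t = \<alpha> *s f + \<beta> *s t"
  shows "zero_lie_type zero_lie_m"
  using f tt
proof (cases rule: quadratic_cases)
  case irreducible
  show ?thesis
    by (rule zero_lie_type.intros(12)[OF quadratic_extension_quad_alg[OF irreducible]],
        rule poisson_iso_trans[OF _ table_P3_12], rule iso_comm_alg3[OF b])
      (simp_all add: e f tt)
next
  case (double s r)
  have "s = 0 *s e + (- r) *s f + 1 *s t" using double(1) by (simp add: vec_eq_iff)
  then have b': "basis3 e f s" by (rule basis3_cong[OF b]) simp
  have es: "e \<odot> s = 0" by (simp add: double(1) bilinear e)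
  show ?thesis
    by (rule zero_lie_type.intros(11), rule poisson_iso_trans[OF _ table_P3_11],
        rule iso_comm_alg3[OF b']) (simp_all add: e f es double(2,3))
next
  case (split g r \<delta>)
  have "g = 0 *s e + (- r / \<delta>) *s f + (1 / \<delta>) *s t"
    by (simp add: split(1) vec_eq_iff algebra_simps)
  then have b': "basis3 e f g" by (rule basis3_cong[OF b]) (simp add: split(2))
  have "f - g = 0 *s e + (- 1) *s g + 1 *s f" by (simp add: vec_eq_iff)
  then have b'': "basis3 e g (f - g)" by (rule basis3_cong[OF basis3_swap23[OF b']]) simp
  have eg: "e \<odot> g = 0" by (simp add: split(1) bilinear e)
  show ?thesis
    by (rule three_idempotents[OF b'']) (simp_all add: bilinear e f eg split(3,4) comm[of g f])
qed

text \<open>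
  The plane of \<open>e\<close> and \<open>t\<close> is a unital algebra with identity \<open>e\<close>, annihilated by the null vector \<open>z\<close>;
  it is a field, contains a square-zero element or splits.
\<close>

lemma unital_plane_times_null:
  assumes b: "basis3 e t z" and z: "z \<odot> z = 0" "e \<odot> z = 0" "t \<odot> z = 0"
    and e: "e \<odot> e = e" "e \<odot> t = t" and tt: "t \<odot> t = \<alpha> *s e + \<beta> *s t"
  shows "zero_lie_type zero_lie_m"
  using e tt
proof (cases rule: quadratic_cases)
  case irreducible
  show ?thesis
    by (rule zero_lie_type.intros(9)[OF quadratic_extension_quad_alg[OF irreducible]],
        rule poisson_iso_trans[OF _ table_P3_9], rule iso_comm_alg3[OF b])
      (simp_all add: e z tt)
next
  case (double s r)
  have "s = 0 *s z + (- r) *s e + 1 *s t" using double(1) by (simp add: vec_eq_iff)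
  then have "basis3 z e s" by (rule basis3_cong[OF basis3_rot[OF basis3_rot[OF b]]]) simp
  then have b': "basis3 e s z" by (rule basis3_rot)
  have sz: "s \<odot> z = 0" by (simp add: double(1) bilinear z)
  show ?thesis
    by (rule zero_lie_type.intros(8), unfold P3_8_def,
        rule iso_comm_alg3[OF b']) (simp_all add: e z sz double(2,3))
next
  case (split g r \<delta>)
  have "g = 0 *s z + (- r / \<delta>) *s e + (1 / \<delta>) *s t"
    by (simp add: split(1) vec_eq_iff algebra_simps)
  then have b': "basis3 z e g" by (rule basis3_cong[OF basis3_rot[OF basis3_rot[OF b]]]) (simp add: split(2))
  have "e - g = 0 *s z + (- 1) *s g + 1 *s e" by (simp add: vec_eq_iff)
  then have "basis3 z g (e - g)" by (rule basis3_cong[OF basis3_swap23[OF b']]) simp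
  then have b'': "basis3 g (e - g) z" by (rule basis3_rot)
  have gz: "g \<odot> z = 0" by (simp add: split(1) bilinear z)
  show ?thesis
    by (rule two_idempotents_null[OF b'']) (simp_all add: bilinear e z gz split(3,4) comm[of g e])
qed

text \<open>
  The kernel of multiplication by \<open>e\<close> is an ideal of dimension two.  An idempotent \<open>f\<close> in it has
  a one-dimensional image, which splits the kernel further, or is the identity of the kernel, which is
  then a unital plane.  Without idempotents the kernel is nilpotent.
\<close>

lemma rank1_idempotent:
  assumes ee: "e \<odot> e = e" and e0: "e \<noteq> 0" and rank1: "\<And>v. \<exists>c. e \<odot> v = c *s e"
  shows "zero_lie_type zero_lie_m"
proof -
  obtain x' y' where b0: "basis3 e x' y'" by (rule extend_basis3_1[OF e0])
  obtain c d where cd: "e \<odot> x' = c *s e" "e \<odot> y' = d *s e" using rank1 by metis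
  define x where "x = x' - c *s e"
  define y where "y = y' - d *s e"
  have ex: "e \<odot> x = 0" and ey: "e \<odot> y = 0" by (simp_all add: x_def y_def bilinear ee cd)
  have "y = (- d) *s e + 0 *s x' + 1 *s y'" by (simp add: y_def vec_eq_iff)
  then have "basis3 e x' y" by (rule basis3_cong[OF b0]) simp
  then have b1: "basis3 e y x'" by (rule basis3_swap23)
  have "x = (- c) *s e + 0 *s y + 1 *s x'" by (simp add: x_def vec_eq_iff)
  then have "basis3 e y x" by (rule basis3_cong[OF b1]) simp
  then have b: "basis3 e x y" by (rule basis3_swap23)
  have kernel: "\<exists>p q. v = p *s x + q *s y" if ev: "e \<odot> v = 0" for v
  proof -
    obtain a p q where v: "v = a *s e + p *s x + q *s y" by (rule basis3_span[OF b])
    have "a *s e = 0" using ev by (simp add: v bilinear ee ex ey)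
    then show ?thesis using v e0 by auto
  qed
  have ideal: "e \<odot> (u \<odot> v) = 0" if "e \<odot> u = 0" for u v
    using that by (simp add: assoc[symmetric])
  show ?thesis
  proof (cases "\<exists>f. e \<odot> f = 0 \<and> f \<odot> f = f \<and> f \<noteq> 0")
    case True
    then obtain f where ef: "e \<odot> f = 0" and ff: "f \<odot> f = f" and f0: "f \<noteq> 0" by auto
    have indep: "p = 0 \<and> q = 0" if dep: "p *s e + q *s f = 0" for p q
    proof -
      have "e \<odot> (p *s e + q *s f) = p *s e" by (simp add: bilinear ee ef)
      then have "p = 0" using dep e0 by simp
      then show ?thesis using dep f0 by simp
    qed
    show ?thesis
    proof (cases "\<forall>v. \<exists>c. f \<odot> v = c *s f")
      case True
      obtain z' where bz': "basis3 e f z'" by (rule extend_basis3[OF indep])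
      obtain c d where cd: "e \<odot> z' = c *s e" "f \<odot> z' = d *s f" using rank1 True by metis
      define z where "z = z' - c *s e - d *s f"
      have ez: "e \<odot> z = 0" and fz: "f \<odot> z = 0"
        by (simp_all add: z_def bilinear ee ff ef comm[of f e] cd)
      have "z = (- c) *s e + (- d) *s f + 1 *s z'" by (simp add: z_def vec_eq_iff)
      then have bz: "basis3 e f z" by (rule basis3_cong[OF bz']) simp
      obtain p q l where zz: "z \<odot> z = p *s e + q *s f + l *s z" by (rule basis3_span[OF bz])
      have "e \<odot> (z \<odot> z) = p *s e" by (simp add: zz bilinear ee ef ez)
      then have p: "p = 0" using ideal[OF ez] e0 by simp
      have "f \<odot> (z \<odot> z) = q *s f" by (simp add: zz bilinear ff comm[of f e] ef fz)
      moreover have "f \<odot> (z \<odot> z) = 0" by (simp add: assoc[symmetric] fz)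
      ultimately have q: "q = 0" using f0 by simp
      have zz': "z \<odot> z = l *s z" using zz p q by simp
      show ?thesis
      proof (cases "l = 0")
        case True
        show ?thesis by (rule two_idempotents_null[OF bz ee ff _ ef ez fz]) (simp add: zz' True)
      next
        case False
        have bg: "basis3 e f ((1 / l) *s z)"
          by (rule basis3_cong[OF bz, of _ 0 0 "1 / l"]) (simp_all add: False)
        show ?thesis
          by (rule three_idempotents[OF bg ee ff _ ef]) (simp_all add: bilinear ez fz zz' False)
      qed
    next
      case False
      then obtain v where v: "\<And>c. f \<odot> v \<noteq> c *s f" by auto
      define t where "t = f \<odot> v"
      have ft: "f \<odot> t = t" by (simp add: t_def assoc[symmetric] ff)
      have et: "e \<odot> t = 0" unfolding t_def by (rule ideal[OF ef])
      have bt: "basis3 e f t"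
        unfolding basis3_def
      proof (intro allI impI)
        fix p q r assume dep: "p *s e + q *s f + r *s t = 0"
        have "e \<odot> (p *s e + q *s f + r *s t) = p *s e" by (simp add: bilinear ee ef et)
        then have p: "p = 0" using dep e0 by simp
        have r: "r = 0"
        proof (rule ccontr)
          assume "r \<noteq> 0"
          from solve_last[OF dep this] p have "t = (- q / r) *s f" by simp
          then show False using v unfolding t_def by blast
        qed
        show "p = 0 \<and> q = 0 \<and> r = 0" using p r dep f0 by simp
      qed
      obtain p \<alpha> \<beta> where tt: "t \<odot> t = p *s e + \<alpha> *s f + \<beta> *s t" by (rule basis3_span[OF bt])
      have "e \<odot> (t \<odot> t) = p *s e" by (simp add: tt bilinear ee ef et)
      then have p: "p = 0" using ideal[OF et] e0 by simp
      have tt': "t \<odot> t = \<alpha> *s f + \<beta> *s t" using tt p by simp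
      show ?thesis by (rule unital_plane_times_field[OF bt ee ef et ff ft tt'])
    qed
  next
    case False
    have nil: "a \<odot> (a \<odot> (a \<odot> a)) = 0" if ea: "e \<odot> a = 0" for a
    proof (rule ccontr)
      assume "a \<odot> (a \<odot> (a \<odot> a)) \<noteq> 0"
      then obtain c where "(a \<odot> c) \<odot> (a \<odot> c) = a \<odot> c" "a \<odot> c \<noteq> 0"
        by (rule nilpotent_or_idempotent)
      then show False using False ideal[OF ea, of c] by blast
    qed
    show ?thesis
    proof (cases "\<exists>w. e \<odot> w = 0 \<and> w \<odot> w \<noteq> 0")
      case True
      then obtain w where ew: "e \<odot> w = 0" and w2: "w \<odot> w \<noteq> 0" by auto
      define z where "z = w \<odot> w"
      have z: "z \<noteq> 0" using w2 by (simp add: z_def)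
      have ez: "e \<odot> z = 0" unfolding z_def by (rule ideal[OF ew])
      have bz: "basis3 e w z"
        unfolding basis3_def
      proof (intro allI impI)
        fix p q r assume dep: "p *s e + q *s w + r *s z = 0"
        have "e \<odot> (p *s e + q *s w + r *s z) = p *s e" by (simp add: bilinear ee ew ez)
        then have p: "p = 0" using dep e0 by simp
        have r: "r = 0"
        proof (rule ccontr)
          assume "r \<noteq> 0"
          from solve_last[OF dep this] p have "w \<odot> w = (- q / r) *s w" by (simp add: z_def)
          from nilpotent_eigenvalue[OF nil[OF ew] this] have "w \<noteq> 0 \<longrightarrow> - q / r = 0" by blast
          with \<open>w \<odot> w = (- q / r) *s w\<close> have "w \<odot> w = 0" by (cases "w = 0") auto
          then show False using w2 by simp
        qed
        have "w \<noteq> 0" using w2 by auto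
        then show "p = 0 \<and> q = 0 \<and> r = 0" using p r dep by simp
      qed
      obtain a p q where wz: "w \<odot> z = a *s e + p *s w + q *s z" by (rule basis3_span[OF bz])
      have "e \<odot> (w \<odot> z) = a *s e" by (simp add: wz bilinear ee ew ez)
      then have a: "a = 0" using ideal[OF ew] e0 by simp
      have "w \<odot> (w \<odot> (w \<odot> w)) = 0 *s e + (q * p) *s w + (p + q * q) *s z"
        by (simp add: z_def[symmetric] wz a bilinear; simp add: vec_eq_iff algebra_simps)
      then have eq: "0 *s e + (q * p) *s w + (p + q * q) *s z = 0" using nil[OF ew] by simp
      note pq = basis3D(2,3)[OF bz eq]
      have "q = 0 \<and> p = 0" using pq by (cases "q = 0") auto
      then have wz': "w \<odot> z = 0" using wz a by simp
      have zz: "z \<odot> z = 0" using nil[OF ew] by (simp add: z_def assoc)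
      show ?thesis
        by (rule zero_lie_type.intros(6), unfold P3_6_def, rule iso_comm_alg3[OF bz])
          (simp_all add: ee ew ez wz' zz z_def[symmetric])
    next
      case False
      then have sq: "v \<odot> v = 0" if "e \<odot> v = 0" for v using that by blast
      obtain p q where xy: "x \<odot> y = p *s x + q *s y" using kernel[OF ideal[OF ex]] by blast
      have xx: "x \<odot> x = 0" and yy: "y \<odot> y = 0" by (simp_all add: sq ex ey)
      have "q *s (x \<odot> y) = x \<odot> (x \<odot> y)" by (simp add: xy[THEN arg_cong[of _ _ "m x"]] bilinear xx)
      also have "\<dots> = 0" by (simp add: assoc[symmetric] xx)
      finally have q: "q = 0 \<or> x \<odot> y = 0" by simp
      have "p *s (x \<odot> y) = y \<odot> (x \<odot> y)" by (simp add: xy[THEN arg_cong[of _ _ "m y"]] bilinear yy comm[of y x])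
      also have "\<dots> = 0" by (simp add: left_commute[of y x] yy)
      finally have p: "p = 0 \<or> x \<odot> y = 0" by simp
      have xy0: "x \<odot> y = 0" using p q xy by (cases "x \<odot> y = 0") auto
      show ?thesis
        by (rule zero_lie_type.intros(2), unfold P3_2_def, rule iso_comm_alg3[OF b])
          (simp_all add: ee ex ey xx yy xy0)
    qed
  qed
qed

lemma null_or_chain_types:
  assumes nil: "\<And>a. a \<odot> (a \<odot> (a \<odot> a)) = 0"
  shows "zero_lie_type zero_lie_m"
  using nil
proof (cases rule: nil_classification)
  case zero
  obtain x y z :: "'f ^ 3" where b: "basis3 x y z"
    by (rule extend_basis3_1[of b1]) simp_all
  show ?thesis
    by (rule zero_lie_type.intros(1), unfold P3_1_def, rule iso_comm_alg3[OF b]) (simp_all add: zero)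
next
  case (chain x y z)
  show ?thesis
    by (rule zero_lie_type.intros(5), unfold P3_5_def, rule iso_comm_alg3[OF chain(1)])
      (simp_all add: chain)
next
  case (rank1 x y z)
  show ?thesis
    by (rule zero_lie_type.intros(3), unfold P3_3_def, rule iso_comm_alg3[OF rank1(1)])
      (simp_all add: rank1)
next
  case (rank2 x y z \<alpha> \<beta> \<gamma>)
  define M :: "'f ^ 2 ^ 2" where "M = vector [vector [\<alpha>, \<beta>], vector [\<beta>, \<gamma>]]"
  have M: "M$1$1 = \<alpha>" "M$1$2 = \<beta>" "M$2$1 = \<beta>" "M$2$2 = \<gamma>" by (simp_all add: M_def)
  have "sym_mat M" by (simp add: sym_mat_def transpose_def vec2_eq_iff M)
  moreover have "det M \<noteq> 0" using rank2 by (simp add: det_2 M)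
  ultimately show ?thesis
    by (rule zero_lie_type.intros(4), unfold P3_4_def M, intro iso_comm_alg3[OF rank2(1)])
      (simp_all add: rank2)
qed

text \<open>
  Every element is nilpotent or invertible.  If the algebra is not a field, it contains \<open>n \<noteq> 0\<close> with
  \<open>n\<^sup>2 = 0\<close>, and \<open>n\<close> also annihilates a vector \<open>t\<close> outside the plane of \<open>e\<close> and \<open>n\<close>.  Then \<open>t\<close> is not
  invertible, hence nilpotent, and the maximal ideal is the plane of \<open>n\<close> and \<open>t\<close>.
\<close>

lemma unital_types:
  assumes one: "\<And>v. e \<odot> v = v" and e0: "e \<noteq> 0"
    and idem: "\<And>f. f \<odot> f = f \<Longrightarrow> f = 0 \<or> f = e"
  shows "zero_lie_type zero_lie_m"
proof -
  have dichotomy: "a \<odot> (a \<odot> (a \<odot> a)) = 0 \<or> (\<exists>c. a \<odot> c = e)" for a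
  proof (rule disjCI, rule ccontr)
    assume *: "\<nexists>c. a \<odot> c = e" and nonzero: "a \<odot> (a \<odot> (a \<odot> a)) \<noteq> 0"
    from nonzero obtain c where "(a \<odot> c) \<odot> (a \<odot> c) = a \<odot> c" "a \<odot> c \<noteq> 0"
      by (rule nilpotent_or_idempotent)
    then show False using idem[of "a \<odot> c"] * by blast
  qed
  show ?thesis
  proof (cases "\<forall>a. a \<noteq> 0 \<longrightarrow> (\<exists>c. a \<odot> c = e)")
    case True
    define K :: "('f, 'f ^ 3) alg" where "K = \<lparr>smul = (*s), mul = m\<rparr>"
    have "comm_assoc_algebra K"
      by (simp add: K_def comm_assoc_algebra_def algebra_over_field_def Vector_Spaces.linear_iff
          vec.vector_space_axioms bilinear assoc) (simp add: comm)
    then have "field_extension K"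
      unfolding field_extension_def using one e0 True by (auto simp: K_def)
    moreover have "alg_dim K = 3" by (simp only: alg_dim_def K_def alg.simps dim3)
    ultimately have "cubic_extension K" by (simp add: cubic_extension_def)
    moreover have "zero_lie_m \<cong>\<^sub>P P3_13 K"
      by (rule poisson_isoI[where f = "\<lambda>x. x"])
        (simp_all add: K_def P3_13_def zero_lie_def vec.vector_space_axioms bij_id[unfolded id_def])
    ultimately show ?thesis by (rule zero_lie_type.intros(13))
  next
    case False
    then obtain a where a0: "a \<noteq> 0" and a: "\<And>c. a \<odot> c \<noteq> e" by auto
    have a4: "a \<odot> (a \<odot> (a \<odot> a)) = 0" using dichotomy[of a] a by blast
    have "\<exists>n. n \<noteq> 0 \<and> n \<odot> n = 0"
    proof (cases "a \<odot> a = 0")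
      case True
      then show ?thesis using a0 by blast
    next
      case a2: False
      show ?thesis
      proof (cases "a \<odot> (a \<odot> a) = 0")
        case True
        then have "(a \<odot> a) \<odot> (a \<odot> a) = 0" by (simp add: assoc)
        then show ?thesis using a2 by blast
      next
        case False
        have "(a \<odot> (a \<odot> a)) \<odot> (a \<odot> (a \<odot> a)) = 0"
          by (simp add: assoc left_commute) (simp add: a4)
        then show ?thesis using False by blast
      qed
    qed
    then obtain n where n0: "n \<noteq> 0" and nn: "n \<odot> n = 0" by auto
    have one': "v \<odot> e = v" for v by (simp only: comm[of v e] one)
    have indep: "p = 0 \<and> q = 0" if dep: "p *s e + q *s n = 0" for p q
    proof -
      have "n \<odot> (p *s e + q *s n) = p *s n" by (simp add: bilinear one' nn)
      then have "p = 0" using dep n0 by simp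
      then show ?thesis using dep n0 by simp
    qed
    obtain w where bw: "basis3 e n w" by (rule extend_basis3[OF indep])
    obtain p q r where nw: "n \<odot> w = p *s e + q *s n + r *s w" by (rule basis3_span[OF bw])
    have nnv: "n \<odot> (n \<odot> v) = 0" for v by (simp add: assoc[symmetric] nn)
    have "\<exists>t. basis3 e n t \<and> n \<odot> t = 0"
    proof (cases "r = 0")
      case False
      then show ?thesis using basis3_cong[OF bw nw] nnv by blast
    next
      case True
      have "n \<odot> (n \<odot> w) = p *s n" by (simp add: nw True bilinear one' nn)
      then have p: "p = 0" using nnv n0 by simp
      define t where "t = w - q *s e"
      have "t = (- q) *s e + 0 *s n + 1 *s w" by (simp add: t_def vec_eq_iff)
      then have "basis3 e n t" by (rule basis3_cong[OF bw]) simp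
      moreover have "n \<odot> t = 0" by (simp add: t_def bilinear one' nw p True)
      ultimately show ?thesis by blast
    qed
    then obtain t where b: "basis3 e n t" and nt: "n \<odot> t = 0" by auto
    have "t \<odot> c \<noteq> e" for c
    proof
      assume "t \<odot> c = e"
      then have "n \<odot> (t \<odot> c) = n" by (simp add: one')
      then show False using n0 by (simp add: assoc[symmetric] nt)
    qed
    then have t4: "t \<odot> (t \<odot> (t \<odot> t)) = 0" using dichotomy[of t] by blast
    obtain s u l where tt: "t \<odot> t = s *s e + u *s n + l *s t" by (rule basis3_span[OF b])
    have "n \<odot> (t \<odot> t) = s *s n" by (simp add: tt bilinear one' nn nt)
    moreover have "n \<odot> (t \<odot> t) = 0" by (simp add: assoc[symmetric] nt)
    ultimately have s: "s = 0" using n0 by simp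
    have "t \<odot> (t \<odot> (t \<odot> t)) = 0 *s e + (l * l * u) *s n + (l * l * l) *s t"
      by (simp add: tt s bilinear comm[of t n] nt; simp add: vec_eq_iff algebra_simps)
    then have eq: "0 *s e + (l * l * u) *s n + (l * l * l) *s t = 0" using t4 by simp
    have l: "l = 0" using basis3D(3)[OF b eq] by simp
    have tt': "t \<odot> t = u *s n" using tt s l by simp
    show ?thesis
    proof (cases "u = 0")
      case True
      show ?thesis
        by (rule zero_lie_type.intros(14), unfold P3_14_def, rule iso_comm_alg3[OF b])
          (simp_all add: one nn nt tt' True)
    next
      case False
      have "basis3 e t (u *s n)"
        by (rule basis3_cong[OF basis3_swap23[OF b], of _ 0 0 u]) (simp_all add: False)
      then show ?thesis
        by (intro zero_lie_type.intros(15), unfold P3_15_def, elim iso_comm_alg3)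
          (simp_all add: one nn nt comm[of t n] bilinear tt')
    qed
  qed
qed

text \<open>
  The cases are: no idempotent, an idempotent of rank one, and idempotents of higher rank only.  In the
  last case a non-identity idempotent \<open>e\<close> has rank two, and the complementary line is null because a
  non-zero square on it would produce an idempotent of rank one.
\<close>

theorem zero_lie_classification: "zero_lie_type zero_lie_m"
proof -
  consider (nil) "\<And>a. a \<odot> (a \<odot> (a \<odot> a)) = 0"
    | (rank1) e where "e \<odot> e = e" "e \<noteq> 0" "\<And>v. \<exists>c. e \<odot> v = c *s e"
    | (higher) e where "e \<odot> e = e" "e \<noteq> 0"
      "\<And>f. f \<odot> f = f \<Longrightarrow> f \<noteq> 0 \<Longrightarrow> \<exists>v. \<forall>c. f \<odot> v \<noteq> c *s f"
  proof (cases "\<exists>e. e \<odot> e = e \<and> e \<noteq> 0 \<and> (\<forall>v. \<exists>c. e \<odot> v = c *s e)")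
    case True
    then show ?thesis using rank1 by auto
  next
    case no1: False
    show ?thesis
    proof (cases "\<exists>e. e \<odot> e = e \<and> e \<noteq> 0")
      case True
      then obtain e where e: "e \<odot> e = e" "e \<noteq> 0" by auto
      show ?thesis
      proof (rule higher[OF e])
        fix f assume "f \<odot> f = f" "f \<noteq> 0"
        then show "\<exists>v. \<forall>c. f \<odot> v \<noteq> c *s f" using no1 by auto
      qed
    next
      case False
      show ?thesis
      proof (rule nil, rule ccontr)
        fix a assume "a \<odot> (a \<odot> (a \<odot> a)) \<noteq> 0"
        then obtain c where "(a \<odot> c) \<odot> (a \<odot> c) = a \<odot> c" "a \<odot> c \<noteq> 0"
          by (rule nilpotent_or_idempotent)
        then show False using False by auto
      qed
    qed
  qed
  then show ?thesis
  proof cases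
    case nil
    then show ?thesis by (rule null_or_chain_types)
  next
    case (rank1 e)
    then show ?thesis by (rule rank1_idempotent)
  next
    case (higher e)
    show ?thesis
    proof (cases "\<exists>e. e \<odot> e = e \<and> e \<noteq> 0 \<and> (\<exists>v. e \<odot> v \<noteq> v)")
      case False
      then have identity: "f \<odot> v = v" if "f \<odot> f = f" "f \<noteq> 0" for f v using that by auto
      show ?thesis
      proof (rule unital_types[of e])
        show "e \<odot> v = v" for v by (rule identity[OF higher(1,2)])
        show "f = 0 \<or> f = e" if "f \<odot> f = f" for f
        proof (rule disjCI)
          assume "f \<noteq> e"
          show "f = 0"
          proof (rule ccontr)
            assume "f \<noteq> 0"
            from identity[OF that this, of e] identity[OF higher(1,2), of f] show False
              using \<open>f \<noteq> e\<close> by (simp add: comm)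
          qed
        qed
      qed (rule higher(2))
    next
      case True
      then obtain e w where ee: "e \<odot> e = e" and e0: "e \<noteq> 0" and w: "e \<odot> w \<noteq> w" by auto
      define z where "z = w - e \<odot> w"
      have z0: "z \<noteq> 0" using w by (simp add: z_def)
      have ez: "e \<odot> z = 0" by (simp add: z_def bilinear assoc[symmetric] ee)
      obtain v where v: "\<And>c. e \<odot> v \<noteq> c *s e" using higher(3)[OF ee e0] by auto
      define t where "t = e \<odot> v"
      have et: "e \<odot> t = t" by (simp add: t_def assoc[symmetric] ee)
      have tz: "t \<odot> z = 0" by (simp add: t_def comm[of e v] assoc ez)
      have b: "basis3 e t z"
        unfolding basis3_def
      proof (intro allI impI)
        fix p q r assume dep: "p *s e + q *s t + r *s z = 0"
        have "e \<odot> (p *s e + q *s t + r *s z) = p *s e + q *s t" by (simp add: bilinear ee et ez)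
        then have pq: "p *s e + q *s t = 0" using dep by simp
        then have r: "r = 0" using dep z0 by simp
        have q: "q = 0"
        proof (rule ccontr)
          assume "q \<noteq> 0"
          have "0 *s e + p *s e + q *s t = 0" using pq by simp
          from solve_last[OF this \<open>q \<noteq> 0\<close>] have "t = (- p / q) *s e" by simp
          then show False using v unfolding t_def by blast
        qed
        show "p = 0 \<and> q = 0 \<and> r = 0" using pq q r e0 by simp
      qed
      obtain p q l where zz: "z \<odot> z = p *s e + q *s t + l *s z" by (rule basis3_span[OF b])
      have "p *s e + q *s t + 0 *s z = e \<odot> (z \<odot> z)" by (simp add: zz bilinear ee et ez)
      also have "\<dots> = 0" by (simp add: assoc[symmetric] ez)
      finally have pq: "p *s e + q *s t + 0 *s z = 0" .
      have zz': "z \<odot> z = l *s z" using zz basis3D(1,2)[OF b pq] by simp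
      have l: "l = 0"
      proof (rule ccontr)
        assume l: "l \<noteq> 0"
        define g where "g = (1 / l) *s z"
        have g: "g \<odot> g = g" by (simp add: g_def bilinear zz' l)
        have g0: "g \<noteq> 0" using z0 l by (simp add: g_def)
        obtain u where u: "\<And>c. g \<odot> u \<noteq> c *s g" using higher(3)[OF g g0] by auto
        obtain i j k where uu: "u = i *s e + j *s t + k *s z" by (rule basis3_span[OF b])
        have "g \<odot> u = (k * l) *s g"
          by (simp add: uu g_def bilinear comm[of z e] comm[of z t] ez tz zz' l)
        then show False using u by blast
      qed
      have zz0: "z \<odot> z = 0" using zz' l by simp
      obtain \<alpha> \<beta> r where tt: "t \<odot> t = \<alpha> *s e + \<beta> *s t + r *s z" by (rule basis3_span[OF b])
      have "e \<odot> (t \<odot> t) = \<alpha> *s e + \<beta> *s t" by (simp add: tt bilinear ee et ez)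
      then have tt': "t \<odot> t = \<alpha> *s e + \<beta> *s t" by (simp add: assoc[symmetric] et)
      show ?thesis by (rule unital_plane_times_null[OF b zz0 ez tz ee et tt'])
    qed
  qed
qed

end

section \<open>Lie algebras of dimension three\<close>

context poisson3
begin

lemma br_expand:
  "br (a *s x + b *s y + c *s z) (a' *s x + b' *s y + c' *s z) =
     (a * b' - b * a') *s br x y + (a * c' - c * a') *s br x z + (b * c' - c * b') *s br y z"
  by (simp add: br_bilinear br_anti[of y x] br_anti[of z x] br_anti[of z y];
      simp add: vec_eq_iff algebra_simps)

lemma br_in_subspace:
  assumes b: "basis3 x y z" and S: "vec.subspace S"
    and mem: "br x y \<in> S" "br x z \<in> S" "br y z \<in> S"
  shows "br v w \<in> S"
proof -
  obtain a b c where v: "v = a *s x + b *s y + c *s z" by (rule basis3_span[OF b])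
  obtain a' b' c' where w: "w = a' *s x + b' *s y + c' *s z" by (rule basis3_span[OF b])
  show ?thesis unfolding v w br_expand
    by (intro vec.subspace_add[OF S] vec.subspace_scale[OF S] mem)
qed

text \<open>
  The element \<open>k\<close> is central and the only bracket is \<open>[x, l]\<close>; whether the derived line is central
  depends on the component of \<open>[x, l]\<close> along \<open>l\<close>.
\<close>

lemma lie_derived_line:
  assumes b: "basis3 x k l" and kl: "br k l = 0" and xk: "br x k = 0"
    and xl: "br x l = s *s k + t *s l" and nz: "s \<noteq> 0 \<or> t \<noteq> 0"
  obtains (heisenberg) x y z where "basis3 x y z" "br x y = z" "br x z = 0" "br y z = 0"
  | (affine) x y z where "basis3 x y z" "br x y = y" "br x z = 0" "br y z = 0"
proof (cases "t = 0")
  case True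
  then have "s \<noteq> 0" using nz by simp
  then have b': "basis3 x l (s *s k)"
    by (intro basis3_cong[OF basis3_swap23[OF b], of _ 0 0 s]) simp_all
  have "br l (s *s k) = 0" using kl br_anti[of l k] by (simp add: br_bilinear)
  then show thesis
    by (intro heisenberg[OF b']) (simp_all add: xl True xk br_bilinear)
next
  case False
  define w where "w = s *s k + t *s l"
  have "w = 0 *s x + s *s k + t *s l" by (simp add: w_def)
  then have "basis3 x k w" by (rule basis3_cong[OF b _ False])
  then have "basis3 w k x" by (rule basis3_swap[OF basis3_rot])
  then have "basis3 w k ((1/t) *s x)"
    by (rule basis3_cong[of _ _ _ _ 0 0 "1/t"]) (simp_all add: False)
  then have b': "basis3 ((1/t) *s x) w k" by (rule basis3_rot[OF basis3_rot])
  have xw: "br x w = t *s w"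
    by (simp add: w_def br_bilinear xk xl)
  have wk: "br w k = 0" using kl br_anti[of l k] by (simp add: w_def br_bilinear)
  show thesis
    by (rule affine[OF b']) (simp_all add: br_bilinear xw xk wk False)
qed

text \<open>
  Unless the brackets of basis vectors are independent, they lie in the plane of two vectors \<open>u\<close> and
  \<open>v\<close>.  If \<open>w = [u, v] \<noteq> 0\<close>, the third basis vector acts on \<open>w\<close> by the trace of its action on the
  plane, and subtracting this action leaves a vector that commutes with \<open>w\<close>.  If \<open>[u, v] = 0\<close>, the
  rank of the action on the plane decides.
\<close>

lemma lie_classification:
  obtains (zero) "\<And>x y. br x y = 0"
  | (heisenberg) x y z where "basis3 x y z" "br x y = z" "br x z = 0" "br y z = 0"
  | (affine) x y z where "basis3 x y z" "br x y = y" "br x z = 0" "br y z = 0"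
  | (plane) x u v a b c d where "basis3 x u v" "br x u = a *s u + b *s v" "br x v = c *s u + d *s v"
      "br u v = 0" "a * d - b * c \<noteq> 0"
  | (perfect) "\<And>S. vec.subspace S \<Longrightarrow> (\<And>x y. br x y \<in> S) \<Longrightarrow> S = UNIV"
proof -
  obtain x y z :: "'f ^ 3" where xyz: "basis3 x y z"
    by (rule extend_basis3_1[of b1]) simp_all
  show thesis
  proof (cases "basis3 (br x y) (br x z) (br y z)")
    case True
    have "S = UNIV" if S: "vec.subspace S" and mem: "\<And>x y. br x y \<in> S" for S
    proof -
      have "v \<in> S" for v
      proof -
        obtain a b c where v: "v = a *s br x y + b *s br x z + c *s br y z"
          by (rule basis3_span[OF True])
        show ?thesis unfolding v
          by (intro vec.subspace_add[OF S] vec.subspace_scale[OF S] mem)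
      qed
      then show ?thesis by auto
    qed
    then show thesis by (rule perfect)
  next
    case False
    obtain X u v where b: "basis3 X u v" and mem: "br x y \<in> vec.span {u, v}"
      "br x z \<in> vec.span {u, v}" "br y z \<in> vec.span {u, v}"
      by (rule plane_through_dependent[OF False])
    have "br p q \<in> vec.span {u, v}" for p q
      by (rule br_in_subspace[OF xyz vec.subspace_span mem])
    then have ex: "\<exists>a b. br p q = a *s u + b *s v" for p q unfolding span2_eq by blast
    obtain a b where Xu: "br X u = a *s u + b *s v" using ex by blast
    obtain c d where Xv: "br X v = c *s u + d *s v" using ex by blast
    obtain g h where uv: "br u v = g *s u + h *s v" using ex by blast
    show thesis
    proof (cases "br u v = 0")
      case w0: False
      define w where "w = br u v"
      have w: "w \<noteq> 0" using w0 by (simp add: w_def)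
      have Xw: "br X w = (a + d) *s w"
      proof -
        have "br X w + br u (br v X) + br v (br X u) = 0"
          unfolding w_def by (rule jacobi)
        moreover have "br u (br v X) = - d *s w"
          by (simp add: br_anti[of v X] Xv br_bilinear w_def)
        moreover have "br v (br X u) = - a *s w"
          by (simp add: Xu br_bilinear br_anti[of v u] w_def)
        ultimately show ?thesis by (simp add: vec_eq_iff algebra_simps)
      qed
      \<comment> \<open>\<open>w\<close> has a non-zero component along \<open>u\<close> or \<open>v\<close>, so a multiple of the other vector acts on it as \<open>1\<close>\<close>
      have "\<exists>y. basis3 X y w \<and> br y w = w"
      proof (cases "h = 0")
        case False
        have "w = 0 *s X + g *s u + h *s v" by (simp add: w_def uv)
        then have "basis3 X u w" by (rule basis3_cong[OF b _ False])
        then have "basis3 X w u" by (rule basis3_swap23)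
        then have "basis3 X w ((1/h) *s u)"
          by (rule basis3_cong[of _ _ _ _ 0 0 "1/h"]) (simp_all add: False)
        then have "basis3 X ((1/h) *s u) w" by (rule basis3_swap23)
        moreover have "br u w = h *s w" by (simp add: w_def) (simp add: uv br_bilinear)
        then have "br ((1/h) *s u) w = w" by (simp add: br_bilinear False)
        ultimately show ?thesis by blast
      next
        case True
        then have g: "g \<noteq> 0" using w by (auto simp: w_def uv)
        have "w = 0 *s X + 0 *s v + g *s u" by (simp add: w_def uv True)
        then have "basis3 X v w" by (rule basis3_cong[OF basis3_swap23[OF b] _ g])
        then have "basis3 X w v" by (rule basis3_swap23)
        then have "basis3 X w ((- 1/g) *s v)"
          by (rule basis3_cong[of _ _ _ _ 0 0 "- 1/g"]) (simp_all add: g)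
        then have "basis3 X ((- 1/g) *s v) w" by (rule basis3_swap23)
        moreover have "br v w = - g *s w"
        proof -
          have "br v w = br v (g *s u)" by (simp add: w_def uv True)
          then show ?thesis by (simp add: br_bilinear br_anti[of v u] w_def)
        qed
        then have "br ((- 1/g) *s v) w = w" by (simp add: br_bilinear g)
        ultimately show ?thesis by blast
      qed
      then obtain y where by': "basis3 X y w" and yw: "br y w = w" by blast
      define z where "z = X - (a + d) *s y"
      have "z = (- (a + d)) *s y + 0 *s w + 1 *s X" by (simp add: z_def vec_eq_iff)
      then have bz: "basis3 y w z" by (rule basis3_cong[OF basis3_rot[OF by']]) simp
      have zw: "br z w = 0" by (simp add: z_def br_bilinear Xw yw)
      obtain p q r where yz: "br y z = p *s y + q *s w + r *s z" by (rule basis3_span[OF bz])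
      have "br y (br z w) + br z (br w y) + br w (br y z) = 0" by (rule jacobi)
      moreover have "br z (br w y) = 0" by (simp add: br_anti[of w y] yw br_bilinear zw)
      moreover have "br w (br y z) = - p *s w"
        by (simp add: yz br_bilinear br_anti[of w y] yw br_anti[of w z] zw)
      ultimately have "p *s w = 0" by (simp add: zw)
      then have p: "p = 0" using w by simp
      show thesis
      proof (cases "r = 0")
        case False
        \<comment> \<open>the brackets of \<open>y\<close> with \<open>z\<close> and \<open>w\<close> are independent, which is the planar case again\<close>
        show thesis
          by (rule plane[of y z w r q 0 1])
            (use basis3_swap23[OF bz] False in \<open>simp_all add: yz p yw zw add.commute\<close>)
      next
        case True
        define z' where "z' = z - q *s w"
        have "z' = 0 *s y + (- q) *s w + 1 *s z" by (simp add: z'_def vec_eq_iff)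
        then have bz': "basis3 y w z'" by (rule basis3_cong[OF bz]) simp
        show thesis
          by (rule affine[OF bz' yw])
            (simp_all add: z'_def br_bilinear yz p True yw br_anti[of w z] zw)
      qed
    next
      case uv0: True
      have vu0: "br v u = 0" using br_anti[of v u] uv0 by simp
      show thesis
      proof (cases "a * d - b * c = 0")
        case False
        then show thesis by (rule plane[OF b Xu Xv uv0])
      next
        case det: True
        consider "c \<noteq> 0" | "c = 0" "a \<noteq> 0" | "c = 0" "a = 0" "d \<noteq> 0"
          | "c = 0" "a = 0" "d = 0" "b \<noteq> 0" | "a = 0" "b = 0" "c = 0" "d = 0" by blast
        then show thesis
        proof cases
          case 1
          define k where "k = c *s u - a *s v"
          have "k = 0 *s X + (- a) *s v + c *s u" by (simp add: k_def vec_eq_iff)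
          then have "basis3 X v k" by (rule basis3_cong[OF basis3_swap23[OF b] _ 1])
          then have bk: "basis3 X k v" by (rule basis3_swap23)
          have "br X k = - (a * d - b * c) *s v"
            by (simp add: k_def br_bilinear Xu Xv; simp add: vec_eq_iff algebra_simps)
          then have Xk: "br X k = 0" by (simp add: det)
          have "br k v = 0" by (simp add: k_def br_bilinear uv0)
          from bk this Xk show thesis
          proof (rule lie_derived_line)
            show "br X v = 1 *s k + (a + d) *s v"
              by (simp add: Xv k_def vec_eq_iff algebra_simps)
          qed (simp_all add: heisenberg affine)
        next
          case 2
          have d: "d = 0" using det 2 by simp
          have Xk: "br X v = 0" by (simp add: Xv 2 d)
          from basis3_swap23[OF b] vu0 Xk show thesis
          proof (rule lie_derived_line)
            show "br X u = b *s v + a *s u" by (simp add: Xu add.commute)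
          qed (simp_all add: heisenberg affine 2)
        next
          case 3
          define k where "k = d *s u - b *s v"
          have "k = 0 *s X + (- b) *s v + d *s u" by (simp add: k_def vec_eq_iff)
          then have "basis3 X v k" by (rule basis3_cong[OF basis3_swap23[OF b] _ 3(3)])
          then have bk: "basis3 X k v" by (rule basis3_swap23)
          have Xk: "br X k = 0"
            by (simp add: k_def br_bilinear Xu Xv 3; simp add: vec_eq_iff algebra_simps)
          have "br k v = 0" by (simp add: k_def br_bilinear uv0)
          from bk this Xk show thesis
          proof (rule lie_derived_line)
            show "br X v = 0 *s k + d *s v" by (simp add: Xv 3)
          qed (simp_all add: heisenberg affine 3)
        next
          case 4
          have Xk: "br X v = 0" by (simp add: Xv 4)
          from basis3_swap23[OF b] vu0 Xk show thesis
          proof (rule lie_derived_line)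
            show "br X u = b *s v + 0 *s u" by (simp add: Xu 4)
          qed (simp_all add: heisenberg affine 4)
        next
          case 5
          have "br p q \<in> {0}" for p q
            by (rule br_in_subspace[OF b vec.subspace_single_0])
              (simp_all add: Xu Xv uv0 5)
          then show thesis by (intro zero) simp
        qed
      qed
    qed
  qed
qed

end

section \<open>Associative products compatible with a Lie bracket\<close>

inductive lie_type :: "('f::field, 'v::ab_group_add) poisson \<Rightarrow> bool" for P where
  "sym_mat M \<Longrightarrow> P \<cong>\<^sub>P P3_16 M \<Longrightarrow> lie_type P"
| "P \<cong>\<^sub>P P3_17 \<Longrightarrow> lie_type P"
| "P \<cong>\<^sub>P P3_18 \<Longrightarrow> lie_type P"
| "P \<cong>\<^sub>P P3_19 \<Longrightarrow> lie_type P"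
| "P \<cong>\<^sub>P P3_20 \<Longrightarrow> lie_type P"
| "invertible (A :: 'f ^ 2 ^ 2) \<Longrightarrow> P \<cong>\<^sub>P P3_21 A \<Longrightarrow> lie_type P"
| "CHAR('f) = 2 \<Longrightarrow> P \<cong>\<^sub>P P3_22 q \<Longrightarrow> lie_type P"
| "simple_lie_algebra3 (L :: ('f, 'f ^ 3) alg) \<Longrightarrow> P \<cong>\<^sub>P P3_23 L \<Longrightarrow> lie_type P"

lemma double_square_eq_square:
  fixes a :: "'f::field"
  assumes "2 * a * a = a * a"
  shows "a = 0"
proof -
  have "a * a = 2 * a * a - a * a" by (simp only: mult_2 distrib_right add_diff_cancel_right')
  also have "\<dots> = 0" by (simp only: assms diff_self)
  finally have "a * a = 0" .
  then show ?thesis by simp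
qed

context poisson3
begin

abbreviation "poisson_m_br \<equiv> \<lparr>psmul = (*s), pmul = m, brk = br\<rparr>"

text \<open>
  Taking brackets of the products of basis vectors with \<open>x\<close> and \<open>y\<close> extracts their coefficients along
  \<open>y\<close> and \<open>x\<close>, and the Leibniz rule expresses all of them through \<open>z x = \<mu> z\<close> and \<open>z y = \<nu> z\<close>.  In
  particular \<open>x\<^sup>2 = 2 \<mu> x + \<alpha> z\<close>, so associativity of \<open>x x z\<close> gives \<open>2 \<mu>\<^sup>2 = \<mu>\<^sup>2\<close>.
\<close>

lemma heisenberg_types:
  assumes b: "basis3 x y z" and xy: "br x y = z" and xz: "br x z = 0" and yz: "br y z = 0"
  shows "lie_type poisson_m_br"
proof -
  have yx: "br y x = - z" and zx: "br z x = 0" and zy: "br z y = 0"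
    using br_anti[of y x] br_anti[of z x] br_anti[of z y] xy xz yz by simp_all
  have z0: "z \<noteq> 0" using basis3D(3)[OF b, of 0 0 1] by auto
  have zscale: "c = d" if "c *s z = d *s z" for c d
    using that z0 by simp
  have zneg: "c = d" if "(- c) *s z = (- d) *s z" for c d
    using zscale[OF that] by simp
  have coeff: "br (p *s x + q *s y + r *s z) y = p *s z" "br (p *s x + q *s y + r *s z) x = (- q) *s z"
    for p q r by (simp_all add: br_bilinear xy yx zx zy)
  obtain a1 a2 \<mu> where mzx: "z \<odot> x = a1 *s x + a2 *s y + \<mu> *s z" by (rule basis3_span[OF b])
  obtain d1 d2 \<nu> where mzy: "z \<odot> y = d1 *s x + d2 *s y + \<nu> *s z" by (rule basis3_span[OF b])
  obtain p1 p2 \<alpha> where mxx: "x \<odot> x = p1 *s x + p2 *s y + \<alpha> *s z" by (rule basis3_span[OF b])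
  obtain q1 q2 \<beta> where mxy: "x \<odot> y = q1 *s x + q2 *s y + \<beta> *s z" by (rule basis3_span[OF b])
  obtain r1 r2 \<gamma> where myy: "y \<odot> y = r1 *s x + r2 *s y + \<gamma> *s z" by (rule basis3_span[OF b])
  have a2: "a2 = 0"
  proof -
    have "br (z \<odot> x) x = 0" by (simp add: leibniz zx)
    then show ?thesis unfolding mzx coeff using z0 by simp
  qed
  have mzz: "z \<odot> z = a1 *s z"
  proof -
    have "br (z \<odot> x) y = z \<odot> z" by (simp add: leibniz zy xy)
    then show ?thesis unfolding mzx coeff by simp
  qed
  have d1: "d1 = 0"
  proof -
    have "br (z \<odot> y) y = 0" by (simp add: leibniz zy)
    then show ?thesis unfolding mzy coeff using z0 by simp
  qed
  have d2: "d2 = a1"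
  proof -
    have "br (z \<odot> y) x = - (z \<odot> z)" by (simp add: leibniz zx yx minus_right)
    then have "(- d2) *s z = (- a1) *s z" unfolding mzy coeff mzz by simp
    then show ?thesis by (rule zneg)
  qed
  have a1: "a1 = 0"
  proof -
    have "br (x \<odot> y) y = y \<odot> z" by (simp add: leibniz xy)
    then have "0 *s x + a1 *s y + (\<nu> - q1) *s z = 0"
      unfolding mxy coeff comm[of y z] mzy d1 d2 by (simp add: algebra_simps)
    then show ?thesis by (rule basis3D(2)[OF b])
  qed
  have q1: "q1 = \<nu>"
  proof -
    have "br (x \<odot> y) y = y \<odot> z" by (simp add: leibniz xy)
    then have "q1 *s z = \<nu> *s z" unfolding mxy coeff comm[of y z] mzy d1 d2 a1 by simp
    then show ?thesis by (rule zscale)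
  qed
  have q2: "q2 = \<mu>"
  proof -
    have "br (x \<odot> y) x = - (x \<odot> z)" by (simp add: leibniz yx minus_right)
    then have "(- q2) *s z = (- \<mu>) *s z" unfolding mxy coeff comm[of x z] mzx a1 a2 by simp
    then show ?thesis by (rule zneg)
  qed
  have p1: "p1 = 2 * \<mu>"
  proof -
    have "br (x \<odot> x) y = x \<odot> z + x \<odot> z" by (simp add: leibniz xy)
    then have "p1 *s z = (2 * \<mu>) *s z"
      unfolding mxx coeff comm[of x z] mzx a1 a2 by (simp add: vec_eq_iff algebra_simps)
    then show ?thesis by (rule zscale)
  qed
  have p2: "p2 = 0"
  proof -
    have "br (x \<odot> x) x = 0" by (simp add: leibniz)
    then show ?thesis unfolding mxx coeff using z0 by simp
  qed
  have r1: "r1 = 0"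
  proof -
    have "br (y \<odot> y) y = 0" by (simp add: leibniz)
    then show ?thesis unfolding myy coeff using z0 by simp
  qed
  have r2: "r2 = 2 * \<nu>"
  proof -
    have "br (y \<odot> y) x = - (y \<odot> z) - y \<odot> z" by (simp add: leibniz yx minus_right)
    then have "(- r2) *s z = (- (2 * \<nu>)) *s z"
      unfolding myy coeff comm[of y z] mzy a1 d1 d2 by (simp add: vec_eq_iff algebra_simps)
    then show ?thesis by (rule zneg)
  qed
  have zx': "z \<odot> x = \<mu> *s z" and zy': "z \<odot> y = \<nu> *s z" and zz': "z \<odot> z = 0"
    by (simp_all add: mzx mzy mzz a1 a2 d1 d2)
  have \<mu>: "\<mu> = 0"
  proof -
    have "z \<odot> (x \<odot> x) = (\<mu> * \<mu> + \<mu> * \<mu>) *s z" by (simp add: mxx p1 p2 bilinear zx' zz'; simp add: vec_eq_iff algebra_simps)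
    moreover have "z \<odot> (x \<odot> x) = (\<mu> * \<mu>) *s z" by (simp add: assoc[symmetric] zx' bilinear)
    ultimately have "(\<mu> * \<mu> + \<mu> * \<mu>) *s z = (\<mu> * \<mu>) *s z" by simp
    then have "\<mu> * \<mu> + \<mu> * \<mu> = \<mu> * \<mu>" by (rule zscale)
    then have "2 * \<mu> * \<mu> = \<mu> * \<mu>" by (simp only: mult_2 distrib_right)
    then show ?thesis by (rule double_square_eq_square)
  qed
  have \<nu>: "\<nu> = 0"
  proof -
    have "z \<odot> (y \<odot> y) = (\<nu> * \<nu> + \<nu> * \<nu>) *s z" by (simp add: myy r1 r2 bilinear zy' zz'; simp add: vec_eq_iff algebra_simps)
    moreover have "z \<odot> (y \<odot> y) = (\<nu> * \<nu>) *s z" by (simp add: assoc[symmetric] zy' bilinear)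
    ultimately have "(\<nu> * \<nu> + \<nu> * \<nu>) *s z = (\<nu> * \<nu>) *s z" by simp
    then have "\<nu> * \<nu> + \<nu> * \<nu> = \<nu> * \<nu>" by (rule zscale)
    then have "2 * \<nu> * \<nu> = \<nu> * \<nu>" by (simp only: mult_2 distrib_right)
    then show ?thesis by (rule double_square_eq_square)
  qed
  define M :: "'f ^ 2 ^ 2" where "M = vector [vector [\<alpha>, \<beta>], vector [\<beta>, \<gamma>]]"
  have M: "M$1$1 = \<alpha>" "M$1$2 = \<beta>" "M$2$1 = \<beta>" "M$2$2 = \<gamma>" by (simp_all add: M_def)
  have "sym_mat M" by (simp add: sym_mat_def transpose_def vec2_eq_iff M)
  then show ?thesis
    by (rule lie_type.intros(1), unfold P3_16_def M, intro iso_structure_constants[OF b])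
      (simp_all add: mxx mxy myy p1 p2 q1 q2 r1 r2 \<mu> \<nu> comm[of x z] comm[of y z] zx' zy' zz' xy xz yz)
qed

text \<open>
  The derivation \<open>[x, _]\<close> has eigenvalue \<open>1\<close> on \<open>y\<close> and \<open>0\<close> on \<open>x\<close> and \<open>z\<close>, so the products of \<open>x\<close>
  and \<open>z\<close> are combinations of \<open>x\<close> and \<open>z\<close> and their products with \<open>y\<close> are multiples of \<open>y\<close>, while
  \<open>y\<^sup>2 = [x y, y] = 0\<close>.  The remaining scalars \<open>\<kappa>, \<sigma>, \<tau>, \<rho>, \<alpha>\<close> are normalised by replacing \<open>x\<close> with \<open>x - c z\<close> and
  rescaling \<open>z\<close>: for \<open>\<sigma> \<noteq> 0\<close> a multiple of \<open>z\<close> is an identity, for \<open>\<sigma> = 0 \<noteq> \<kappa>\<close> it is an idempotent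
  that annihilates \<open>y\<close>.
\<close>

lemma affine_types:
  assumes b: "basis3 x y z" and xy: "br x y = y" and xz: "br x z = 0" and yz: "br y z = 0"
  shows "lie_type poisson_m_br"
proof -
  have zy: "br z y = 0" using br_anti[of z y] yz by simp
  have y0: "y \<noteq> 0" using basis3D(2)[OF b, of 0 1 0] by auto
  have z0: "z \<noteq> 0" using basis3D(3)[OF b, of 0 0 1] by auto
  have yscale: "c = d" if "c *s y = d *s y" for c d using that y0 by simp
  have zscale: "c = d" if "c *s z = d *s z" for c d using that z0 by simp
  have coeff: "br x (p *s x + q *s y + r *s z) = q *s y" "br (p *s x + q *s y + r *s z) y = p *s y"
    for p q r by (simp_all add: br_bilinear xy xz zy)
  obtain l1 l2 \<kappa> where mzz: "z \<odot> z = l1 *s x + l2 *s y + \<kappa> *s z" by (rule basis3_span[OF b])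
  obtain s1 \<sigma> s3 where mzy: "z \<odot> y = s1 *s x + \<sigma> *s y + s3 *s z" by (rule basis3_span[OF b])
  obtain t1 t2 \<tau> where mzx: "z \<odot> x = t1 *s x + t2 *s y + \<tau> *s z" by (rule basis3_span[OF b])
  obtain r1 \<rho> r3 where mxy: "x \<odot> y = r1 *s x + \<rho> *s y + r3 *s z" by (rule basis3_span[OF b])
  obtain a1 a2 \<alpha> where mxx: "x \<odot> x = a1 *s x + a2 *s y + \<alpha> *s z" by (rule basis3_span[OF b])
  have zz: "z \<odot> z = \<kappa> *s z"
  proof -
    have "br x (z \<odot> z) = 0" by (simp add: leibniz_right xz)
    then have "l2 = 0" unfolding mzz coeff using y0 by simp
    moreover have "br (z \<odot> z) y = 0" by (simp add: leibniz zy)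
    then have "l1 = 0" unfolding mzz coeff using y0 by simp
    ultimately show ?thesis using mzz by simp
  qed
  have zy': "z \<odot> y = \<sigma> *s y"
  proof -
    have "br x (z \<odot> y) = z \<odot> y" by (simp add: leibniz_right xz xy)
    then show ?thesis by (simp only: mzy coeff)
  qed
  have zx': "z \<odot> x = \<sigma> *s x + \<tau> *s z"
  proof -
    have "br x (z \<odot> x) = 0" by (simp add: leibniz_right xz)
    then have "t2 = 0" unfolding mzx coeff using y0 by simp
    moreover have "br (z \<odot> x) y = z \<odot> y" by (simp add: leibniz zy xy)
    then have "t1 *s y = \<sigma> *s y" unfolding mzx coeff zy' .
    then have "t1 = \<sigma>" by (rule yscale)
    ultimately show ?thesis using mzx by simp
  qed
  have xy': "x \<odot> y = \<rho> *s y"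
  proof -
    have "br x (x \<odot> y) = x \<odot> y" by (simp add: leibniz_right xy)
    then show ?thesis by (simp only: mxy coeff)
  qed
  have yy: "y \<odot> y = 0"
  proof -
    have "br (x \<odot> y) y = y \<odot> y" by (simp add: leibniz xy)
    then show ?thesis by (simp add: xy' br_bilinear)
  qed
  have xx: "x \<odot> x = (2 * \<rho>) *s x + \<alpha> *s z"
  proof -
    have "br x (x \<odot> x) = 0" by (simp add: leibniz_right)
    then have "a2 = 0" unfolding mxx coeff using y0 by simp
    moreover have "br (x \<odot> x) y = x \<odot> y + x \<odot> y" by (simp add: leibniz xy)
    then have "a1 *s y = (2 * \<rho>) *s y"
      unfolding mxx coeff xy' by (simp add: vec_eq_iff algebra_simps)
    then have "a1 = 2 * \<rho>" by (rule yscale)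
    ultimately show ?thesis using mxx by simp
  qed
  have A1: "\<kappa> * \<sigma> = \<sigma> * \<sigma>"
  proof (rule yscale)
    have "(z \<odot> z) \<odot> y = z \<odot> (z \<odot> y)" by (rule assoc)
    then show "(\<kappa> * \<sigma>) *s y = (\<sigma> * \<sigma>) *s y" by (simp add: zz zy' bilinear)
  qed
  have A2: "2 * \<rho> * \<rho> + \<alpha> * \<sigma> = \<rho> * \<rho>"
  proof (rule yscale)
    have "(x \<odot> x) \<odot> y = x \<odot> (x \<odot> y)" by (rule assoc)
    then show "(2 * \<rho> * \<rho> + \<alpha> * \<sigma>) *s y = (\<rho> * \<rho>) *s y"
      by (simp add: xx xy' zy' bilinear vec_eq_iff algebra_simps)
  qed
  have A3: "\<tau> * \<sigma> = 0"
  proof -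
    have "(z \<odot> x) \<odot> y = z \<odot> (x \<odot> y)" by (rule assoc)
    then have "(\<sigma> * \<rho> + \<tau> * \<sigma>) *s y = (\<rho> * \<sigma>) *s y"
      by (simp add: zx' xy' zy' bilinear vec_eq_iff algebra_simps)
    then have "\<sigma> * \<rho> + \<tau> * \<sigma> = \<rho> * \<sigma>" by (rule yscale)
    then show ?thesis by (simp add: mult.commute)
  qed
  have bzc: "basis3 x y (c *s z)" if "c \<noteq> 0" for c
    by (rule basis3_cong[OF b, of _ 0 0 c]) (simp_all add: that)
  have bxz: "basis3 (x - d *s z) y (c *s z)" if "c \<noteq> 0" for c d
  proof -
    have "basis3 y z (x - d *s z)"
      by (rule basis3_cong[OF basis3_rot[OF b], of _ 0 "- d" 1]) (simp_all add: vec_eq_iff)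
    then have "basis3 (x - d *s z) y z" by (rule basis3_rot[OF basis3_rot])
    then show ?thesis by (rule basis3_cong[of _ _ _ _ 0 0 c]) (simp_all add: that)
  qed
  show ?thesis
  proof (cases "\<sigma> = 0")
    case False
    have \<kappa>: "\<kappa> = \<sigma>" and \<tau>: "\<tau> = 0" using A1 A3 False by simp_all
    define z' where "z' = (1 / \<sigma>) *s z"
    define x' where "x' = x - (\<rho> / \<sigma>) *s z"
    have b': "basis3 x' y z'" unfolding x'_def z'_def by (rule bxz) (simp add: False)
    have zx0: "z \<odot> x = \<sigma> *s x" by (simp add: zx' \<tau>)
    have "x' \<odot> x' = (\<alpha> + \<rho> * \<rho> / \<sigma>) *s z"
      using False
      by (simp add: x'_def bilinear xx comm[of x z] zx0 zz \<kappa>; simp add: vec_eq_iff field_simps)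
    moreover have "\<alpha> + \<rho> * \<rho> / \<sigma> = 0" using A2 False by (simp add: field_simps)
    ultimately have xx': "x' \<odot> x' = 0" by simp
    have xy0: "x' \<odot> y = 0" using False by (simp add: x'_def bilinear xy' zy')
    have xz': "x' \<odot> z' = x'"
      using False by (simp add: x'_def z'_def bilinear comm[of x z] zx0 zz \<kappa>)
    have yz': "y \<odot> z' = y" using False by (simp add: z'_def bilinear comm[of y z] zy')
    have zz': "z' \<odot> z' = z'" using False by (simp add: z'_def bilinear zz \<kappa>)
    have brs: "br x' y = y" "br x' z' = 0" "br y z' = 0"
      by (simp_all add: x'_def z'_def br_bilinear xy xz yz zy)
    show ?thesis
      by (rule lie_type.intros(5), unfold P3_20_def, rule iso_structure_constants[OF b'])
        (simp_all add: xx' xy0 xz' yy yz' zz' brs)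
  next
    case \<sigma>: True
    have \<rho>: "\<rho> = 0" by (rule double_square_eq_square) (use A2 \<sigma> in simp)
    have xx0: "x \<odot> x = \<alpha> *s z" using xx \<rho> by simp
    have xz0: "x \<odot> z = \<tau> *s z" using zx' \<sigma> by (simp add: comm[of x z])
    have xy0: "x \<odot> y = 0" using xy' \<rho> by simp
    have yz0: "y \<odot> z = 0" using zy' \<sigma> by (simp add: comm[of y z])
    have A4: "\<alpha> * \<kappa> = \<tau> * \<tau>"
    proof (rule zscale)
      have "(x \<odot> x) \<odot> z = x \<odot> (x \<odot> z)" by (rule assoc)
      then show "(\<alpha> * \<kappa>) *s z = (\<tau> * \<tau>) *s z" by (simp add: xx0 zz xz0 bilinear)
    qed
    show ?thesis
    proof (cases "\<kappa> = 0")
      case False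
      define z' where "z' = (1 / \<kappa>) *s z"
      define x' where "x' = x - (\<tau> / \<kappa>) *s z"
      have b': "basis3 x' y z'" unfolding x'_def z'_def by (rule bxz) (simp add: False)
      have "x' \<odot> x' = (\<alpha> - \<tau> * \<tau> / \<kappa>) *s z"
        using False
        by (simp add: x'_def bilinear xx0 comm[of z x] xz0 zz; simp add: vec_eq_iff field_simps)
      moreover have "\<alpha> - \<tau> * \<tau> / \<kappa> = 0" using A4 False by (simp add: field_simps)
      ultimately have xx': "x' \<odot> x' = 0" by simp
      have xy1: "x' \<odot> y = 0" by (simp add: x'_def bilinear xy0 comm[of z y] yz0)
      have xz1: "x' \<odot> z' = 0" using False by (simp add: x'_def z'_def bilinear xz0 zz)
      have yz1: "y \<odot> z' = 0" by (simp add: z'_def bilinear yz0)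
      have zz1: "z' \<odot> z' = z'" using False by (simp add: z'_def bilinear zz)
      have brs: "br x' y = y" "br x' z' = 0" "br y z' = 0"
        by (simp_all add: x'_def z'_def br_bilinear xy xz yz zy)
      show ?thesis
        by (rule lie_type.intros(4), unfold P3_19_def, rule iso_structure_constants[OF b'])
          (simp_all add: xx' xy1 xz1 yy yz1 zz1 brs)
    next
      case \<kappa>: True
      have \<tau>: "\<tau> = 0" using A4 \<kappa> by simp
      show ?thesis
      proof (cases "\<alpha> = 0")
        case True
        show ?thesis
          by (rule lie_type.intros(2), unfold P3_17_def, rule iso_structure_constants[OF b])
            (simp_all add: xx0 xy0 xz0 yy yz0 zz xy xz yz \<tau> \<kappa> True)
      next
        case False
        show ?thesis
          by (rule lie_type.intros(3), unfold P3_18_def, rule iso_structure_constants[OF bzc[OF False]])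
            (simp_all add: xx0 xy0 xz0 yy yz0 zz xy xz yz \<tau> \<kappa> bilinear br_bilinear)
      qed
    qed
  qed
qed

end

lemma table_P3_21:
  "\<lparr>psmul = (*s), pmul = comm3 0 0 0 0 0 0,
     brk = alt3 (A$1$1 *s b2 + A$2$1 *s b3) (A$1$2 *s b2 + A$2$2 *s b3) 0\<rparr> \<cong>\<^sub>P P3_21 A"
proof (rule poisson_isoI)
  let ?f = "\<lambda>a :: 'a ^ 3. (a$1, vector [a$2, a$3] :: 'a ^ 2)"
  show "bij ?f"
  proof (rule bijI')
    show "(?f x = ?f y) = (x = y)" for x y by (auto simp: vec2_eq_iff vec3_eq_iff)
    show "\<exists>x. y = ?f x" for y
      by (rule exI[of _ "vector [fst y, snd y $ 1, snd y $ 2]"])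
        (simp add: prod_eq_iff vec2_eq_iff)
  qed
qed (simp_all add: P3_21_def zero_assoc_def vec.vector_space_axioms vector_space_prod
    vector_space_field vec2_eq_iff comm3_nth alt3_def zero_prod_def matrix_vector_mult_def sum_2
    algebra_simps)

context poisson3
begin

lemma zero_product_plane:
  assumes b: "basis3 x u v" and xu: "br x u = a *s u + b *s v" and xv: "br x v = c *s u + d *s v"
    and uv: "br u v = 0" and det: "a * d - b * c \<noteq> 0" and zero: "\<And>p q. p \<odot> q = 0"
  shows "lie_type poisson_m_br"
proof -
  define A :: "'f ^ 2 ^ 2" where "A = vector [vector [a, c], vector [b, d]]"
  have A: "A$1$1 = a" "A$1$2 = c" "A$2$1 = b" "A$2$2 = d" by (simp_all add: A_def)
  have "invertible A" using det by (simp add: invertible_det_nz det_2 A algebra_simps)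
  then show ?thesis
    by (rule lie_type.intros(6))
      (rule poisson_iso_trans[OF _ table_P3_21], rule iso_structure_constants[OF b],
        simp_all add: zero xu xv uv A)
qed

text \<open>
  Multiplication by \<open>x\<close> maps \<open>u\<close> to \<open>w\<close> and \<open>w\<close> to \<open>0\<close>, and it commutes with \<open>[x, _]\<close>.  Hence
  \<open>[x, _]\<close> is \<open>p + q N\<close> on the plane, where \<open>N\<close> is the multiplication by \<open>x\<close>, and dividing \<open>x\<close> by
  \<open>p\<close> gives the normal form.
\<close>

lemma nilpotent_product_plane:
  assumes char2: "(2 :: 'f) = 0"
    and b: "basis3 x u v" and Xu: "br x u = a *s u + b *s v" and Xv: "br x v = c *s u + d *s v"
    and uv: "br u v = 0" and det: "a * d - b * c \<noteq> 0"
    and V: "u \<odot> u = 0" "u \<odot> v = 0" "v \<odot> v = 0" and xx: "x \<odot> x = 0"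
    and xu: "x \<odot> u = f *s u + g *s v" and nz: "x \<odot> u \<noteq> 0"
  shows "lie_type poisson_m_br"
proof -
  define w where "w = x \<odot> u"
  have w0: "w \<noteq> 0" using nz by (simp add: w_def)
  have xw: "x \<odot> w = 0" by (simp add: w_def assoc[symmetric] xx)
  have g: "g \<noteq> 0"
  proof
    assume g: "g = 0"
    have "x \<odot> w = f *s w" by (simp add: w_def) (simp add: xu g bilinear)
    then have "f = 0" using xw w0 by simp
    then show False using nz by (simp add: xu g)
  qed
  have w: "w = f *s u + g *s v" by (simp add: w_def xu)
  have "w = 0 *s x + f *s u + g *s v" by (simp add: w)
  then have bw: "basis3 x u w" by (rule basis3_cong[OF b _ g])
  have uw: "br u w = 0" by (simp add: w br_bilinear uv)
  have wu: "u \<odot> w = 0" and ww: "w \<odot> w = 0" by (simp_all add: w bilinear V comm[of v u])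
  define p where "p = a - b * f / g"
  define q where "q = b / g"
  have Xu': "br x u = p *s u + q *s w"
    using g by (simp add: Xu p_def q_def w; simp add: vec_eq_iff field_simps)
  have Xw: "br x w = p *s w"
  proof -
    have "br x (x \<odot> u) = x \<odot> br x u" by (simp add: leibniz_right)
    then show ?thesis unfolding Xu' by (simp add: bilinear xw w_def[symmetric])
  qed
  have p: "p \<noteq> 0"
  proof
    assume "p = 0"
    then have "br x w = 0" using Xw by simp
    moreover have "br x w = (f * a + g * c) *s u + (f * b + g * d) *s v"
      by (simp add: w br_bilinear Xu Xv; simp add: vec_eq_iff algebra_simps)
    ultimately have eq: "0 *s x + (f * a + g * c) *s u + (f * b + g * d) *s v = 0" by simp
    have 1: "f * a + g * c = 0" and 2: "f * b + g * d = 0" by (rule basis3D[OF b eq])+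
    have "(a * d - b * c) * g = a * (f * b + g * d) - b * (f * a + g * c)"
      by (simp add: algebra_simps)
    then have "(a * d - b * c) * g = 0" unfolding 1 2 by simp
    then show False using det g by simp
  qed
  define X where "X = (1 / p) *s x"
  define W where "W = (1 / p) *s w"
  have "basis3 u w X"
    by (rule basis3_cong[OF basis3_rot[OF bw], of _ 0 0 "1 / p"]) (simp_all add: X_def p)
  then have "basis3 u X w" by (rule basis3_swap23)
  then have "basis3 u X W"
    by (rule basis3_cong[of _ _ _ _ 0 0 "1 / p"]) (simp_all add: W_def p)
  then have bas: "basis3 X W u" by (rule basis3_rot)
  have prods: "X \<odot> X = 0" "X \<odot> W = 0" "X \<odot> u = W" "W \<odot> W = 0" "W \<odot> u = 0"
    by (simp_all add: X_def W_def bilinear xx xw w_def[symmetric] ww comm[of w u] wu)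
  have brs: "br X W = W" "br X u = u + q *s W" "br W u = 0"
    using p by (simp_all add: X_def W_def br_bilinear Xw Xu' br_anti[of w u] uw)
  \<comment> \<open>an odd number is \<open>1\<close> in \<open>'f\<close>, so only even numbers vanish\<close>
  have "CHAR('f) = 2"
  proof (rule CHAR_eqI)
    show "of_nat 2 = (0 :: 'f)" using char2 by simp
    fix n :: nat assume n: "of_nat n = (0 :: 'f)"
    show "2 dvd n"
    proof (rule ccontr)
      assume "\<not> 2 dvd n"
      then obtain k where "n = 2 * k + 1" by (rule oddE)
      then have "(1 :: 'f) = 0" using n char2 by simp
      then show False by simp
    qed
  qed
  then show ?thesis
    by (rule lie_type.intros(7)[where q = q]) (unfold P3_22_def, rule iso_structure_constants[OF bas],
        simp_all add: prods brs V)
qed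

text \<open>
  The identity \<open>[x u, w] = u [x, w]\<close> on the plane shows that \<open>u\<close> multiplies the plane by a scalar, as does \<open>v\<close>;
  comparing the two on \<open>u v\<close> makes both scalars \<open>0\<close>.  Then \<open>x\<^sup>2 = s x\<close> and \<open>2 x w = s w\<close> on the plane,
  so \<open>s = 0\<close> by associativity, and the product vanishes unless \<open>2 = 0\<close>.
\<close>

lemma plane_types:
  assumes b: "basis3 x u v" and Xu: "br x u = a *s u + b *s v" and Xv: "br x v = c *s u + d *s v"
    and uv: "br u v = 0" and det: "a * d - b * c \<noteq> 0"
  shows "lie_type poisson_m_br"
proof -
  have vu: "br v u = 0" using br_anti[of v u] uv by simp
  \<comment> \<open>a linear relation on the image of \<open>ad x\<close> holds on the whole plane\<close>
  have solve: "p = 0 \<and> q = 0"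
    if 1: "a *s p + b *s q = 0" and 2: "c *s p + d *s q = 0" for p q :: "'f ^ 3"
  proof -
    have "(a * d - b * c) *s p = d *s (a *s p + b *s q) - b *s (c *s p + d *s q)"
      by (simp add: vec_eq_iff algebra_simps)
    moreover have "(a * d - b * c) *s q = a *s (c *s p + d *s q) - c *s (a *s p + b *s q)"
      by (simp add: vec_eq_iff algebra_simps)
    ultimately show ?thesis unfolding 1 2 using det by simp
  qed
  have nonzero: "u \<noteq> 0" "v \<noteq> 0"
    using basis3D(2)[OF b, of 0 1 0] basis3D(3)[OF b, of 0 0 1] by auto
  obtain e f g where xu: "x \<odot> u = e *s x + f *s u + g *s v" by (rule basis3_span[OF b])
  obtain e' h k where xv: "x \<odot> v = e' *s x + h *s u + k *s v" by (rule basis3_span[OF b])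
  have U: "u \<odot> u = e *s u \<and> u \<odot> v = e *s v"
  proof -
    have lu: "br (x \<odot> u) u = u \<odot> br x u" and lv: "br (x \<odot> u) v = u \<odot> br x v"
      by (simp_all add: leibniz uv)
    have "a *s (u \<odot> u - e *s u) + b *s (u \<odot> v - e *s v) = 0"
      using lu unfolding xu by (simp add: br_bilinear Xu bilinear vu; simp add: vec_eq_iff algebra_simps)
    moreover have "c *s (u \<odot> u - e *s u) + d *s (u \<odot> v - e *s v) = 0"
      using lv unfolding xu by (simp add: br_bilinear Xv bilinear uv; simp add: vec_eq_iff algebra_simps)
    ultimately show ?thesis using solve[of "u \<odot> u - e *s u" "u \<odot> v - e *s v"] by simp
  qed
  have W: "v \<odot> u = e' *s u \<and> v \<odot> v = e' *s v"
  proof -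
    have lu: "br (x \<odot> v) u = v \<odot> br x u" and lv: "br (x \<odot> v) v = v \<odot> br x v"
      by (simp_all add: leibniz vu)
    have "a *s (v \<odot> u - e' *s u) + b *s (v \<odot> v - e' *s v) = 0"
      using lu unfolding xv by (simp add: br_bilinear Xu bilinear vu; simp add: vec_eq_iff algebra_simps)
    moreover have "c *s (v \<odot> u - e' *s u) + d *s (v \<odot> v - e' *s v) = 0"
      using lv unfolding xv by (simp add: br_bilinear Xv bilinear uv; simp add: vec_eq_iff algebra_simps)
    ultimately show ?thesis using solve[of "v \<odot> u - e' *s u" "v \<odot> v - e' *s v"] by simp
  qed
  have "0 *s x + (- e') *s u + e *s v = 0"
    using U W comm[of u v] by simp
  then have e: "e = 0" "e' = 0" using basis3D(2,3)[OF b] by fastforce+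
  have V: "u \<odot> u = 0" "u \<odot> v = 0" "v \<odot> v = 0" using U W e by simp_all
  have xu': "x \<odot> u = f *s u + g *s v" and xv': "x \<odot> v = h *s u + k *s v"
    using xu xv e by simp_all
  obtain s s1 s2 where xx: "x \<odot> x = s *s x + s1 *s u + s2 *s v" by (rule basis3_span[OF b])
  have s12: "s1 = 0" "s2 = 0"
  proof -
    have "br x (x \<odot> x) = 0" by (simp add: leibniz_right)
    then have eq: "0 *s x + (s1 * a + s2 * c) *s u + (s1 * b + s2 * d) *s v = 0"
      unfolding xx by (simp add: br_bilinear Xu Xv; simp add: vec_eq_iff algebra_simps)
    have 1: "s1 * a + s2 * c = 0" and 2: "s1 * b + s2 * d = 0" by (rule basis3D[OF b eq])+
    have "(a * d - b * c) * s1 = d * (s1 * a + s2 * c) - c * (s1 * b + s2 * d)"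
      "(a * d - b * c) * s2 = a * (s1 * b + s2 * d) - b * (s1 * a + s2 * c)"
      by (simp_all add: algebra_simps)
    then show "s1 = 0" "s2 = 0" unfolding 1 2 using det by simp_all
  qed
  have xx': "x \<odot> x = s *s x" using xx s12 by simp
  have twice: "s *s u = 2 *s (x \<odot> u) \<and> s *s v = 2 *s (x \<odot> v)"
  proof -
    have lu: "br (x \<odot> x) u = x \<odot> br x u + x \<odot> br x u" and lv: "br (x \<odot> x) v = x \<odot> br x v + x \<odot> br x v"
      by (rule leibniz)+
    have "a *s (s *s u - 2 *s (x \<odot> u)) + b *s (s *s v - 2 *s (x \<odot> v)) = 0"
      using lu unfolding xx' by (simp add: br_bilinear Xu bilinear; simp add: vec_eq_iff algebra_simps)
    moreover have "c *s (s *s u - 2 *s (x \<odot> u)) + d *s (s *s v - 2 *s (x \<odot> v)) = 0"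
      using lv unfolding xx' by (simp add: br_bilinear Xv bilinear; simp add: vec_eq_iff algebra_simps)
    ultimately show ?thesis using solve[of "s *s u - 2 *s (x \<odot> u)" "s *s v - 2 *s (x \<odot> v)"] by simp
  qed
  have square: "x \<odot> (x \<odot> w) = s *s (x \<odot> w)" for w
    by (simp add: assoc[symmetric] xx' bilinear)
  have s0: "s = 0"
  proof -
    have su: "s *s u = 2 *s (x \<odot> u)" using twice ..
    have "s *s (s *s u) = s *s (2 *s (x \<odot> u))" by (simp only: su)
    also have "\<dots> = 2 *s (x \<odot> (s *s u))" by (simp add: bilinear mult.commute)
    also have "\<dots> = 2 *s (x \<odot> (2 *s (x \<odot> u)))" by (simp only: su)
    also have "\<dots> = 2 *s (s *s (2 *s (x \<odot> u)))" by (simp add: bilinear square mult.commute mult.left_commute)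
    also have "\<dots> = 2 *s (s *s (s *s u))" by (simp only: su)
    finally have "s * s = 2 * s * s" using nonzero by (simp add: mult.assoc)
    from double_square_eq_square[OF this[symmetric]] show ?thesis .
  qed
  show ?thesis
  proof (cases "x \<odot> u = 0 \<and> x \<odot> v = 0")
    case True
    have "p \<odot> q = 0" for p q
    proof -
      obtain p1 p2 p3 where p: "p = p1 *s x + p2 *s u + p3 *s v" by (rule basis3_span[OF b])
      obtain q1 q2 q3 where q: "q = q1 *s x + q2 *s u + q3 *s v" by (rule basis3_span[OF b])
      show ?thesis
        by (simp add: p q bilinear V True xx' s0 comm[of u x] comm[of v x] comm[of v u])
    qed
    then show ?thesis by (rule zero_product_plane[OF b Xu Xv uv det])
  next
    case False
    have char2: "(2 :: 'f) = 0"
    proof (rule ccontr)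
      assume "(2 :: 'f) \<noteq> 0"
      then show False using twice False s0 by simp
    qed
    show ?thesis
    proof (cases "x \<odot> u = 0")
      case False
      show ?thesis
        by (rule nilpotent_product_plane[OF char2 b Xu Xv uv det V _ xu' False]) (simp add: xx' s0)
    next
      case True
      have b': "basis3 x v u" by (rule basis3_swap23[OF b])
      have Xv': "br x v = d *s v + c *s u" and Xu': "br x u = b *s v + a *s u"
        and xv'': "x \<odot> v = k *s v + h *s u"
        using Xu Xv xv' by (simp_all add: add.commute)
      have det': "d * a - c * b \<noteq> 0" using det by (simp add: mult.commute)
      show ?thesis
        by (rule nilpotent_product_plane[OF char2 b' Xv' Xu' vu det' V(3) _ V(1) _ xv''])
          (use False True in \<open>simp_all add: xx' s0 V comm[of v u]\<close>)
    qed
  qed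
qed

text \<open>
  A proper non-zero ideal would have a quotient of dimension at most two, whose derived algebra is
  proper, so the algebra is simple.  The span of all products is an ideal.
\<close>

lemma perfect_types:
  assumes perfect: "\<And>S. vec.subspace S \<Longrightarrow> (\<And>x y. br x y \<in> S) \<Longrightarrow> S = UNIV"
  shows "lie_type poisson_m_br"
proof -
  have ideals: "I = {0} \<or> I = UNIV"
    if I: "vec.subspace I" and ideal: "\<And>x y. y \<in> I \<Longrightarrow> br x y \<in> I" for I
  proof (rule disjCI)
    have ideal': "br y x \<in> I" if "y \<in> I" for x y
      using vec.subspace_neg[OF I ideal[OF that, of x]] br_anti[of y x] by simp
    assume "I \<noteq> UNIV"
    show "I = {0}"
    proof (rule ccontr)
      assume "I \<noteq> {0}"
      then obtain i where i: "i \<in> I" "i \<noteq> 0" using vec.subspace_0[OF I] by auto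
      obtain j k where b: "basis3 i j k" by (rule extend_basis3_1[OF i(2)])
      \<comment> \<open>modulo \<open>I\<close> every bracket is a multiple of \<open>br j k\<close>\<close>
      have mem: "br x y \<in> {v + c *s br j k |v c. v \<in> I}" for x y
      proof -
        obtain p1 p2 p3 where p: "x = p1 *s i + p2 *s j + p3 *s k" by (rule basis3_span[OF b])
        obtain q1 q2 q3 where q: "y = q1 *s i + q2 *s j + q3 *s k" by (rule basis3_span[OF b])
        have "(p1 * q2 - p2 * q1) *s br i j + (p1 * q3 - p3 * q1) *s br i k \<in> I"
          by (intro vec.subspace_add[OF I] vec.subspace_scale[OF I] ideal' i(1))
        then show ?thesis unfolding p q br_expand by blast
      qed
      show False
      proof (cases "\<exists>l\<in>I. \<forall>c. l \<noteq> c *s i")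
        case True
        then obtain l where l: "l \<in> I" "\<And>c. l \<noteq> c *s i" by auto
        have indep: "p = 0 \<and> q = 0" if dep: "p *s i + q *s l = 0" for p q
        proof -
          have "0 *s i + p *s i + q *s l = 0" using dep by simp
          from solve_last[OF this] l(2)[of "- p / q"] have "q = 0" by auto
          then show ?thesis using dep i(2) by simp
        qed
        obtain n where bn: "basis3 i l n" by (rule extend_basis3[OF indep])
        have "br x y \<in> I" for x y
          by (rule br_in_subspace[OF bn I]) (intro ideal' i l)+
        with perfect[OF I] \<open>I \<noteq> UNIV\<close> show False by blast
      next
        case False
        have "br x y \<in> vec.span {i, br j k}" for x y
        proof -
          obtain v c where v: "v \<in> I" and eq: "br x y = v + c *s br j k" using mem[of x y] by blast
          obtain t where "v = t *s i" using False v by blast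
          then show ?thesis unfolding span2_eq using eq by blast
        qed
        then have "vec.span {i, br j k} = UNIV" by (rule perfect[OF vec.subspace_span])
        then show False using span2_proper by blast
      qed
    qed
  qed
  have nil: "a \<odot> (a \<odot> (a \<odot> a)) = 0" for a
  proof (rule ccontr)
    assume "a \<odot> (a \<odot> (a \<odot> a)) \<noteq> 0"
    then obtain c where "(a \<odot> c) \<odot> (a \<odot> c) = a \<odot> c" "a \<odot> c \<noteq> 0"
      by (rule nilpotent_or_idempotent)
    then obtain e where ee: "e \<odot> e = e" and e0: "e \<noteq> 0" by blast
    have central: "br e v = 0" for v
    proof -
      have d: "br e v = e \<odot> br e v + e \<odot> br e v" using leibniz[of e e v] by (simp only: ee)
      have "e \<odot> br e v = e \<odot> (e \<odot> br e v + e \<odot> br e v)" using arg_cong[OF d, of "m e"] .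
      also have "\<dots> = e \<odot> br e v + e \<odot> br e v" by (simp only: add_right assoc[symmetric] ee)
      finally have "e \<odot> br e v = 0" by simp
      then show ?thesis using d by simp
    qed
    have "br x y \<in> vec.span {e, e}" if y: "y \<in> vec.span {e, e}" for x y
    proof -
      obtain p q where "y = p *s e + q *s e" using y unfolding span2_eq by blast
      then have "br x y = 0" by (simp add: br_bilinear br_anti[of x e] central)
      then show ?thesis by (simp add: vec.span_zero)
    qed
    then have "vec.span {e, e} = {0} \<or> vec.span {e, e} = UNIV"
      by (rule ideals[OF vec.subspace_span])
    moreover have "e \<in> vec.span {e, e}" by (simp add: vec.span_base)
    ultimately show False using e0 span2_proper by blast
  qed
  define S where "S = vec.span {p \<odot> q |p q. True}"
  have prod_S: "p \<odot> q \<in> S" for p q unfolding S_def by (rule vec.span_base) blast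
  have subS: "vec.subspace S" unfolding S_def by (rule vec.subspace_span)
  have "br x y \<in> S" if y: "y \<in> S" for x y
    using y unfolding S_def
  proof (induction rule: vec.span_induct)
    show "vec.subspace {y. br x y \<in> vec.span {p \<odot> q |p q. True}}"
      by (rule vec.subspaceI)
        (simp_all add: br_bilinear vec.span_zero vec.span_add vec.span_scale)
    fix y assume "y \<in> {p \<odot> q |p q. True}"
    then obtain p q where "y = p \<odot> q" by blast
    then show "br x y \<in> vec.span {p \<odot> q |p q. True}"
      using vec.subspace_add[OF subS prod_S prod_S] unfolding S_def by (simp add: leibniz_right)
  qed
  then have S: "S = {0} \<or> S = UNIV" by (rule ideals[OF subS])
  have zero: "p \<odot> q = 0" for p q
  proof (rule ccontr)
    assume "p \<odot> q \<noteq> 0"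
    then have UNIV: "S = UNIV" using S prod_S[of p q] by auto
    have "\<exists>x y z. basis3 x y z \<and> (\<forall>v\<in>{x, y, z}. \<forall>w\<in>{x, y, z}. v \<odot> w \<in> vec.span {y, z})"
      using nil
    proof (cases rule: nil_classification)
      case zero
      then show ?thesis using \<open>p \<odot> q \<noteq> 0\<close> by blast
    next
      case (chain x y z)
      have "\<forall>v\<in>{x, y, z}. \<forall>w\<in>{x, y, z}. v \<odot> w \<in> vec.span {y, z}"
        by (simp add: chain comm[of y x] comm[of z x] comm[of z y] vec.span_zero vec.span_base)
      then show ?thesis using chain(1) by blast
    next
      case (rank1 x y z)
      have "\<forall>v\<in>{x, y, z}. \<forall>w\<in>{x, y, z}. v \<odot> w \<in> vec.span {y, z}"
        by (simp add: rank1 comm[of y x] comm[of z x] comm[of z y] vec.span_zero vec.span_base)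
      then show ?thesis using rank1(1) by blast
    next
      case (rank2 x y z)
      have "\<forall>v\<in>{x, y, z}. \<forall>w\<in>{x, y, z}. v \<odot> w \<in> vec.span {y, z}"
        by (simp add: rank2 comm[of y x] comm[of z x] comm[of z y] vec.span_zero vec.span_base
            vec.span_scale)
      then show ?thesis using rank2(1) by blast
    qed
    then obtain x y z where b: "basis3 x y z"
      and mem: "\<And>v w. v \<in> {x, y, z} \<Longrightarrow> w \<in> {x, y, z} \<Longrightarrow> v \<odot> w \<in> vec.span {y, z}" by blast
    have "v \<odot> w \<in> vec.span {y, z}" for v w
    proof -
      obtain a b' c where v: "v = a *s x + b' *s y + c *s z" by (rule basis3_span[OF b])
      obtain d e f where w: "w = d *s x + e *s y + f *s z" by (rule basis3_span[OF b])
      show ?thesis unfolding v w bilinear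
        by (intro vec.span_add vec.span_scale mem) simp_all
    qed
    then have "S \<subseteq> vec.span {y, z}" unfolding S_def
      by (intro vec.span_minimal vec.subspace_span) auto
    then show False using UNIV span2_proper[of y z] by auto
  qed
  define L :: "('f, 'f ^ 3) alg" where "L = \<lparr>smul = (*s), mul = br\<rparr>"
  have "lie_algebra L"
    by (simp add: L_def lie_algebra_def algebra_over_field_def Vector_Spaces.linear_iff
        vec.vector_space_axioms br_add_left br_add_right br_scale_left br_scale_right jacobi)
  moreover have "\<exists>x y. br x y \<noteq> 0"
  proof (rule ccontr)
    assume "\<nexists>x y. br x y \<noteq> 0"
    then have "br x y \<in> vec.span {0, 0}" for x y by (simp add: vec.span_zero)
    then have "vec.span {0, 0 :: 'f ^ 3} = UNIV" by (rule perfect[OF vec.subspace_span])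
    then show False using span2_proper by blast
  qed
  ultimately have "simple_lie_algebra L"
    unfolding simple_lie_algebra_def using ideals by (simp add: L_def)
  then have "simple_lie_algebra3 L"
    by (simp only: simple_lie_algebra3_def alg_dim_def L_def alg.simps dim3)
  moreover have "poisson_m_br \<cong>\<^sub>P P3_23 L"
    by (rule poisson_isoI[where f = "\<lambda>x. x"])
      (simp_all add: L_def P3_23_def zero_assoc_def vec.vector_space_axioms zero bij_id[unfolded id_def])
  ultimately show ?thesis by (rule lie_type.intros(8))
qed

theorem lie_type_classification:
  assumes "br p q \<noteq> 0"
  shows "lie_type poisson_m_br"
proof (cases rule: lie_classification)
  case zero
  then show ?thesis using assms by blast
next
  case (heisenberg x y z)
  then show ?thesis by (rule heisenberg_types)
next
  case (affine x y z)
  then show ?thesis by (rule affine_types)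
next
  case (plane x u v a b c d)
  then show ?thesis by (rule plane_types)
next
  case perfect
  then show ?thesis by (rule perfect_types)
qed

theorem classification: "zero_lie_type poisson_m_br \<or> lie_type poisson_m_br"
proof (cases "\<exists>p q. br p q \<noteq> 0")
  case True
  then show ?thesis using lie_type_classification by auto
next
  case False
  then have "br = (\<lambda>_ _. 0)" by (simp add: fun_eq_iff)
  then show ?thesis using zero_lie_classification by simp
qed

end

lemma poisson_classification:
  fixes P :: "('f::field, 'v::ab_group_add) poisson"
  assumes "poisson_algebra P" "poisson_dim P = 3"
  shows "zero_lie_type P \<or> lie_type P"
proof -
  obtain m br :: "'f ^ 3 \<Rightarrow> 'f ^ 3 \<Rightarrow> 'f ^ 3"
    where "poisson3 m br" and iso: "P \<cong>\<^sub>P \<lparr>psmul = (*s), pmul = m, brk = br\<rparr>"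
    by (rule iso_coordinate_space[OF assms])
  interpret poisson3 m br by fact
  note trans = poisson_iso_trans[OF iso]
  show ?thesis
  proof (rule disjE[OF classification])
    assume "zero_lie_type poisson_m_br"
    then have "zero_lie_type P"
      by cases (blast intro: zero_lie_type.intros trans)+
    then show ?thesis ..
  next
    assume "lie_type poisson_m_br"
    then have "lie_type P"
      by cases (blast intro: lie_type.intros trans)+
    then show ?thesis ..
  qed
qed

section \<open>Parameters of the families\<close>

lemma mat_scale_nth: "mat_scale c A $ i $ j = c * A $ i $ j"
  by (simp add: mat_scale_def map_matrix_def)

lemma mat_scale_mult: "mat_scale c (A ** B) = mat_scale c A ** B" "mat_scale c (A ** B) = A ** mat_scale c B"
  by (simp_all add: vec2_eq_iff mat_scale_nth matrix_matrix_mult_def sum_2 algebra_simps)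

text \<open>
  The common form of \<open>P3_4 M\<close> (with \<open>k = 0\<close>) and \<open>P3_16 M\<close> (with \<open>k = 1\<close>).
\<close>

definition form_poisson :: "'f::field \<Rightarrow> 'f ^ 2 ^ 2 \<Rightarrow> ('f, 'f ^ 3) poisson" where
  "form_poisson k M = \<lparr>psmul = (*s),
     pmul = comm3 (M$1$1 *s b3) (M$1$2 *s b3) 0 (M$2$2 *s b3) 0 0, brk = alt3 (k *s b3) 0 0\<rparr>"

lemma P3_4_form: "P3_4 M = form_poisson 0 M"
  by (simp add: P3_4_def form_poisson_def zero_lie_def comm_alg3_def alt3_zero)

lemma P3_16_form: "P3_16 M = form_poisson 1 M"
  by (simp add: P3_16_def form_poisson_def)

lemma form_poisson_mul:
  "pmul (form_poisson k M) v w =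
     (M$1$1 * v$1 * w$1 + M$1$2 * (v$1 * w$2 + v$2 * w$1) + M$2$2 * v$2 * w$2) *s b3"
  by (simp add: form_poisson_def vec3_eq_iff comm3_nth algebra_simps)

lemma form_poisson_brk: "brk (form_poisson k M) v w = (k * (v$1 * w$2 - v$2 * w$1)) *s b3"
  by (simp add: form_poisson_def alt3_def algebra_simps)

lemma form_poisson_smul: "psmul (form_poisson k M) = (*s)"
  by (simp add: form_poisson_def)

lemma form_poisson_isoE:
  assumes "form_poisson k M \<cong>\<^sub>P form_poisson k M'"
  obtains f where "\<And>x y. f (x + y) = f x + f y" "\<And>c x. f (c *s x) = c *s f x" "bij f"
    "\<And>x y. f (pmul (form_poisson k M) x y) = pmul (form_poisson k M') (f x) (f y)"
    "\<And>x y. f (brk (form_poisson k M) x y) = brk (form_poisson k M') (f x) (f y)"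
proof (rule poisson_isoE[OF assms])
  fix f
  assume f: "\<And>x y. f (x + y) = f x + f y"
    "\<And>c x. f (psmul (form_poisson k M) c x) = psmul (form_poisson k M') c (f x)" "bij f"
    "\<And>x y. f (pmul (form_poisson k M) x y) = pmul (form_poisson k M') (f x) (f y)"
    "\<And>x y. f (brk (form_poisson k M) x y) = brk (form_poisson k M') (f x) (f y)"
  show thesis by (rule that[of f, OF f(1) f(2)[unfolded form_poisson_smul] f(3-5)])
qed

lemma matrix_inv_unit:
  assumes "invertible (A :: 'f::field ^ 'n ^ 'n)"
  shows "A ** matrix_inv A = mat 1" "matrix_inv A ** A = mat 1"
  using someI_ex[OF assms[unfolded invertible_def]] unfolding matrix_inv_def by blast+

lemma sym_mat_entry:
  assumes "sym_mat M"
  shows "M$2$1 = M$1$2"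
proof -
  have "transpose M $ 2 $ 1 = M$1$2" by (simp add: transpose_def)
  then show ?thesis using assms by (simp only: sym_mat_def)
qed

lemma congruence_solve:
  fixes G M M' :: "'f::field ^ 2 ^ 2"
  assumes G: "invertible G" and eq: "mat_scale \<mu> M = transpose G ** M' ** G"
  defines "C \<equiv> matrix_inv G"
  shows "invertible C" "M' = mat_scale \<mu> (transpose C ** M ** C)" "det C * det G = 1"
proof -
  have GC: "G ** C = mat 1" and CG: "C ** G = mat 1"
    unfolding C_def using G by (simp_all add: matrix_inv_unit)
  show "invertible C" unfolding invertible_def using GC CG by blast
  show "det C * det G = 1" by (metis CG det_mul det_I)
  have "mat_scale \<mu> (transpose C ** M ** C) = transpose C ** mat_scale \<mu> M ** C"
    by (simp only: mat_scale_mult(1)[of \<mu> _ C] mat_scale_mult(2)[of \<mu> _ M])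
  also have "\<dots> = transpose (G ** C) ** M' ** (G ** C)"
    unfolding eq matrix_transpose_mul by (simp only: matrix_mul_assoc)
  finally show "M' = mat_scale \<mu> (transpose C ** M ** C)"
    by (simp add: GC transpose_mat)
qed

text \<open>
  The first two coordinates of \<open>f b1\<close> and \<open>f b2\<close> form the matrix \<open>G\<close> that \<open>f\<close> induces on the quotient
  by the line of \<open>b3\<close>.  Comparing products gives \<open>\<mu> M = G\<^sup>T M' G\<close>, comparing brackets gives
  \<open>\<mu> k = k det G\<close>, and \<open>C\<close> is the inverse of \<open>G\<close>.
\<close>

lemma form_poisson_isoD:
  fixes M M' :: "'f::field ^ 2 ^ 2"
  assumes sym: "sym_mat M" "sym_mat M'"
    and f: "\<And>x y. f (x + y) = f x + f y" "\<And>c x. f (c *s x) = c *s f x" "bij f"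
    and mult: "\<And>x y. f (pmul (form_poisson k M) x y) = pmul (form_poisson k M') (f x) (f y)"
    and brk: "\<And>x y. f (brk (form_poisson k M) x y) = brk (form_poisson k M') (f x) (f y)"
    and z: "f b3 = \<mu> *s b3"
  obtains C where "invertible C" "M' = mat_scale \<mu> (transpose C ** M ** C)" "\<mu> \<noteq> 0"
    "\<mu> * det C * k = k"
proof -
  have inj: "x = y" if "f x = f y" for x y using f(3) that by (simp add: bij_is_inj inj_eq)
  have f0: "f 0 = 0" using f(2)[of 0 0] by simp
  have \<mu>: "\<mu> \<noteq> 0"
  proof
    assume "\<mu> = 0"
    then have "f b3 = f 0" using z f0 by simp
    then have "b3 = (0 :: 'f ^ 3)" by (rule inj)
    then show False by simp
  qed
  define G :: "'f ^ 2 ^ 2" where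
    "G = vector [vector [f b1 $ 1, f b2 $ 1], vector [f b1 $ 2, f b2 $ 2]]"
  have G: "G$1$1 = f b1 $ 1" "G$1$2 = f b2 $ 1" "G$2$1 = f b1 $ 2" "G$2$2 = f b2 $ 2"
    by (simp_all add: G_def)
  have "x = 0" if x: "G *v x = 0" for x
  proof -
    have fx: "f (x$1 *s b1 + x$2 *s b2) = x$1 *s f b1 + x$2 *s f b2" by (simp add: f)
    define r where "r = (x$1 * f b1 $ 3 + x$2 * f b2 $ 3) / \<mu>"
    have r: "r * \<mu> = x$1 * f b1 $ 3 + x$2 * f b2 $ 3"
      and r': "\<mu> * r = x$1 * f b1 $ 3 + x$2 * f b2 $ 3" using \<mu> by (simp_all add: r_def)
    have "f (x$1 *s b1 + x$2 *s b2) = f (r *s b3)"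
      unfolding fx f(2) z using x
      by (simp add: vec3_eq_iff vec2_eq_iff matrix_vector_mult_def sum_2 G r r' mult.commute)
    then have "x$1 *s b1 + x$2 *s b2 = r *s b3" by (rule inj)
    then show "x = 0" by (simp add: vec3_eq_iff vec2_eq_iff)
  qed
  then have inv: "invertible G"
    by (simp add: invertible_left_inverse matrix_left_invertible_ker)
  have eq: "mat_scale \<mu> M = transpose G ** M' ** G"
  proof -
    have "pmul (form_poisson k M) b1 b1 = M$1$1 *s b3" "pmul (form_poisson k M) b1 b2 = M$1$2 *s b3"
      "pmul (form_poisson k M) b2 b2 = M$2$2 *s b3" by (simp_all add: form_poisson_mul)
    then have "(M$1$1 * \<mu>) *s b3 = pmul (form_poisson k M') (f b1) (f b1)"
      "(M$1$2 * \<mu>) *s b3 = pmul (form_poisson k M') (f b1) (f b2)"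
      "(M$2$2 * \<mu>) *s b3 = pmul (form_poisson k M') (f b2) (f b2)"
      using mult[of b1 b1] mult[of b1 b2] mult[of b2 b2] by (simp_all add: f z)
    then have "M$1$1 * \<mu> = M'$1$1 * f b1 $ 1 * f b1 $ 1
          + M'$1$2 * (f b1 $ 1 * f b1 $ 2 + f b1 $ 2 * f b1 $ 1) + M'$2$2 * f b1 $ 2 * f b1 $ 2"
      "M$1$2 * \<mu> = M'$1$1 * f b1 $ 1 * f b2 $ 1
          + M'$1$2 * (f b1 $ 1 * f b2 $ 2 + f b1 $ 2 * f b2 $ 1) + M'$2$2 * f b1 $ 2 * f b2 $ 2"
      "M$2$2 * \<mu> = M'$1$1 * f b2 $ 1 * f b2 $ 1
          + M'$1$2 * (f b2 $ 1 * f b2 $ 2 + f b2 $ 2 * f b2 $ 1) + M'$2$2 * f b2 $ 2 * f b2 $ 2"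
      unfolding form_poisson_mul by (simp_all add: vec3_eq_iff)
    then show ?thesis
      by (simp add: vec2_eq_iff mat_scale_nth matrix_matrix_mult_def sum_2 transpose_def G
          sym_mat_entry[OF sym(1)] sym_mat_entry[OF sym(2)] mult.commute[of \<mu>])
        (simp add: algebra_simps)
  qed
  have muk: "\<mu> * k = det G * k"
  proof -
    have "f (k *s b3) = brk (form_poisson k M') (f b1) (f b2)"
      using brk[of b1 b2] by (simp add: form_poisson_brk)
    then show ?thesis unfolding form_poisson_brk f(2) z
      by (simp add: vec3_eq_iff det_2 G algebra_simps)
  qed
  have "\<mu> * det (matrix_inv G) * k = det (matrix_inv G) * (\<mu> * k)"
    by (simp only: ac_simps)
  also have "\<dots> = (det (matrix_inv G) * det G) * k"
    by (simp only: muk mult.assoc)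
  also have "\<dots> = k" by (simp only: congruence_solve(3)[OF inv eq] mult_1)
  finally show thesis
    by (rule that[OF congruence_solve(1,2)[OF inv eq] \<mu>])
qed

lemma form_poisson_isoI:
  fixes M M' C :: "'f::field ^ 2 ^ 2"
  assumes sym: "sym_mat M" and C: "invertible C" and l: "l \<noteq> 0"
    and M': "M' = mat_scale l (transpose C ** M ** C)" and k: "l * det C * k = k"
  shows "form_poisson k M \<cong>\<^sub>P form_poisson k M'"
proof -
  define f :: "'f ^ 3 \<Rightarrow> 'f ^ 3" where
    "f v = vector [C$1$1 * v$1 + C$1$2 * v$2, C$2$1 * v$1 + C$2$2 * v$2, v$3 / l]" for v
  have f_nth: "f v $ 1 = C$1$1 * v$1 + C$1$2 * v$2" "f v $ 2 = C$2$1 * v$1 + C$2$2 * v$2"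
    "f v $ 3 = v$3 / l" for v
    by (simp_all add: f_def)
  have lin: "f (x + y) = f x + f y" "f (c *s x) = c *s f x" for x y c
    by (simp_all add: vec3_eq_iff f_nth algebra_simps add_divide_distrib)
  have linear: "Vector_Spaces.linear (*s) (*s) f"
    using lin by (simp add: Vector_Spaces.linear_iff vec.vector_space_axioms)
  have "v = 0" if v: "f v = 0" for v
  proof -
    have 1: "C$1$1 * v$1 + C$1$2 * v$2 = 0" and 2: "C$2$1 * v$1 + C$2$2 * v$2 = 0" and 3: "v$3 = 0"
      using v l f_nth[of v] by (simp_all add: vec3_eq_iff)
    have "det C * v$1 = C$2$2 * (C$1$1 * v$1 + C$1$2 * v$2) - C$1$2 * (C$2$1 * v$1 + C$2$2 * v$2)"
      "det C * v$2 = C$1$1 * (C$2$1 * v$1 + C$2$2 * v$2) - C$2$1 * (C$1$1 * v$1 + C$1$2 * v$2)"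
      by (simp_all add: det_2 algebra_simps)
    then show ?thesis unfolding 1 2 using C 3 by (simp add: invertible_det_nz vec3_eq_iff)
  qed
  then have "inj f" using vec.linear_inj_iff_eq_0[OF linear] by blast
  then have bij: "bij f" by (simp add: bij_def vec.linear_inj_imp_surj[OF linear])
  have entries: "M'$1$1 = l * (C$1$1 * C$1$1 * M$1$1 + 2 * C$1$1 * C$2$1 * M$1$2 + C$2$1 * C$2$1 * M$2$2)"
    "M'$1$2 = l * (C$1$1 * C$1$2 * M$1$1 + (C$1$1 * C$2$2 + C$2$1 * C$1$2) * M$1$2 + C$2$1 * C$2$2 * M$2$2)"
    "M'$2$2 = l * (C$1$2 * C$1$2 * M$1$1 + 2 * C$1$2 * C$2$2 * M$1$2 + C$2$2 * C$2$2 * M$2$2)"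
    by (simp_all add: M' mat_scale_nth matrix_matrix_mult_def sum_2 transpose_def
        sym_mat_entry[OF sym] algebra_simps)
  have mult: "f (pmul (form_poisson k M') x y) = pmul (form_poisson k M) (f x) (f y)" for x y
    unfolding form_poisson_mul entries using l
    by (simp add: vec3_eq_iff f_nth field_simps)
  have brk: "f (brk (form_poisson k M') x y) = brk (form_poisson k M) (f x) (f y)" for x y
  proof -
    have "k / l = det C * k" using k l by (simp add: field_simps)
    moreover have "f (brk (form_poisson k M') x y) = (k / l * (x$1 * y$2 - x$2 * y$1)) *s b3"
      unfolding form_poisson_brk by (simp add: vec3_eq_iff f_nth)
    ultimately have "f (brk (form_poisson k M') x y) = (det C * k * (x$1 * y$2 - x$2 * y$1)) *s b3"
      by simp
    then show ?thesis unfolding form_poisson_brk by (simp add: f_nth det_2 algebra_simps)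
  qed
  show ?thesis
    by (rule poisson_iso_sym, rule poisson_isoI[where f = f])
      (simp_all only: form_poisson_smul vec.vector_space_axioms lin bij mult brk)
qed

text \<open>
  Some entry in the first row of \<open>M\<close> is non-zero, so \<open>b3\<close> is a multiple of a product and its image
  under an isomorphism is a multiple of \<open>b3\<close>.
\<close>

lemma P3_4_iso_iff:
  fixes M M' :: "'f::field ^ 2 ^ 2"
  assumes sym: "sym_mat M" "sym_mat M'" and det: "det M \<noteq> 0"
  shows "P3_4 M \<cong>\<^sub>P P3_4 M' \<longleftrightarrow>
    (\<exists>C l. invertible C \<and> l \<noteq> 0 \<and> M' = mat_scale l (transpose C ** M ** C))"
    (is "_ \<longleftrightarrow> ?rhs")
proof
  assume iso: "P3_4 M \<cong>\<^sub>P P3_4 M'"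
  show ?rhs
  proof (rule form_poisson_isoE[OF iso[unfolded P3_4_form]])
    fix f assume f: "\<And>x y. f (x + y) = f x + f y" "\<And>c x. f (c *s x) = c *s f x" "bij f"
      "\<And>x y. f (pmul (form_poisson 0 M) x y) = pmul (form_poisson 0 M') (f x) (f y)"
      "\<And>x y. f (brk (form_poisson 0 M) x y) = brk (form_poisson 0 M') (f x) (f y)"
    have "M$1$1 \<noteq> 0 \<or> M$1$2 \<noteq> 0" using det sym_mat_entry[OF sym(1)] by (auto simp: det_2)
    obtain c v where c: "c \<noteq> 0" and v: "c *s b3 = pmul (form_poisson 0 M) b1 v"
    proof (cases "M$1$1 = 0")
      case False
      then show thesis by (rule that[of _ b1]) (simp add: form_poisson_mul)
    next
      case True
      with \<open>M$1$1 \<noteq> 0 \<or> M$1$2 \<noteq> 0\<close> show thesis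
        by (intro that[of "M$1$2" b2]) (simp_all add: form_poisson_mul)
    qed
    have "f (c *s b3) = pmul (form_poisson 0 M') (f b1) (f v)" by (simp only: v f(4))
    then obtain t where "f (c *s b3) = t *s b3" unfolding form_poisson_mul by blast
    then have "(1 / c) *s f (c *s b3) = (t / c) *s b3" by simp
    then have "f b3 = (t / c) *s b3" using c by (simp add: f(2))
    then show ?rhs
      by (rule form_poisson_isoD[where f = f, OF sym f]) blast
  qed
next
  assume "\<exists>C l. invertible C \<and> l \<noteq> 0 \<and> M' = mat_scale l (transpose C ** M ** C)"
  then show "P3_4 M \<cong>\<^sub>P P3_4 M'"
    unfolding P3_4_form using form_poisson_isoI[OF sym(1), of _ _ M' 0] by auto
qed

text \<open>
  Here \<open>b3\<close> is a bracket, which ties the scalar to the determinant.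
\<close>

lemma P3_16_iso_iff:
  fixes M M' :: "'f::field ^ 2 ^ 2"
  assumes sym: "sym_mat M" "sym_mat M'"
  shows "P3_16 M \<cong>\<^sub>P P3_16 M' \<longleftrightarrow>
    (\<exists>C. invertible C \<and> M' = mat_scale (1 / det C) (transpose C ** M ** C))"
    (is "_ \<longleftrightarrow> ?rhs")
proof
  assume iso: "P3_16 M \<cong>\<^sub>P P3_16 M'"
  show ?rhs
  proof (rule form_poisson_isoE[OF iso[unfolded P3_16_form]])
    fix f assume f: "\<And>x y. f (x + y) = f x + f y" "\<And>c x. f (c *s x) = c *s f x" "bij f"
      "\<And>x y. f (pmul (form_poisson 1 M) x y) = pmul (form_poisson 1 M') (f x) (f y)"
      "\<And>x y. f (brk (form_poisson 1 M) x y) = brk (form_poisson 1 M') (f x) (f y)"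
    have "b3 = brk (form_poisson 1 M) b1 b2" by (simp add: form_poisson_brk)
    then have "f b3 = brk (form_poisson 1 M') (f b1) (f b2)" using f(5)[of b1 b2] by simp
    then obtain \<mu> where "f b3 = \<mu> *s b3" unfolding form_poisson_brk by blast
    then obtain C where C: "invertible C"
      "M' = mat_scale \<mu> (transpose C ** M ** C)" "\<mu> * det C * 1 = 1"
      by (rule form_poisson_isoD[where f = f, OF sym f])
    have "\<mu> = 1 / det C" using C(1,3) by (simp add: invertible_det_nz field_simps)
    then show ?rhs
      using C(1,2) by blast
  qed
next
  assume "\<exists>C. invertible C \<and> M' = mat_scale (1 / det C) (transpose C ** M ** C)"
  then obtain C where C: "invertible C" "M' = mat_scale (1 / det C) (transpose C ** M ** C)" by auto
  have "det C \<noteq> 0" using C(1) by (simp add: invertible_det_nz)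
  then show "P3_16 M \<cong>\<^sub>P P3_16 M'"
    unfolding P3_16_form by (intro form_poisson_isoI[OF sym(1) C(1) _ C(2)]) simp_all
qed

lemma P3_21_simps:
  "psmul (P3_21 A) c (a, v) = (c * a, c *s v)" "pmul (P3_21 A) p q = 0"
  "brk (P3_21 A) (a, v) (b, w) = (0, a *s (A *v w) - b *s (A *v v))"
  by (simp_all add: P3_21_def zero_assoc_def)

lemma vector_space_P3_21: "vector_space (psmul (P3_21 A))"
  by (simp add: P3_21_def zero_assoc_def vector_space_prod vector_space_field vec.vector_space_axioms)

text \<open>
  Since \<open>A\<close> is invertible, the plane \<open>V\<close> consists of brackets and is preserved by an isomorphism.  The
  restriction \<open>S\<close> satisfies \<open>S A = \<kappa> A' S\<close>, with \<open>\<kappa>\<close> the coefficient of \<open>x\<close> in the image of \<open>x\<close>.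
\<close>

lemma P3_21_iso_iff:
  fixes A A' :: "'f::field ^ 2 ^ 2"
  assumes A: "invertible A"
  shows "P3_21 A \<cong>\<^sub>P P3_21 A' \<longleftrightarrow>
    (\<exists>S l. invertible S \<and> l \<noteq> 0 \<and> A' = mat_scale l (S ** A ** matrix_inv S))" (is "_ \<longleftrightarrow> ?rhs")
proof
  assume iso: "P3_21 A \<cong>\<^sub>P P3_21 A'"
  show ?rhs
  proof (rule poisson_isoE[OF iso])
    fix f
    assume add: "\<And>x y. f (x + y) = f x + f y"
      and scale: "\<And>c x. f (psmul (P3_21 A) c x) = psmul (P3_21 A') c (f x)" and bij: "bij f"
      and brk: "\<And>x y. f (brk (P3_21 A) x y) = brk (P3_21 A') (f x) (f y)"
    have inj: "x = y" if "f x = f y" for x y using bij that by (simp add: bij_is_inj inj_eq)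
    obtain \<kappa> w0 where fx: "f (1, 0) = (\<kappa>, w0)" by (cases "f (1, 0)")
    define g where "g v = snd (f (0, v))" for v
    have AA: "A *v (matrix_inv A *v v) = v" for v
      by (simp add: matrix_vector_mul_assoc matrix_inv_unit[OF A])
    have fv: "f (0, v) = (0, g v)" for v
    proof -
      have "brk (P3_21 A) (1, 0) (0, matrix_inv A *v v) = (0, v)"
        by (simp add: P3_21_simps AA)
      then have "f (0, v) = brk (P3_21 A') (\<kappa>, w0) (f (0, matrix_inv A *v v))"
        using brk[of "(1, 0)" "(0, matrix_inv A *v v)"] by (simp only: fx)
      then have "fst (f (0, v)) = 0"
        by (cases "f (0, matrix_inv A *v v)") (simp add: P3_21_simps)
      then show ?thesis by (simp add: g_def prod_eq_iff)
    qed
    have g_add: "g (v + w) = g v + g w" for v w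
      using add[of "(0, v)" "(0, w)"] by (simp add: fv)
    have g_scale: "g (c *s v) = c *s g v" for c v
      using scale[of c "(0, v)"] by (simp add: fv P3_21_simps)
    have g_inj: "v = 0" if "g v = 0" for v
    proof -
      have "f (0, v) = f (0, 0)" using that g_scale[of 0 0] by (simp add: fv)
      then have "(0 :: 'f, v) = (0, 0)" by (rule inj)
      then show ?thesis by simp
    qed
    define S where "S = matrix g"
    have "Vector_Spaces.linear (*s) (*s) g"
      using g_add g_scale by (simp add: Vector_Spaces.linear_iff vec.vector_space_axioms)
    then have g: "g v = S *v v" for v unfolding S_def by (simp add: matrix_works)
    have S: "invertible S"
      unfolding invertible_left_inverse matrix_left_invertible_ker using g_inj g by simp
    have intertwine: "S *v (A *v v) = \<kappa> *s (A' *v (S *v v))" for v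
      using brk[of "(1, 0)" "(0, v)"] by (simp add: P3_21_simps fx fv g)
    have \<kappa>: "\<kappa> \<noteq> 0"
    proof
      assume "\<kappa> = 0"
      then have "g v = 0" for v using intertwine[of "matrix_inv A *v v"] by (simp add: AA g)
      then have "v = (0 :: 'f ^ 2)" for v using g_inj by blast
      from this[of "vector [1, 0]"] show False by (simp add: vec2_eq_iff)
    qed
    have "A' *v v = mat_scale (1 / \<kappa>) (S ** A ** matrix_inv S) *v v" for v
    proof -
      define w where "w = matrix_inv S *v v"
      have v: "v = S *v w" unfolding w_def by (simp add: matrix_vector_mul_assoc matrix_inv_unit[OF S])
      have "mat_scale (1 / \<kappa>) (S ** A ** matrix_inv S) *v v = (1 / \<kappa>) *s ((S ** A ** matrix_inv S) *v v)"
        by (simp add: vec2_eq_iff matrix_vector_mult_def mat_scale_nth sum_2 algebra_simps)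
      also have "(S ** A ** matrix_inv S) *v v = S *v (A *v w)"
        unfolding w_def by (simp only: matrix_vector_mul_assoc matrix_mul_assoc)
      finally show ?thesis using \<kappa> by (simp add: intertwine v)
    qed
    then have "A' = mat_scale (1 / \<kappa>) (S ** A ** matrix_inv S)" by (simp add: matrix_eq)
    then show ?rhs using S \<kappa> by (intro exI[of _ S] exI[of _ "1 / \<kappa>"]) simp
  qed
next
  assume ?rhs
  then obtain S l where S: "invertible S" and l: "l \<noteq> 0"
    and A': "A' = mat_scale l (S ** A ** matrix_inv S)" by auto
  define f where "f = (\<lambda>(c, w). (c / l, S *v w))"
  have f: "f (c, w) = (c / l, S *v w)" for c w by (simp add: f_def)
  have SS: "matrix_inv S *v (S *v v) = v" "S *v (matrix_inv S *v v) = v" for v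
    by (simp_all add: matrix_vector_mul_assoc matrix_inv_unit[OF S])
  have A'S: "A' *v (S *v w) = l *s (S *v (A *v w))" for w
  proof -
    have "A' *v (S *v w) = l *s ((S ** A ** matrix_inv S) *v (S *v w))"
      unfolding A' by (simp add: vec2_eq_iff matrix_vector_mult_def mat_scale_nth sum_2 algebra_simps)
    also have "(S ** A ** matrix_inv S) *v (S *v w) = S *v (A *v (matrix_inv S *v (S *v w)))"
      by (simp only: matrix_vector_mul_assoc matrix_mul_assoc)
    finally show ?thesis by (simp only: SS)
  qed
  have "bij f"
  proof (rule bijI')
    show "(f p = f q) = (p = q)" for p q
      using l SS(1) by (cases p; cases q) (auto simp: f dest: arg_cong[of _ _ "\<lambda>v. matrix_inv S *v v"])
    show "\<exists>p. q = f p" for q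
      by (rule exI[of _ "(l * fst q, matrix_inv S *v snd q)"]) (use l in \<open>simp add: f SS prod_eq_iff\<close>)
  qed
  moreover have "f (x + y) = f x + f y" for x y
    by (cases x; cases y) (simp add: f matrix_vector_right_distrib add_divide_distrib)
  moreover have "f (psmul (P3_21 A) c x) = psmul (P3_21 A') c (f x)" for c x
    by (cases x) (simp add: f P3_21_simps vec.scale matrix_vector_mult_scaleR vector_scalar_commute)
  moreover have "f (pmul (P3_21 A) x y) = pmul (P3_21 A') (f x) (f y)" for x y
    by (simp add: P3_21_simps f zero_prod_def)
  moreover have "f (brk (P3_21 A) x y) = brk (P3_21 A') (f x) (f y)" for x y
    using l by (cases x; cases y)
      (simp add: f P3_21_simps A'S matrix_vector_mult_diff_distrib vector_scalar_commute)
  ultimately show "P3_21 A \<cong>\<^sub>P P3_21 A'"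
    by (intro poisson_isoI[where f = f] vector_space_P3_21)
qed

text \<open>
  An isomorphism scales \<open>x\<close> by \<open>1\<close> modulo brackets because \<open>[x, u] = u\<close>, it scales \<open>u\<close> and \<open>v\<close> by the
  same factor because \<open>x v = u\<close>, and then \<open>[x, v] = v + q u\<close> determines \<open>q\<close>.
\<close>

lemma P3_22_iso_iff:
  fixes q q' :: "'f::field"
  shows "P3_22 q \<cong>\<^sub>P P3_22 q' \<longleftrightarrow> q = q'"
proof
  assume iso: "P3_22 q \<cong>\<^sub>P P3_22 q'"
  show "q = q'"
  proof (rule poisson_isoE[OF iso])
    fix f
    assume add: "\<And>x y. f (x + y) = f x + f y"
      and scale: "\<And>c x. f (psmul (P3_22 q) c x) = psmul (P3_22 q') c (f x)" and bij: "bij f"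
      and mult: "\<And>x y. f (pmul (P3_22 q) x y) = pmul (P3_22 q') (f x) (f y)"
      and brk: "\<And>x y. f (brk (P3_22 q) x y) = brk (P3_22 q') (f x) (f y)"
    have scale': "f (c *s x) = c *s f x" for c x using scale[of c x] by (simp add: P3_22_def)
    have P: "pmul (P3_22 q) x y = (x$1 * y$3 + x$3 * y$1) *s b2"
      "brk (P3_22 q) x y = vector [0, x$1 * y$2 - x$2 * y$1 + q * (x$1 * y$3 - x$3 * y$1),
         x$1 * y$3 - x$3 * y$1]" for q x y
      by (simp_all add: P3_22_def vec3_eq_iff comm3_nth alt3_def algebra_simps)
    have f2: "f b2 \<noteq> 0"
    proof
      assume "f b2 = 0"
      then have "f b2 = f 0" using scale'[of 0 0] by simp
      then have "b2 = (0 :: 'f ^ 3)" using bij by (simp add: bij_is_inj inj_eq)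
      then show False by simp
    qed
    have "brk (P3_22 q) b1 b2 = b2" "brk (P3_22 q) b1 b3 = b3 + q *s b2"
      "pmul (P3_22 q) b1 b2 = 0" "pmul (P3_22 q) b1 b3 = b2"
      by (simp_all add: P vec3_eq_iff)
    then have e12: "f b2 = brk (P3_22 q') (f b1) (f b2)"
      and e13: "f b3 + q *s f b2 = brk (P3_22 q') (f b1) (f b3)"
      and m12: "0 = pmul (P3_22 q') (f b1) (f b2)" and m13: "f b2 = pmul (P3_22 q') (f b1) (f b3)"
      using brk[of b1 b2] brk[of b1 b3] mult[of b1 b2] mult[of b1 b3] scale'[of 0 0]
      by (simp_all add: add scale')
    define l where "l = f b1 $ 1"
    have "f b2 $ 1 = 0" using e12 by (simp add: P vec3_eq_iff)
    moreover have "(f b3 + q *s f b2) $ 1 = 0" unfolding e13 by (simp add: P)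
    ultimately have z: "f b2 $ 1 = 0" "f b3 $ 1 = 0" by simp_all
    have "l * f b2 $ 3 = 0" using m12 z by (simp add: P vec3_eq_iff l_def)
    moreover have "f b2 $ 3 = l * f b2 $ 3"
      using arg_cong[OF e12, of "\<lambda>v. v $ 3"] z by (simp add: P l_def)
    ultimately have f23: "f b2 $ 3 = 0" by simp
    then have f22: "f b2 $ 2 \<noteq> 0" using f2 z by (simp add: vec3_eq_iff)
    have "f b2 $ 2 = l * f b2 $ 2"
      using arg_cong[OF e12, of "\<lambda>v. v $ 2"] z f23 by (simp add: P l_def)
    then have l: "l = 1" using f22 by simp
    have s: "f b2 $ 2 = f b3 $ 3"
      using arg_cong[OF m13, of "\<lambda>v. v $ 2"] z l by (simp add: P l_def)
    have "f b3 $ 2 + q * f b2 $ 2 = f b3 $ 2 + q' * f b3 $ 3"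
      using arg_cong[OF e13, of "\<lambda>v. v $ 2"] z l by (simp add: P l_def)
    then show "q = q'" using s f22 by simp
  qed
next
  assume "q = q'"
  then show "P3_22 q \<cong>\<^sub>P P3_22 q'"
    by (simp add: poisson_iso_refl P3_22_def vec.vector_space_axioms)
qed

lemma zero_lie_iso_iff: "zero_lie A \<cong>\<^sub>P zero_lie B \<longleftrightarrow> A \<cong>\<^sub>A B"
proof -
  have "f 0 = 0" if "Vector_Spaces.linear (smul A) (smul B) f" for f
    using that unfolding Vector_Spaces.linear_iff by (metis add_cancel_right_right)
  then show ?thesis by (auto simp: poisson_iso_def alg_iso_def zero_lie_def)
qed

lemma zero_assoc_iso_iff: "zero_assoc A \<cong>\<^sub>P zero_assoc B \<longleftrightarrow> A \<cong>\<^sub>A B"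
proof -
  have "f 0 = 0" if "Vector_Spaces.linear (smul A) (smul B) f" for f
    using that unfolding Vector_Spaces.linear_iff by (metis add_cancel_right_right)
  then show ?thesis by (auto simp: poisson_iso_def alg_iso_def zero_assoc_def)
qed

lemma field_extensionE:
  assumes "field_extension E"
  obtains u where "vector_space (smul E)" "u \<noteq> 0" "\<And>x. mul E u x = x" "\<And>x. mul E x u = x"
    "\<And>x y. mul E x (mul E x y) = mul E (mul E x x) y"
    "\<And>x. x \<noteq> 0 \<Longrightarrow> \<exists>y. mul E x y = u" "\<And>x. mul E x 0 = 0"
    "\<And>x. mul E 0 x = 0"
proof -
  have E: "vector_space (smul E)" "\<And>x y. mul E x y = mul E y x"
    "\<And>x y z. mul E (mul E x y) z = mul E x (mul E y z)"
    "\<And>x. Vector_Spaces.linear (smul E) (smul E) (mul E x)"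
    using assms unfolding field_extension_def comm_assoc_algebra_def algebra_over_field_def by blast+
  obtain u where u: "u \<noteq> 0" "\<And>x. mul E u x = x" "\<And>x. x \<noteq> 0 \<Longrightarrow> \<exists>y. mul E x y = u"
    using assms unfolding field_extension_def by blast
  have "mul E x u = x" for x by (simp only: E(2)[of x u] u(2))
  moreover have zero: "mul E x 0 = 0" for x
  proof -
    have "mul E x (0 + 0) = mul E x 0 + mul E x 0"
      using E(4)[of x] unfolding Vector_Spaces.linear_iff by blast
    then show ?thesis by simp
  qed
  moreover have "mul E 0 x = 0" for x by (simp only: E(2)[of 0 x] zero)
  moreover have "mul E x (mul E x y) = mul E (mul E x x) y" for x y by (simp only: E(3))
  ultimately show thesis using that[of u] E(1) u by blast
qed

text \<open>
  As \<open>E\<close> is unital, it is the square of the algebra \<open>E \<oplus> F z\<close> and hence preserved by an isomorphism.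
\<close>

lemma P3_9_iso_iff:
  fixes E :: "('f::field, 'a::ab_group_add) alg" and E' :: "('f, 'b::ab_group_add) alg"
  assumes E: "field_extension E" and E': "field_extension E'"
  shows "P3_9 E \<cong>\<^sub>P P3_9 E' \<longleftrightarrow> E \<cong>\<^sub>A E'"
proof -
  obtain u where u: "vector_space (smul E)" "\<And>x. mul E u x = x" by (rule field_extensionE[OF E]) blast
  obtain u' where u': "vector_space (smul E')" "\<And>x. mul E' u' x = x" by (rule field_extensionE[OF E']) blast
  have ops: "psmul (P3_9 E) c (x, a) = (smul E c x, c * a)"
    "pmul (P3_9 E) (x, a) (y, b) = (mul E x y, 0)" "brk (P3_9 E) p q = 0" for c x a y b p q
    and E :: "('f, 'd::ab_group_add) alg"
    by (simp_all add: P3_9_def zero_lie_def alg_prod_def null_alg_def)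
  have vs: "vector_space (psmul (P3_9 E))" if "vector_space (smul E)"
    for E :: "('f, 'd::ab_group_add) alg"
    using that by (simp add: P3_9_def zero_lie_def alg_prod_def null_alg_def vector_space_prod
        vector_space_field)
  show ?thesis
  proof
    assume iso: "P3_9 E \<cong>\<^sub>P P3_9 E'"
    show "E \<cong>\<^sub>A E'"
    proof (rule poisson_isoE[OF iso])
      fix f
      assume add: "\<And>x y. f (x + y) = f x + f y"
        and scale: "\<And>c x. f (psmul (P3_9 E) c x) = psmul (P3_9 E') c (f x)" and bij: "bij f"
        and mult: "\<And>x y. f (pmul (P3_9 E) x y) = pmul (P3_9 E') (f x) (f y)"
      define g where "g x = fst (f (x, 0))" for x
      have f: "f (x, 0) = (g x, 0)" for x
      proof -
        have "f (x, 0) = pmul (P3_9 E') (f (u, 0)) (f (x, 0))"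
          using mult[of "(u, 0)" "(x, 0)"] by (simp add: ops u)
        then have "snd (f (x, 0)) = 0"
          by (cases "f (u, 0)"; cases "f (x, 0)") (simp add: ops)
        then show ?thesis by (simp add: g_def prod_eq_iff)
      qed
      have "bij g"
      proof (rule bijI')
        show "(g x = g y) = (x = y)" for x y
          using f[of x] f[of y] bij by (metis bij_is_inj inj_eq prod.inject)
        show "\<exists>x. y = g x" for y
        proof -
          obtain p q where p: "f p = (u', 0)" and q: "f q = (y, 0)"
            using bij by (metis bij_pointE)
          have "f (pmul (P3_9 E) p q) = (y, 0)" by (simp add: mult p q ops u')
          moreover obtain x where "pmul (P3_9 E) p q = (x, 0)"
            by (cases p; cases q) (simp add: ops)
          ultimately have "f (x, 0) = (y, 0)" by simp
          then have "y = g x" by (simp add: f)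
          then show ?thesis ..
        qed
      qed
      moreover have "g (x + y) = g x + g y" for x y using add[of "(x, 0)" "(y, 0)"] by (simp add: f)
      moreover have "g (smul E c x) = smul E' c (g x)" for c x
        using scale[of c "(x, 0)"] by (simp add: f ops)
      moreover have "g (mul E x y) = mul E' (g x) (g y)" for x y
        using mult[of "(x, 0)" "(y, 0)"] by (simp add: f ops)
      ultimately show ?thesis using u(1) u'(1) by (intro alg_isoI[where f = g])
    qed
  next
    assume iso: "E \<cong>\<^sub>A E'"
    show "P3_9 E \<cong>\<^sub>P P3_9 E'"
    proof (rule alg_isoE[OF iso])
      fix g
      assume g: "\<And>x y. g (x + y) = g x + g y" "\<And>c x. g (smul E c x) = smul E' c (g x)" "bij g"
        "\<And>x y. g (mul E x y) = mul E' (g x) (g y)"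
      define f where "f p = (g (fst p), snd p)" for p :: "'a \<times> 'f"
      have "bij f"
      proof (rule bijI')
        show "(f x = f y) = (x = y)" for x y
          using bij_is_inj[OF g(3)] by (auto simp: f_def prod_eq_iff inj_eq)
        show "\<exists>x. y = f x" for y
          by (rule exI[of _ "(inv g (fst y), snd y)"])
            (use bij_is_surj[OF g(3)] in \<open>simp add: f_def surj_f_inv_f\<close>)
      qed
      moreover have "g 0 = 0" using g(1)[of 0 0] by simp
      ultimately show ?thesis using u(1) u'(1)
        by (intro poisson_isoI[where f = f] vs) (auto simp: f_def g ops zero_prod_def split: prod.split)
    qed
  qed
qed

text \<open>
  The field \<open>E\<close> is the annihilator of the idempotent \<open>(1, 0)\<close>.  This idempotent has a one-dimensional
  image, which rules out every other non-zero idempotent of \<open>F \<times> E'\<close> as its image under an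
  isomorphism because \<open>E'\<close> has dimension two.
\<close>

lemma P3_12_iso_iff:
  fixes E :: "('f::field, 'a::ab_group_add) alg" and E' :: "('f, 'b::ab_group_add) alg"
  assumes E: "quadratic_extension E" and E': "quadratic_extension E'"
  shows "P3_12 E \<cong>\<^sub>P P3_12 E' \<longleftrightarrow> E \<cong>\<^sub>A E'"
proof -
  have ext: "field_extension E" "field_extension E'"
    using E E' by (simp_all add: quadratic_extension_def)
  obtain u where u: "vector_space (smul E)" "\<And>x. mul E x 0 = 0" and mul0: "\<And>x. mul E 0 x = 0"
    by (rule field_extensionE[OF ext(1)]) blast
  obtain u' where u': "vector_space (smul E')" "u' \<noteq> 0" "\<And>x. mul E' u' x = x" "\<And>x. mul E' x u' = x"
    "\<And>x y. mul E' x (mul E' x y) = mul E' (mul E' x x) y"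
    "\<And>x. x \<noteq> 0 \<Longrightarrow> \<exists>y. mul E' x y = u'"
    and mul0': "\<And>x. mul E' 0 x = 0"
    by (rule field_extensionE[OF ext(2)]) blast
  interpret U: vector_space "smul E" by (rule u(1))
  interpret V: vector_space "smul E'" by (rule u'(1))
  have ops: "psmul (P3_12 E) c (a, x) = (c * a, smul E c x)"
    "pmul (P3_12 E) (a, x) (b, y) = (a * b, mul E x y)" "brk (P3_12 E) p q = 0" for c x a y b p q
    and E :: "('f, 'd::ab_group_add) alg"
    by (simp_all add: P3_12_def zero_lie_def alg_prod_def base_alg_def)
  have vs: "vector_space (psmul (P3_12 E))" if "vector_space (smul E)"
    for E :: "('f, 'd::ab_group_add) alg"
    using that by (simp add: P3_12_def zero_lie_def alg_prod_def base_alg_def vector_space_prod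
        vector_space_field)
  show ?thesis
  proof
    assume iso: "P3_12 E \<cong>\<^sub>P P3_12 E'"
    show "E \<cong>\<^sub>A E'"
    proof (rule poisson_isoE[OF iso])
      fix f
      assume add: "\<And>x y. f (x + y) = f x + f y"
        and scale: "\<And>c x. f (psmul (P3_12 E) c x) = psmul (P3_12 E') c (f x)" and bij: "bij f"
        and mult: "\<And>x y. f (pmul (P3_12 E) x y) = pmul (P3_12 E') (f x) (f y)"
      have "f 0 = 0" using add[of 0 0] by simp
      then have f0: "f (0, 0) = (0, 0)" by (simp add: zero_prod_def)
      have inj: "x = y" if "f x = f y" for x y using bij that by (simp add: bij_is_inj inj_eq)
      have surj: "\<exists>p. f p = q" for q using surjD[OF bij_is_surj[OF bij], of q] by metis
      obtain c w where e: "f (1, 0) = (c, w)" by (cases "f (1, 0)")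
      have idem: "c * c = c" "mul E' w w = w"
        using mult[of "(1, 0)" "(1, 0)"] by (simp_all add: ops e u)
      have line: "\<exists>s. mul E' w y = smul E' s w" for y
      proof -
        obtain p where p: "f p = (0, y)" using surj by blast
        obtain a x where ax: "p = (a, x)" by (cases p)
        have "pmul (P3_12 E) (1, 0) p = psmul (P3_12 E) a (1, 0)"
          by (simp add: ops ax mul0)
        then have "pmul (P3_12 E') (c, w) (0, y) = psmul (P3_12 E') a (c, w)"
          using mult[of "(1, 0)" p] scale[of a "(1, 0)"] by (simp add: e p)
        then show ?thesis by (auto simp: ops)
      qed
      have w: "w = 0"
      proof (rule ccontr)
        assume "w \<noteq> 0"
        then obtain y where "mul E' w y = u'" using u'(6) by blast
        then have "w = u'" using u'(5)[of w y] idem(2) u'(4) by metis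
        then have "y \<in> V.span {u'}" for y using line[of y] u'(3) by (auto simp: V.span_singleton)
        then have "V.dim UNIV \<le> card {u'}" by (intro V.dim_le_card) auto
        moreover have "V.dim UNIV = 2" using E' by (simp add: quadratic_extension_def alg_dim_def)
        ultimately show False by simp
      qed
      have c: "c = 1"
      proof -
        have "c \<noteq> 0"
        proof
          assume "c = 0"
          then have "f (1, 0) = f (0, 0)" using e w f0 by simp
          from inj[OF this] show False by simp
        qed
        then show ?thesis using idem(1) by simp
      qed
      define g where "g x = snd (f (0, x))" for x
      have f: "f (0, x) = (0, g x)" for x
      proof -
        have "pmul (P3_12 E') (1, 0) (f (0, x)) = (0, 0)"
          using mult[of "(1, 0)" "(0, x)"] by (simp add: ops e c w mul0 u f0)
        then have "fst (f (0, x)) = 0"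
          by (cases "f (0, x)") (simp add: ops)
        then show ?thesis by (simp add: g_def prod_eq_iff)
      qed
      have "bij g"
      proof (rule bijI')
        show "(g x = g y) = (x = y)" for x y
          using inj[of "(0, x)" "(0, y)"] by (auto simp: f)
        show "\<exists>x. y = g x" for y
        proof -
          obtain p where p: "f p = (0, y)" using surj by blast
          obtain a x where ax: "p = (a, x)" by (cases p)
          have "f (a, 0) = f (0, 0)"
            using mult[of "(1, 0)" p] by (simp add: ops ax mul0 mul0' e c w p[unfolded ax] f0)
          from inj[OF this] have "a = 0" by simp
          then have "y = g x" using p ax f by simp
          then show ?thesis ..
        qed
      qed
      moreover have "g (x + y) = g x + g y" for x y using add[of "(0, x)" "(0, y)"] by (simp add: f)
      moreover have "g (smul E c x) = smul E' c (g x)" for c x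
        using scale[of c "(0, x)"] by (simp add: f ops)
      moreover have "g (mul E x y) = mul E' (g x) (g y)" for x y
        using mult[of "(0, x)" "(0, y)"] by (simp add: f ops)
      ultimately show ?thesis using u(1) u'(1) by (intro alg_isoI[where f = g])
    qed
  next
    assume iso: "E \<cong>\<^sub>A E'"
    show "P3_12 E \<cong>\<^sub>P P3_12 E'"
    proof (rule alg_isoE[OF iso])
      fix g
      assume g: "\<And>x y. g (x + y) = g x + g y" "\<And>c x. g (smul E c x) = smul E' c (g x)" "bij g"
        "\<And>x y. g (mul E x y) = mul E' (g x) (g y)"
      define f where "f p = (fst p, g (snd p))" for p :: "'f \<times> 'a"
      have "bij f"
      proof (rule bijI')
        show "(f x = f y) = (x = y)" for x y
          using bij_is_inj[OF g(3)] by (auto simp: f_def prod_eq_iff inj_eq)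
        show "\<exists>x. y = f x" for y
          by (rule exI[of _ "(fst y, inv g (snd y))"])
            (use bij_is_surj[OF g(3)] in \<open>simp add: f_def surj_f_inv_f\<close>)
      qed
      moreover have "g 0 = 0" using g(1)[of 0 0] by simp
      ultimately show ?thesis using u(1) u'(1)
        by (intro poisson_isoI[where f = f] vs) (auto simp: f_def g ops zero_prod_def split: prod.split)
    qed
  qed
qed

section \<open>The classification\<close>

theorem theorem5p7:
  shows
    "(\<forall>P :: ('f::field, 'v::ab_group_add) poisson. poisson_algebra P \<and> poisson_dim P = 3 \<longrightarrow>
        P \<cong>\<^sub>P (P3_1 :: ('f, 'f ^ 3) poisson) \<or> P \<cong>\<^sub>P (P3_2 :: ('f, 'f ^ 3) poisson) \<or>
        P \<cong>\<^sub>P (P3_3 :: ('f, 'f ^ 3) poisson) \<or>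
        (\<exists>M :: 'f ^ 2 ^ 2. sym_mat M \<and> det M \<noteq> 0 \<and> P \<cong>\<^sub>P P3_4 M) \<or>
        P \<cong>\<^sub>P (P3_5 :: ('f, 'f ^ 3) poisson) \<or> P \<cong>\<^sub>P (P3_6 :: ('f, 'f ^ 3) poisson) \<or>
        P \<cong>\<^sub>P (P3_7 :: ('f, 'f ^ 3) poisson) \<or> P \<cong>\<^sub>P (P3_8 :: ('f, 'f ^ 3) poisson) \<or>
        (\<exists>E :: ('f, 'f ^ 2) alg. quadratic_extension E \<and> P \<cong>\<^sub>P P3_9 E) \<or>
        P \<cong>\<^sub>P (P3_10 :: ('f, 'f \<times> 'f \<times> 'f) poisson) \<or>
        P \<cong>\<^sub>P (P3_11 :: ('f, 'f \<times> 'f \<times> 'f) poisson) \<or>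
        (\<exists>E :: ('f, 'f ^ 2) alg. quadratic_extension E \<and> P \<cong>\<^sub>P P3_12 E) \<or>
        (\<exists>K :: ('f, 'f ^ 3) alg. cubic_extension K \<and> P \<cong>\<^sub>P P3_13 K) \<or>
        P \<cong>\<^sub>P (P3_14 :: ('f, 'f ^ 3) poisson) \<or> P \<cong>\<^sub>P (P3_15 :: ('f, 'f ^ 3) poisson) \<or>
        (\<exists>M :: 'f ^ 2 ^ 2. sym_mat M \<and> P \<cong>\<^sub>P P3_16 M) \<or>
        P \<cong>\<^sub>P (P3_17 :: ('f, 'f ^ 3) poisson) \<or> P \<cong>\<^sub>P (P3_18 :: ('f, 'f ^ 3) poisson) \<or>
        P \<cong>\<^sub>P (P3_19 :: ('f, 'f ^ 3) poisson) \<or> P \<cong>\<^sub>P (P3_20 :: ('f, 'f ^ 3) poisson) \<or>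
        (\<exists>A :: 'f ^ 2 ^ 2. invertible A \<and> P \<cong>\<^sub>P P3_21 A) \<or>
        (CHAR('f) = 2 \<and> (\<exists>q :: 'f. P \<cong>\<^sub>P P3_22 q)) \<or>
        (\<exists>L :: ('f, 'f ^ 3) alg. simple_lie_algebra3 L \<and> P \<cong>\<^sub>P P3_23 L))
     \<and> (\<forall>M M' :: 'f ^ 2 ^ 2. sym_mat M \<and> det M \<noteq> 0 \<and> sym_mat M' \<and> det M' \<noteq> 0 \<longrightarrow>
          (P3_4 M \<cong>\<^sub>P P3_4 M' \<longleftrightarrow>
            (\<exists>C l. invertible C \<and> l \<noteq> 0 \<and> M' = mat_scale l (transpose C ** M ** C))))
     \<and> (\<forall>M M' :: 'f ^ 2 ^ 2. sym_mat M \<and> sym_mat M' \<longrightarrow>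
          (P3_16 M \<cong>\<^sub>P P3_16 M' \<longleftrightarrow>
            (\<exists>C. invertible C \<and> M' = mat_scale (1 / det C) (transpose C ** M ** C))))
     \<and> (\<forall>A A' :: 'f ^ 2 ^ 2. invertible A \<and> invertible A' \<longrightarrow>
          (P3_21 A \<cong>\<^sub>P P3_21 A' \<longleftrightarrow>
            (\<exists>S l. invertible S \<and> l \<noteq> 0 \<and> A' = mat_scale l (S ** A ** matrix_inv S))))
     \<and> (CHAR('f) = 2 \<longrightarrow> (\<forall>q q' :: 'f. P3_22 q \<cong>\<^sub>P P3_22 q' \<longleftrightarrow> q = q'))
     \<and> (\<forall>(E :: ('f, 'a::ab_group_add) alg) (E' :: ('f, 'b::ab_group_add) alg).
          quadratic_extension E \<and> quadratic_extension E' \<longrightarrow>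
          (P3_9 E \<cong>\<^sub>P P3_9 E' \<longleftrightarrow> E \<cong>\<^sub>A E') \<and> (P3_12 E \<cong>\<^sub>P P3_12 E' \<longleftrightarrow> E \<cong>\<^sub>A E'))
     \<and> (\<forall>(K :: ('f, 'a) alg) (K' :: ('f, 'b) alg).
          cubic_extension K \<and> cubic_extension K' \<longrightarrow> (P3_13 K \<cong>\<^sub>P P3_13 K' \<longleftrightarrow> K \<cong>\<^sub>A K'))
     \<and> (\<forall>(L :: ('f, 'a) alg) (L' :: ('f, 'b) alg).
          simple_lie_algebra3 L \<and> simple_lie_algebra3 L' \<longrightarrow>
          (P3_23 L \<cong>\<^sub>P P3_23 L' \<longleftrightarrow> L \<cong>\<^sub>A L'))"
proof (intro conjI allI impI, goal_cases)
  case (1 P)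
  then have "zero_lie_type P \<or> lie_type P" by (simp add: poisson_classification)
  then show ?case by (elim disjE zero_lie_type.cases lie_type.cases) blast+
next
  case (2 M M')
  then show ?case by (simp add: P3_4_iso_iff)
next
  case (3 M M')
  then show ?case by (simp add: P3_16_iso_iff)
next
  case (4 A A')
  then show ?case by (simp add: P3_21_iso_iff)
next
  case (5 q q')
  show ?case by (rule P3_22_iso_iff)
next
  case (6 E E')
  then show ?case by (simp add: P3_9_iso_iff quadratic_extension_def)
next
  case (7 E E')
  then show ?case by (simp add: P3_12_iso_iff)
next
  case (8 K K')
  show ?case by (simp add: P3_13_def zero_lie_iso_iff)
next
  case (9 L L')
  show ?case by (simp add: P3_23_def zero_assoc_iso_iff)
qed

end
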